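(* Let $\mathcal G=(V,E,\mathfrak c)$ be a countably infinite connected graph with conductances such that $\pi(x)=\sum_{y\sim x}\mathfrak c(x,y)<\infty$ for all $x\in V$. Let $(\tilde{\mathcal E},\tilde{\mathcal F})$ be the Dirichlet form on $L^2(V,m)$ corresponding to the random walk reflected off of infinity on $\mathcal G$ with rate function $\mathfrak w$, where $m=\pi/\mathfrak w$. Then $\tilde{\mathcal F}=\mathcal F^{\mathrm{ref}}\cap L^2(V,m)$, where $$\mathcal F^{\mathrm{ref}}=\{f:V\to\mathbb R\;:\;\operatorname{Energy}(f)<\infty\}=\mathcal F_e\oplus\{\text{finite-energy discrete harmonic functions on }\mathcal G\}$$ is known as the reflected Dirichlet space, and $\tilde{\mathcal E}(f,f)=\operatorname{Energy}(f)$ for $f\in\tilde{\mathcal F}$.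
   Context: $\mathcal G=(V,E,\mathfrak c)$ is a graph with vertex set $V$, set $E$ of unoriented edges and conductance function $\mathfrak c:E\to(0,\infty)$. Write $x\sim y$ if $x$ and $y$ are joined by an edge, in which case $\mathfrak c(x,y)=\mathfrak c(y,x)$ is its conductance. Vertices may have infinite degree. Energy and harmonic functions. $\operatorname{Energy}(f)=\sum_{\{x,y\}\in E}\mathfrak c(x,y)|f(y)-f(x)|^2$, and for $f,g$ of finite energy $\mathcal E(f,g)=\frac12\sum_{x\in V}\sum_{y\sim x}\mathfrak c(x,y)(f(x)-f(y))(g(x)-g(y))$, so $\mathcal E(f,f)=\operatorname{Energy}(f)$. A function $h:V\to\mathbb R$ is discrete harmonic on $\mathcal G$ if for every $x\in V$ the sum $\sum_{y\sim x}\mathfrak c(x,y)(h(y)-h(x))$ converges absolutely and equals $0$. For each non-empty finite $\mathcal A\subset V$ and $\phi:\mathcal A\to\mathbb R$ there is a unique $h^\phi:V\to\mathbb R$ with $h^\phi|_{\mathcal A}=\phi$ of minimal energy among all functions $f:V\to\mathbb R$ with $f|_{\mathcal A}=\phi$. Extended Dirichlet space. $\mathcal F_e=\{f:V\to\mathbb R : \operatorname{Energy}(f)<\infty,\ \mathcal E(f,h)=0 \text{ for any finite-energy discrete harmonic function } h \text{ on } V\}$; this is the extended Dirichlet space of $(\mathcal E,L^2(V,\pi))$. The symbol $\oplus$ denotes the sum of two subspaces that are orthogonal with respect to the semi-inner product $\mathcal E$ (which vanishes on constants). Random walk reflected off of infinity. There is a function $\mathfrak w_*:V\to(0,\infty)$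 such that for every $\mathfrak w:V\to(0,\infty)$ with $\mathfrak w\ge\mathfrak w_*$ pointwise there is a unique (in law) family of processes $X:[0,\infty)\to V\cup\{\infty\}$, started from $X_0=z$ for each $z\in V$ (law $\mathbb P_z$), such that: (i) for each $t\ge0$, a.s. $X_t\in V$ and $X$ is constant on a neighbourhood of $t$ in $[0,\infty)$; (ii) a.s., for every $t\ge 0$ with $X_t\in V$ there is $\varepsilon>0$ with $X_s=X_t$ for all $s\in[t,t+\varepsilon]$; (iii) with $\tau=\min\{t>0:X_t\ne z\}$, $\tau$ and $X_\tau$ are independent, $\tau$ is exponential with rate $\mathfrak w(z)$, and $\mathbb P_z[X_\tau=x]=\mathfrak c(z,x)/\pi(z)$ for $x\sim z$; (iv) for $t\ge0$ and $x\in V$, on $\{X_t=x\}$ the conditional law of $\{X_{s+t}\}_{s\ge0}$ given $\{X_s\}_{s\le t}$ is the law of $X$ under $\mathbb P_x$; (v) a.s. there are arbitrarily large $t$ with $X_t=z$; (vi) for every non-empty finite $\mathcal A\subset V$, $\phi:\mathcal A\to\mathbb R$ and $z\in V$, with $\tau=\min\{t\ge0:X_t\in\mathcal A\}$, $h^\phi(z)=\mathbb E_z[\phi(X_\tau)]$. Fix such $\mathfrak w_*$ and $\mathfrak w\ge\mathfrak w_*$; $X$ denotes this process. Dirichlet form. $m$ is the measure on $V$ with $m(\{x\})=\pi(x)/\mathfrak w(x)$. Let $p_t(x,y)=\mathbb P_x[X_t=y]$ and $T_tf(x)=\sum_{y\in V}p_t(x,y)f(y)$, a strongly continuous symmetric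 contraction semigroup on $L^2(V,m)$. The corresponding Dirichlet form is given by $\tilde{\mathcal E}(f,f)=\lim_{t\downarrow0}\frac1t(f-T_tf,f)_{L^2(m)}$ (an increasing limit), with domain $\tilde{\mathcal F}$ the set of $f\in L^2(V,m)$ for which this limit is finite. *)

theory Defs
  imports "HOL-Probability.Probability"
begin

text \<open>The vertex set is the whole type \<open>'v\<close>, so that functions on vertices are plain HOL functions.
  Edges are unordered pairs of distinct vertices; values of \<open>c\<close> outside \<open>E\<close> are never used.\<close>

locale conductance_graph =
  fixes E :: "'v set set" and c :: "'v set \<Rightarrow> real"
  assumes edge_pair: "e \<in> E \<Longrightarrow> \<exists>x y. x \<noteq> y \<and> e = {x, y}"
    and conductance_pos: "e \<in> E \<Longrightarrow> c e > 0"

definition nbrs :: "'v set set \<Rightarrow> 'v \<Rightarrow> 'v set" where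
  "nbrs E x = {y. {x, y} \<in> E}"

definition graph_connected :: "'v set set \<Rightarrow> bool" where
  "graph_connected E \<longleftrightarrow> (\<forall>x y. (x, y) \<in> {(a, b). {a, b} \<in> E}\<^sup>*)"

text \<open>The total conductance \<open>\<pi>(x)\<close>. Degrees may be infinite, so its finiteness is a separate
  condition (\<open>infsum\<close> of a non-summable real family is 0).\<close>

definition finite_total_conductance :: "'v set set \<Rightarrow> ('v set \<Rightarrow> real) \<Rightarrow> bool" where
  "finite_total_conductance E c \<longleftrightarrow> (\<forall>x. (\<lambda>y. c {x, y}) summable_on nbrs E x)"

definition total_conductance :: "'v set set \<Rightarrow> ('v set \<Rightarrow> real) \<Rightarrow> 'v \<Rightarrow> real" where
  "total_conductance E c x = (\<Sum>\<^sub>\<infinity>y\<in>nbrs E x. c {x, y})"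

section \<open>Energy and harmonic functions\<close>

text \<open>\<open>\<bar>f y - f x\<bar>\<^sup>2\<close> as a function of the unordered pair \<open>{x, y}\<close>.\<close>

definition edge_sq_diff :: "('v \<Rightarrow> real) \<Rightarrow> 'v set \<Rightarrow> real" where
  "edge_sq_diff f e = (THE d. \<exists>x y. e = {x, y} \<and> d = \<bar>f y - f x\<bar>\<^sup>2)"

lemma edge_sq_diff_pair [simp]: "edge_sq_diff f {x, y} = \<bar>f y - f x\<bar>\<^sup>2"
  unfolding edge_sq_diff_def
  by (rule the_equality) (auto simp: doubleton_eq_iff power2_commute)

definition energy :: "'v set set \<Rightarrow> ('v set \<Rightarrow> real) \<Rightarrow> ('v \<Rightarrow> real) \<Rightarrow> ennreal" where
  "energy E c f = (\<Sum>\<^sub>\<infinity>e\<in>E. ennreal (c e * edge_sq_diff f e))"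

text \<open>Only meaningful for \<open>f\<close> and \<open>g\<close> of finite energy.\<close>

definition energy_form ::
    "'v set set \<Rightarrow> ('v set \<Rightarrow> real) \<Rightarrow> ('v \<Rightarrow> real) \<Rightarrow> ('v \<Rightarrow> real) \<Rightarrow> real" where
  "energy_form E c f g =
     1 / 2 * (\<Sum>\<^sub>\<infinity>x\<in>UNIV. \<Sum>\<^sub>\<infinity>y\<in>nbrs E x. c {x, y} * (f x - f y) * (g x - g y))"

definition discrete_harmonic ::
    "'v set set \<Rightarrow> ('v set \<Rightarrow> real) \<Rightarrow> ('v \<Rightarrow> real) \<Rightarrow> bool" where
  "discrete_harmonic E c h \<longleftrightarrow>
     (\<forall>x. (\<lambda>y. \<bar>c {x, y} * (h y - h x)\<bar>) summable_on nbrs E x \<and>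
          (\<Sum>\<^sub>\<infinity>y\<in>nbrs E x. c {x, y} * (h y - h x)) = 0)"

text \<open>The energy-minimising extension \<open>h\<^sup>\<phi>\<close> of \<open>\<phi>\<close> from \<open>A\<close>; only the values of \<open>\<phi>\<close> on \<open>A\<close> matter.\<close>

definition min_energy_ext ::
    "'v set set \<Rightarrow> ('v set \<Rightarrow> real) \<Rightarrow> 'v set \<Rightarrow> ('v \<Rightarrow> real) \<Rightarrow> 'v \<Rightarrow> real" where
  "min_energy_ext E c A \<phi> =
     (THE h. (\<forall>x\<in>A. h x = \<phi> x) \<and>
             (\<forall>f. (\<forall>x\<in>A. f x = \<phi> x) \<longrightarrow> energy E c h \<le> energy E c f))"

definition finite_energy_harmonic :: "'v set set \<Rightarrow> ('v set \<Rightarrow> real) \<Rightarrow> ('v \<Rightarrow> real) set" where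
  "finite_energy_harmonic E c = {h. energy E c h < \<infinity> \<and> discrete_harmonic E c h}"

definition extended_dirichlet_space :: "'v set set \<Rightarrow> ('v set \<Rightarrow> real) \<Rightarrow> ('v \<Rightarrow> real) set" where
  "extended_dirichlet_space E c =
     {f. energy E c f < \<infinity> \<and> (\<forall>h\<in>finite_energy_harmonic E c. energy_form E c f h = 0)}"

definition reflected_dirichlet_space :: "'v set set \<Rightarrow> ('v set \<Rightarrow> real) \<Rightarrow> ('v \<Rightarrow> real) set" where
  "reflected_dirichlet_space E c = {f. energy E c f < \<infinity>}"

definition function_subspace :: "('v \<Rightarrow> real) set \<Rightarrow> bool" where
  "function_subspace S \<longleftrightarrow>
     (\<lambda>_. 0) \<in> S \<and> (\<forall>f\<in>S. \<forall>g\<in>S. (\<lambda>x. f x + g x) \<in> S) \<and> (\<forall>a. \<forall>f\<in>S. (\<lambda>x. a * f x) \<in> S)"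

text \<open>\<open>S = A \<oplus> B\<close>: orthogonality is with respect to the semi-inner product \<open>energy_form\<close>, which
  vanishes on constants, so \<open>A \<inter> B\<close> may contain the constants.\<close>

definition energy_orthogonal_sum ::
    "'v set set \<Rightarrow> ('v set \<Rightarrow> real) \<Rightarrow>
     ('v \<Rightarrow> real) set \<Rightarrow> ('v \<Rightarrow> real) set \<Rightarrow> ('v \<Rightarrow> real) set \<Rightarrow> bool" where
  "energy_orthogonal_sum E c S A B \<longleftrightarrow>
     function_subspace A \<and> function_subspace B \<and>
     (\<forall>f\<in>A. \<forall>g\<in>B. energy_form E c f g = 0) \<and>
     S = {\<lambda>x. f x + g x | f g. f \<in> A \<and> g \<in> B}"

section \<open>Random walk reflected off of infinity\<close>

text \<open>The point \<open>\<infinity>\<close> is \<open>None\<close>. \<open>X z\<close> is the process started from \<open>z\<close>, defined on the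
  probability space \<open>P z\<close> and indexed by times \<open>t \<ge> 0\<close>; its values at negative times are irrelevant.

  For a set of times bounded below, \<open>Inf T \<in> T\<close> says that \<open>T\<close> has a minimum (and is non-empty).
  Exit and hitting times are determined by countably many coordinates only up to null sets, so
  quantities involving them are measured with respect to \<open>completion (P z)\<close>.\<close>

definition exit_times :: "(real \<Rightarrow> 'w \<Rightarrow> 'v option) \<Rightarrow> 'v \<Rightarrow> 'w \<Rightarrow> real set" where
  "exit_times Y z \<omega> = {t. 0 < t \<and> Y t \<omega> \<noteq> Some z}"

definition hitting_times :: "(real \<Rightarrow> 'w \<Rightarrow> 'v option) \<Rightarrow> 'v set \<Rightarrow> 'w \<Rightarrow> real set" where
  "hitting_times Y A \<omega> = {t. 0 \<le> t \<and> Y t \<omega> \<in> Some ` A}"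

definition sample_path :: "(real \<Rightarrow> 'w \<Rightarrow> 'v option) \<Rightarrow> 'w \<Rightarrow> real \<Rightarrow> 'v option" where
  "sample_path Y \<omega> = (\<lambda>t\<in>{0..}. Y t \<omega>)"

abbreviation path_space :: "(real \<Rightarrow> 'v option) measure" where
  "path_space \<equiv> Pi\<^sub>M {0..} (\<lambda>_. count_space UNIV)"

definition process_law ::
    "'w measure \<Rightarrow> (real \<Rightarrow> 'w \<Rightarrow> 'v option) \<Rightarrow> (real \<Rightarrow> 'v option) measure" where
  "process_law M Y = distr M path_space (sample_path Y)"

text \<open>The \<open>\<sigma>\<close>-algebra generated by \<open>Y s\<close> for \<open>0 \<le> s \<le> t\<close>.\<close>

definition past :: "'w measure \<Rightarrow> (real \<Rightarrow> 'w \<Rightarrow> 'v option) \<Rightarrow> real \<Rightarrow> 'w measure" where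
  "past M Y t =
     vimage_algebra (space M) (\<lambda>\<omega>. \<lambda>s\<in>{0..t}. Y s \<omega>) (Pi\<^sub>M {0..t} (\<lambda>_. count_space UNIV))"

text \<open>\<open>prob_space.indep_var\<close> for random variables whose value types may differ.\<close>

definition independent_rvs ::
    "'w measure \<Rightarrow> 'a measure \<Rightarrow> ('w \<Rightarrow> 'a) \<Rightarrow> 'b measure \<Rightarrow> ('w \<Rightarrow> 'b) \<Rightarrow> bool" where
  "independent_rvs M N Y N' Y' \<longleftrightarrow>
     Y \<in> measurable M N \<and> Y' \<in> measurable M N' \<and>
     prob_space.indep_set M {Y -` A \<inter> space M | A. A \<in> sets N} {Y' -` A \<inter> space M | A. A \<in> sets N'}"

locale reflected_walk =
  fixes E :: "'v set set" and c :: "'v set \<Rightarrow> real" and w :: "'v \<Rightarrow> real"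
    and P :: "'v \<Rightarrow> 'w measure" and X :: "'v \<Rightarrow> real \<Rightarrow> 'w \<Rightarrow> 'v option"
  assumes prob_space_P: "prob_space (P z)"
    and measurable_X: "t \<ge> 0 \<Longrightarrow> X z t \<in> measurable (P z) (count_space UNIV)"
    and start: "AE \<omega> in P z. X z 0 \<omega> = Some z"
    and locally_constant_at: "t \<ge> 0 \<Longrightarrow>
      AE \<omega> in P z. X z t \<omega> \<noteq> None \<and>
        (\<exists>\<epsilon>>0. \<forall>s\<ge>0. \<bar>s - t\<bar> < \<epsilon> \<longrightarrow> X z s \<omega> = X z t \<omega>)"
    and right_constant:
      "AE \<omega> in P z. \<forall>t\<ge>0. X z t \<omega> \<noteq> None \<longrightarrow>
        (\<exists>\<epsilon>>0. \<forall>s\<in>{t..t + \<epsilon>}. X z s \<omega> = X z t \<omega>)"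
    and exit_attained: "AE \<omega> in P z. Inf (exit_times (X z) z \<omega>) \<in> exit_times (X z) z \<omega>"
    and exit_indep:
      "independent_rvs (completion (P z))
         borel (\<lambda>\<omega>. Inf (exit_times (X z) z \<omega>))
         (count_space UNIV) (\<lambda>\<omega>. X z (Inf (exit_times (X z) z \<omega>)) \<omega>)"
    and exit_exponential:
      "distributed (completion (P z)) lborel (\<lambda>\<omega>. Inf (exit_times (X z) z \<omega>))
         (exponential_density (w z))"
    and exit_position: "x \<in> nbrs E z \<Longrightarrow>
      measure (completion (P z)) {\<omega>\<in>space (P z). X z (Inf (exit_times (X z) z \<omega>)) \<omega> = Some x}
        = c {z, x} / total_conductance E c z"
    and markov: "t \<ge> 0 \<Longrightarrow> B \<in> sets path_space \<Longrightarrow>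
      AE \<omega> in P z. X z t \<omega> = Some x \<longrightarrow>
        real_cond_exp (P z) (past (P z) (X z) t)
          (indicator {\<omega>'\<in>space (P z). sample_path (\<lambda>s. X z (s + t)) \<omega>' \<in> B}) \<omega>
        = measure (process_law (P x) (X x)) B"
    and recurrent: "AE \<omega> in P z. \<forall>T. \<exists>t. t > T \<and> t \<ge> 0 \<and> X z t \<omega> = Some z"
    and hitting_attained: "finite A \<Longrightarrow> A \<noteq> {} \<Longrightarrow>
      AE \<omega> in P z. Inf (hitting_times (X z) A \<omega>) \<in> hitting_times (X z) A \<omega>"
    and hitting_value: "finite A \<Longrightarrow> A \<noteq> {} \<Longrightarrow>
      min_energy_ext E c A \<phi> z =
        prob_space.expectation (completion (P z))
          (\<lambda>\<omega>. \<phi> (the (X z (Inf (hitting_times (X z) A \<omega>)) \<omega>)))"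

text \<open>The defining property of the threshold rate function \<open>w0\<close>: for every rate function above it, the reflected walk exists
  and is unique in law. Quantifying over processes whose sample points have the type of paths is no
  restriction, as a process may be transported to the space of its paths.\<close>

definition reflection_threshold ::
    "'v set set \<Rightarrow> ('v set \<Rightarrow> real) \<Rightarrow> ('v \<Rightarrow> real) \<Rightarrow> bool" where
  "reflection_threshold E c w0 \<longleftrightarrow>
     (\<forall>x. w0 x > 0) \<and>
     (\<forall>w. (\<forall>x. w0 x \<le> w x) \<longrightarrow>
        (\<exists>(P :: 'v \<Rightarrow> (real \<Rightarrow> 'v option) measure) X. reflected_walk E c w P X) \<and>
        (\<forall>(P :: 'v \<Rightarrow> (real \<Rightarrow> 'v option) measure) X
          (P' :: 'v \<Rightarrow> (real \<Rightarrow> 'v option) measure) X'.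
            reflected_walk E c w P X \<longrightarrow> reflected_walk E c w P' X' \<longrightarrow>
            (\<forall>z. process_law (P z) (X z) = process_law (P' z) (X' z))))"

section \<open>The Dirichlet form of the reflected walk\<close>

definition speed_measure ::
    "'v set set \<Rightarrow> ('v set \<Rightarrow> real) \<Rightarrow> ('v \<Rightarrow> real) \<Rightarrow> 'v measure" where
  "speed_measure E c w = point_measure UNIV (\<lambda>x. ennreal (total_conductance E c x / w x))"

definition L2 :: "'a measure \<Rightarrow> ('a \<Rightarrow> real) set" where
  "L2 M = {f \<in> borel_measurable M. integrable M (\<lambda>x. (f x)\<^sup>2)}"

definition L2_inner :: "'a measure \<Rightarrow> ('a \<Rightarrow> real) \<Rightarrow> ('a \<Rightarrow> real) \<Rightarrow> real" where
  "L2_inner M f g = (\<integral>x. f x * g x \<partial>M)"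

definition transition_prob ::
    "('v \<Rightarrow> 'w measure) \<Rightarrow> ('v \<Rightarrow> real \<Rightarrow> 'w \<Rightarrow> 'v option) \<Rightarrow> real \<Rightarrow> 'v \<Rightarrow> 'v \<Rightarrow> real" where
  "transition_prob P X t x y = measure (P x) {\<omega>\<in>space (P x). X x t \<omega> = Some y}"

definition semigroup_op ::
    "('v \<Rightarrow> 'w measure) \<Rightarrow> ('v \<Rightarrow> real \<Rightarrow> 'w \<Rightarrow> 'v option) \<Rightarrow> real \<Rightarrow> ('v \<Rightarrow> real) \<Rightarrow> 'v \<Rightarrow> real" where
  "semigroup_op P X t f x = (\<Sum>\<^sub>\<infinity>y\<in>UNIV. transition_prob P X t x y * f y)"

definition approx_form ::
    "'v measure \<Rightarrow> ('v \<Rightarrow> 'w measure) \<Rightarrow> ('v \<Rightarrow> real \<Rightarrow> 'w \<Rightarrow> 'v option) \<Rightarrow>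
     ('v \<Rightarrow> real) \<Rightarrow> real \<Rightarrow> real" where
  "approx_form m P X f t = 1 / t * L2_inner m (\<lambda>x. f x - semigroup_op P X t f x) f"

definition dirichlet_domain ::
    "'v measure \<Rightarrow> ('v \<Rightarrow> 'w measure) \<Rightarrow> ('v \<Rightarrow> real \<Rightarrow> 'w \<Rightarrow> 'v option) \<Rightarrow> ('v \<Rightarrow> real) set" where
  "dirichlet_domain m P X =
     {f \<in> L2 m. \<exists>l::real. (approx_form m P X f \<longlongrightarrow> l) (at_right 0)}"

text \<open>The diagonal value of the form at \<open>f\<close>, for \<open>f\<close> in \<open>dirichlet_domain\<close>.\<close>

definition dirichlet_form ::
    "'v measure \<Rightarrow> ('v \<Rightarrow> 'w measure) \<Rightarrow> ('v \<Rightarrow> real \<Rightarrow> 'w \<Rightarrow> 'v option) \<Rightarrow> ('v \<Rightarrow> real) \<Rightarrow> real" where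
  "dirichlet_form m P X f = Lim (at_right 0) (approx_form m P X f)"

end

theory Submission
  imports Defs
begin

text \<open>Let \<open>R\<^sub>l\<close> be the resolvent of the reflected walk and \<open>G\<^sub>l\<close> the resolvent of the form
  \<open>(Energy, F\<^bsup>ref\<^esup> \<inter> L\<^sup>2(m))\<close>. The strong Markov property at the first jump shows that \<open>u = R\<^sub>l \<delta>\<^sub>y\<close> satisfies
  the resolvent equation at every vertex, and at the hitting time of a finite set \<open>A \<ni> y\<close> it gives
  \<open>u \<le> h\<^sup>u\<close>, the energy-minimising extension from \<open>A\<close>. Exhausting \<open>V\<close> by finite sets, \<open>u\<close> is a weak
  subsolution, so \<open>R\<^sub>l \<delta>\<^sub>y \<le> G\<^sub>l \<delta>\<^sub>y\<close>. Since the walk never dies, \<open>l \<Sum>\<^sub>y R\<^sub>l \<delta>\<^sub>y = 1\<close>, whereas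
  \<open>l \<Sum>\<^sub>y G\<^sub>l \<delta>\<^sub>y \<le> 1\<close> because the energy form is Markovian; hence \<open>R\<^sub>l = G\<^sub>l\<close>. In particular \<open>R\<^sub>l\<close> is
  symmetric and, by uniqueness of Laplace transforms, so is the semigroup. The form of the semigroup is
  then the limit of \<open>l \<langle>f - l G\<^sub>l f, f\<rangle> = min\<^sub>v (Energy(v) + l \<parallel>v - f\<parallel>\<^sup>2)\<close> as \<open>l \<rightarrow> \<infinity>\<close>, which is
  \<open>Energy(f)\<close>. The orthogonal decomposition is the energy projection onto the closure of the finitely
  supported functions.\<close>

text \<open>The obstacle is probabilistic. Paths may make infinitely many jumps in finite time and
  come back from infinity, so there is no jump chain to condition on; the Markov property is assumed
  at fixed times only, and hitting and exit times are measurable only for the completion. Every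
  stopping argument is therefore run on the grid of multiples of \<open>mesh n\<close>, where the
  first visit takes countably many values and the fixed-time property suffices; since paths are
  right-constant at vertices, the grid visit converges to the true one from above. The limit yields
  upper bounds for the resolvent only, which is why the analysis is set up for subsolutions. On the
  analytic side, small times and large \<open>l\<close> are compared without spectral calculus,
  through two facts: the quotient of the semigroup form by \<open>t\<close> decreases in
  \<open>t\<close>, and the resolvent form is the average of the semigroup form over an exponential
  time. Multiplying the exponential density by \<open>t\<close> gives a multiple of the density
  \<open>l^2 * t * exp (- l * t)\<close>, whose mass concentrates at zero as \<open>l\<close>
  grows.\<close>

lemma quadratic_nonneg_imp_linear_zero:
  fixes b q :: real
  assumes "\<And>t. 0 \<le> t * b + t\<^sup>2 * q"
  shows "b = 0"
proof (rule ccontr)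
  assume "b \<noteq> 0"
  \<comment> \<open>The minimiser of \<open>t * b + t^2 * (|q| + 1)\<close>. Adding 1 keeps the
    denominator positive when \<open>q\<close> is zero.\<close>
  define t where "t = - b / (2 * (\<bar>q\<bar> + 1))"
  have "t * b + t\<^sup>2 * q \<le> t * b + t\<^sup>2 * (\<bar>q\<bar> + 1)"
    by (intro add_left_mono mult_left_mono) auto
  also have "\<dots> = - b\<^sup>2 / (4 * (\<bar>q\<bar> + 1))"
    unfolding t_def by (simp add: divide_simps power2_eq_square) (auto simp: algebra_simps)
  also have "\<dots> < 0"
    using \<open>b \<noteq> 0\<close> by (intro divide_neg_pos) (auto intro: add_nonneg_pos)
  finally show False using assms[of t] by linarith
qed

section \<open>Square integrable functions\<close>

lemma L2_mult_integrable:
  assumes "f \<in> L2 M" "g \<in> L2 M"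
  shows "integrable M (\<lambda>x. f x * g x)"
proof (rule Bochner_Integration.integrable_bound[of _ "\<lambda>x. (f x)\<^sup>2 + (g x)\<^sup>2"])
  show "integrable M (\<lambda>x. (f x)\<^sup>2 + (g x)\<^sup>2)" using assms by (auto simp: L2_def)
  show "(\<lambda>x. f x * g x) \<in> borel_measurable M" using assms by (auto simp: L2_def)
  have "\<bar>a * b\<bar> \<le> a\<^sup>2 + b\<^sup>2" for a b :: real
    using sum_squares_bound[of "\<bar>a\<bar>" "\<bar>b\<bar>"] mult_nonneg_nonneg[of "\<bar>a\<bar>" "\<bar>b\<bar>"]
    unfolding abs_mult by (simp del: mult_nonneg_nonneg)
  then show "AE x in M. norm (f x * g x) \<le> norm ((f x)\<^sup>2 + (g x)\<^sup>2)"
    by (auto intro!: AE_I2 simp: abs_mult)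
qed

text \<open>With this measure the \<open>L2\<close> part of \<open>energy_minimizer\<close>
  disappears, so that the same lemma also minimises the pure energy.\<close>

lemma L2_null_measure:
  "f \<in> L2 (null_measure (count_space UNIV))" "L2_inner (null_measure (count_space UNIV)) f g = 0"
  by (auto simp: L2_def L2_inner_def integrable_iff_bounded nn_integral_null_measure)

lemma L2_add: "f \<in> L2 M \<Longrightarrow> g \<in> L2 M \<Longrightarrow> (\<lambda>x. f x + g x) \<in> L2 M"
  using L2_mult_integrable[of f M g] by (auto simp: L2_def power2_sum mult.assoc)

lemma L2_scale: "f \<in> L2 M \<Longrightarrow> (\<lambda>x. a * f x) \<in> L2 M"
  by (auto simp: L2_def power_mult_distrib)

lemma L2_diff: "f \<in> L2 M \<Longrightarrow> g \<in> L2 M \<Longrightarrow> (\<lambda>x. f x - g x) \<in> L2 M"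
  using L2_add[of f M "\<lambda>x. -1 * g x"] L2_scale[of g M "-1"] by simp

lemma L2_zero [simp]: "(\<lambda>x. 0) \<in> L2 M"
  by (simp add: L2_def)

lemma L2_dominated:
  assumes "g \<in> L2 M" "f \<in> borel_measurable M" "\<And>x. \<bar>f x\<bar> \<le> \<bar>g x\<bar>"
  shows "f \<in> L2 M"
  unfolding L2_def
proof (intro CollectI conjI assms(2))
  show "integrable M (\<lambda>x. (f x)\<^sup>2)"
    by (rule Bochner_Integration.integrable_bound[of _ "\<lambda>x. (g x)\<^sup>2"])
      (use assms in \<open>auto simp: L2_def abs_le_square_iff\<close>)
qed

lemma L2_inner_commute: "L2_inner M f g = L2_inner M g f"
  by (simp add: L2_inner_def mult.commute)

lemma L2_inner_self_nonneg: "0 \<le> L2_inner M f f"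
  by (simp add: L2_inner_def)

lemma L2_inner_scale_left: "L2_inner M (\<lambda>x. a * f x) g = a * L2_inner M f g"
  by (simp add: L2_inner_def mult.assoc)

lemma L2_inner_scale_right: "L2_inner M f (\<lambda>x. a * g x) = a * L2_inner M f g"
  using L2_inner_scale_left[of M a g f] by (simp add: L2_inner_commute)

lemma L2_inner_zero [simp]: "L2_inner M (\<lambda>x. 0) g = 0" "L2_inner M g (\<lambda>x. 0) = 0"
  by (simp_all add: L2_inner_def)

lemma L2_inner_add_left:
  "f \<in> L2 M \<Longrightarrow> g \<in> L2 M \<Longrightarrow> h \<in> L2 M \<Longrightarrow>
    L2_inner M (\<lambda>x. f x + g x) h = L2_inner M f h + L2_inner M g h"
  by (simp add: L2_inner_def distrib_right L2_mult_integrable)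

lemma L2_inner_add_right:
  "f \<in> L2 M \<Longrightarrow> g \<in> L2 M \<Longrightarrow> h \<in> L2 M \<Longrightarrow>
    L2_inner M h (\<lambda>x. f x + g x) = L2_inner M h f + L2_inner M h g"
  using L2_inner_add_left[of f M g h] by (simp add: L2_inner_commute)

lemma L2_inner_diff_left:
  "f \<in> L2 M \<Longrightarrow> g \<in> L2 M \<Longrightarrow> h \<in> L2 M \<Longrightarrow>
    L2_inner M (\<lambda>x. f x - g x) h = L2_inner M f h - L2_inner M g h"
  by (simp add: L2_inner_def left_diff_distrib L2_mult_integrable)

lemma L2_inner_diff_right:
  "f \<in> L2 M \<Longrightarrow> g \<in> L2 M \<Longrightarrow> h \<in> L2 M \<Longrightarrow>
    L2_inner M h (\<lambda>x. f x - g x) = L2_inner M h f - L2_inner M h g"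
  using L2_inner_diff_left[of f M g h] by (simp add: L2_inner_commute)

lemma L2_Cauchy_Schwarz:
  assumes "f \<in> L2 M" "g \<in> L2 M"
  shows "(L2_inner M f g)\<^sup>2 \<le> L2_inner M f f * L2_inner M g g"
proof -
  have ineq: "0 \<le> s\<^sup>2 * L2_inner M f f - 2 * s * t * L2_inner M f g + t\<^sup>2 * L2_inner M g g" for s t
  proof -
    have sf: "(\<lambda>x. s * f x) \<in> L2 M" and tg: "(\<lambda>x. t * g x) \<in> L2 M"
      using assms by (auto intro: L2_scale)
    have "0 \<le> L2_inner M (\<lambda>x. s * f x - t * g x) (\<lambda>x. s * f x - t * g x)"
      by (rule L2_inner_self_nonneg)
    also have "\<dots> = s\<^sup>2 * L2_inner M f f - 2 * s * t * L2_inner M f g + t\<^sup>2 * L2_inner M g g"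
      unfolding L2_inner_diff_left[OF sf tg L2_diff[OF sf tg]] L2_inner_scale_left L2_inner_scale_right L2_inner_diff_right[OF sf tg assms(1)]
        L2_inner_diff_right[OF sf tg assms(2)] L2_inner_scale_left L2_inner_scale_right
        L2_inner_commute[of M g f]
      by (simp add: power2_eq_square algebra_simps)
    finally show ?thesis .
  qed
  show ?thesis
  \<comment> \<open>The form is only a seminorm: if \<open>g\<close> has norm zero, the quadratic in
    \<open>t\<close> has no leading term and its linear coefficient must vanish.\<close>
  proof (cases "L2_inner M g g = 0")
    case True
    have "- 2 * L2_inner M f g = 0"
    proof (rule quadratic_nonneg_imp_linear_zero)
      show "0 \<le> t * (- 2 * L2_inner M f g) + t\<^sup>2 * L2_inner M f f" for t
        using ineq[of t 1] True by (simp add: algebra_simps)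
    qed
    then show ?thesis by (simp add: L2_inner_self_nonneg)
  next
    case False
    then have pos: "0 < L2_inner M g g" using L2_inner_self_nonneg[of M g] by linarith
    \<comment> \<open>The choice \<open>s = <g, g>\<close>, \<open>t = <f, g>\<close> makes
      \<open><g, g>\<close> a common factor and avoids division.\<close>
    have "0 \<le> L2_inner M g g * (L2_inner M f f * L2_inner M g g - (L2_inner M f g)\<^sup>2)"
      using ineq[of "L2_inner M g g" "L2_inner M f g"] by (simp add: power2_eq_square algebra_simps)
    then show ?thesis using pos by (simp add: zero_le_mult_iff)
  qed
qed

text \<open>Lower semicontinuity of the norm under pointwise convergence, by Fatou applied to the
  squares. Applied to gradients, it passes energy bounds to pointwise limits.\<close>

lemma L2_Fatou:
  assumes u: "\<And>n. u n \<in> L2 M" and le: "\<And>n. L2_inner M (u n) (u n) \<le> B"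
    and lim: "\<And>x. x \<in> space M \<Longrightarrow> (\<lambda>n. u n x) \<longlonglongrightarrow> v x"
  shows "v \<in> L2 M \<and> L2_inner M v v \<le> B"
proof -
  have um: "u n \<in> borel_measurable M" for n using u by (auto simp: L2_def)
  have vm: "v \<in> borel_measurable M"
    by (rule borel_measurable_LIMSEQ_real[OF lim um])
  have "0 \<le> B" using le[of 0] L2_inner_self_nonneg[of M "u 0"] by linarith
  have "(\<integral>\<^sup>+x. ennreal ((v x)\<^sup>2) \<partial>M) = (\<integral>\<^sup>+x. liminf (\<lambda>n. ennreal ((u n x)\<^sup>2)) \<partial>M)"
  proof (rule nn_integral_cong)
    fix x assume "x \<in> space M"
    then have "(\<lambda>n. ennreal ((u n x)\<^sup>2)) \<longlonglongrightarrow> ennreal ((v x)\<^sup>2)"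
      by (intro tendsto_ennrealI tendsto_power lim)
    then show "ennreal ((v x)\<^sup>2) = liminf (\<lambda>n. ennreal ((u n x)\<^sup>2))"
      by (intro lim_imp_Liminf[symmetric]) auto
  qed
  also have "\<dots> \<le> liminf (\<lambda>n. \<integral>\<^sup>+x. ennreal ((u n x)\<^sup>2) \<partial>M)"
    by (rule nn_integral_liminf) (use um in measurable)
  also have "\<dots> \<le> liminf (\<lambda>n::nat. ennreal B)"
  proof (intro Liminf_mono always_eventually allI)
    fix n
    have "(\<integral>\<^sup>+x. ennreal ((u n x)\<^sup>2) \<partial>M) = ennreal (L2_inner M (u n) (u n))"
      using u[of n] by (simp add: L2_def L2_inner_def power2_eq_square nn_integral_eq_integral)
    then show "(\<integral>\<^sup>+x. ennreal ((u n x)\<^sup>2) \<partial>M) \<le> ennreal B" using le[of n] by (simp add: ennreal_leI)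
  qed
  finally have *: "(\<integral>\<^sup>+x. ennreal ((v x)\<^sup>2) \<partial>M) \<le> ennreal B" by (simp add: Liminf_const)
  have "integrable M (\<lambda>x. (v x)\<^sup>2)"
    by (rule integrableI_bounded) (use vm * in \<open>auto simp: less_top[symmetric] top_unique\<close>)
  then have v: "v \<in> L2 M" using vm by (simp add: L2_def)
  then have "ennreal (L2_inner M v v) \<le> ennreal B"
    using * by (simp add: L2_def L2_inner_def power2_eq_square nn_integral_eq_integral)
  then show ?thesis using v \<open>0 \<le> B\<close> by simp
qed

lemma L2_inner_tendsto:
  assumes u: "\<And>n. u n \<in> L2 M" "v \<in> L2 M" "g \<in> L2 M"
    and lim: "(\<lambda>n. L2_inner M (\<lambda>x. u n x - v x) (\<lambda>x. u n x - v x)) \<longlonglongrightarrow> 0"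
  shows "(\<lambda>n. L2_inner M (u n) g) \<longlonglongrightarrow> L2_inner M v g"
proof -
  have "(\<lambda>n. (L2_inner M (u n) g - L2_inner M v g)\<^sup>2) \<longlonglongrightarrow> 0"
  proof (rule tendsto_sandwich[OF _ _ tendsto_const])
    show "(\<lambda>n. L2_inner M (\<lambda>x. u n x - v x) (\<lambda>x. u n x - v x) * L2_inner M g g) \<longlonglongrightarrow> 0"
      using tendsto_mult_right[OF lim, of "L2_inner M g g"] by simp
    show "\<forall>\<^sub>F n in sequentially. (L2_inner M (u n) g - L2_inner M v g)\<^sup>2
        \<le> L2_inner M (\<lambda>x. u n x - v x) (\<lambda>x. u n x - v x) * L2_inner M g g"
      using L2_Cauchy_Schwarz[OF L2_diff[OF u(1) u(2)] u(3)] u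
      by (simp add: L2_inner_diff_left)
  qed simp
  then have "(\<lambda>n. L2_inner M (u n) g - L2_inner M v g) \<longlonglongrightarrow> 0"
    by simp
  then show ?thesis by (simp add: LIM_zero_iff)
qed

lemma L2_inner_self_tendsto:
  assumes u: "\<And>n. u n \<in> L2 M" "v \<in> L2 M"
    and lim: "(\<lambda>n. L2_inner M (\<lambda>x. u n x - v x) (\<lambda>x. u n x - v x)) \<longlonglongrightarrow> 0"
  shows "(\<lambda>n. L2_inner M (u n) (u n)) \<longlonglongrightarrow> L2_inner M v v"
proof -
  have "L2_inner M (u n) (u n) = L2_inner M (\<lambda>x. u n x - v x) (\<lambda>x. u n x - v x)
      + 2 * L2_inner M (u n) v - L2_inner M v v" for n
    using L2_inner_diff_left[OF u(1) u(2) L2_diff[OF u(1) u(2)], of n n]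
      L2_inner_diff_right[OF u(1) u(2) u(1), of n n] L2_inner_diff_right[OF u(1) u(2) u(2), of n]
      L2_inner_commute[of M v "u n"] by linarith
  moreover have "(\<lambda>n. L2_inner M (\<lambda>x. u n x - v x) (\<lambda>x. u n x - v x)
      + 2 * L2_inner M (u n) v - L2_inner M v v) \<longlonglongrightarrow> 0 + 2 * L2_inner M v v - L2_inner M v v"
    by (intro tendsto_intros lim L2_inner_tendsto[OF u u(2)])
  ultimately show ?thesis by simp
qed

lemma L2_Fatou_tendsto:
  assumes u: "\<And>n. u n \<in> L2 M" and le: "\<And>n. L2_inner M (u n) (u n) \<le> B n"
    and B: "B \<longlonglongrightarrow> B0"
    and lim: "\<And>x. x \<in> space M \<Longrightarrow> (\<lambda>n. u n x) \<longlonglongrightarrow> v x"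
  shows "v \<in> L2 M \<and> L2_inner M v v \<le> B0"
proof -
  have *: "v \<in> L2 M \<and> L2_inner M v v \<le> B0 + e" if "0 < e" for e
  proof -
    from B that have "\<forall>\<^sub>F n in sequentially. B n < B0 + e" by (intro order_tendstoD) auto
    then obtain k where k: "\<And>n. n \<ge> k \<Longrightarrow> B n < B0 + e" by (auto simp: eventually_sequentially)
    show ?thesis
    proof (rule L2_Fatou[of "\<lambda>n. u (n + k)"])
      show "L2_inner M (u (n + k)) (u (n + k)) \<le> B0 + e" for n
        using le[of "n + k"] k[of "n + k"] by simp
      show "(\<lambda>n. u (n + k) x) \<longlonglongrightarrow> v x" if "x \<in> space M" for x
        using lim[OF that] by (rule LIMSEQ_ignore_initial_segment)
    qed (rule u)
  qed
  show ?thesis using *[of 1] * by (auto intro: field_le_epsilon)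
qed

text \<open>This replaces completeness of the space. The candidate limit is known pointwise, and
  letting \<open>k\<close> tend to infinity in the Cauchy bound, by Fatou, bounds the distance from
  \<open>u n\<close> to it by \<open>B n\<close>.\<close>

lemma L2_Cauchy_limit:
  assumes u: "\<And>n. u n \<in> L2 M"
    and cauchy: "\<And>n k. L2_inner M (\<lambda>x. u n x - u k x) (\<lambda>x. u n x - u k x) \<le> B n + B k"
    and B: "B \<longlonglongrightarrow> 0"
    and lim: "\<And>x. x \<in> space M \<Longrightarrow> (\<lambda>n. u n x) \<longlonglongrightarrow> v x"
  shows "v \<in> L2 M" and "(\<lambda>n. L2_inner M (\<lambda>x. u n x - v x) (\<lambda>x. u n x - v x)) \<longlonglongrightarrow> 0"
proof -
  have *: "(\<lambda>x. u n x - v x) \<in> L2 M \<and> L2_inner M (\<lambda>x. u n x - v x) (\<lambda>x. u n x - v x) \<le> B n + 0" for n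
    by (rule L2_Fatou_tendsto[where u = "\<lambda>k x. u n x - u k x" and B = "\<lambda>k. B n + B k"])
      (intro tendsto_intros B lim L2_diff u cauchy | assumption)+
  show "v \<in> L2 M" using L2_diff[OF u[of 0], of "\<lambda>x. u 0 x - v x"] *[of 0] by simp
  show "(\<lambda>n. L2_inner M (\<lambda>x. u n x - v x) (\<lambda>x. u n x - v x)) \<longlonglongrightarrow> 0"
    by (rule tendsto_sandwich[OF _ _ tendsto_const B])
      (use * in \<open>auto simp: L2_inner_self_nonneg\<close>)
qed

text \<open>The midpoint of two almost minimisers cannot lie below the infimum, so the parallelogram
  identity forces their difference to be small. \<open>J\<close> is centred at a target whereas
  \<open>N\<close> measures differences, hence two functionals.\<close>

lemma minimizing_sequence:
  fixes J N :: "('a \<Rightarrow> real) \<Rightarrow> real"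
  assumes "C \<noteq> {}" and nonneg: "\<And>u. u \<in> C \<Longrightarrow> 0 \<le> J u"
    and mid: "\<And>u v. u \<in> C \<Longrightarrow> v \<in> C \<Longrightarrow> (\<lambda>x. (u x + v x) / 2) \<in> C"
    and par: "\<And>u v. u \<in> C \<Longrightarrow> v \<in> C \<Longrightarrow>
      N (\<lambda>x. u x - v x) = 2 * J u + 2 * J v - 4 * J (\<lambda>x. (u x + v x) / 2)"
  obtains v :: "nat \<Rightarrow> 'a \<Rightarrow> real" where "\<And>n. v n \<in> C"
    and "\<And>n u. u \<in> C \<Longrightarrow> J (v n) \<le> J u + 1 / real (Suc n)"
    and "\<And>n k. N (\<lambda>x. v n x - v k x) \<le> 2 / real (Suc n) + 2 / real (Suc k)"
proof -
  define d where "d = (INF u\<in>C. J u)"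
  have bdd: "bdd_below (J ` C)" using nonneg by (auto intro!: bdd_belowI2[of _ 0])
  have d: "d \<le> J u" if "u \<in> C" for u unfolding d_def using bdd that by (rule cINF_lower)
  have "\<exists>u\<in>C. J u < d + 1 / real (Suc n)" for n
  proof -
    have "d < d + 1 / real (Suc n)" by simp
    then show ?thesis unfolding d_def using cINF_less_iff[OF assms(1) bdd] by blast
  qed
  then obtain v where v: "\<And>n. v n \<in> C" "\<And>n. J (v n) < d + 1 / real (Suc n)" by metis
  have "J (v n) \<le> J u + 1 / real (Suc n)" if "u \<in> C" for u n
    using v(2)[of n] d[OF that] by linarith
  moreover have "N (\<lambda>x. v n x - v k x) \<le> 2 / real (Suc n) + 2 / real (Suc k)" for n k
    using par[OF v(1)[of n] v(1)[of k]] d[OF mid[OF v(1)[of n] v(1)[of k]]] v(2)[of n] v(2)[of k]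
    by (simp del: of_nat_Suc)
  ultimately show ?thesis using v(1) that by blast
qed

lemma L2_parallelogram:
  assumes "f \<in> L2 M" "g \<in> L2 M"
  shows "L2_inner M (\<lambda>x. f x - g x) (\<lambda>x. f x - g x) = 2 * L2_inner M f f + 2 * L2_inner M g g
    - 4 * L2_inner M (\<lambda>x. (f x + g x) / 2) (\<lambda>x. (f x + g x) / 2)"
proof -
  have "(\<lambda>x. (f x + g x) / 2) = (\<lambda>x. (1/2) * (f x + g x))" by auto
  then show ?thesis
    unfolding L2_inner_add_left[OF assms L2_add[OF assms]] L2_inner_diff_left[OF assms L2_diff[OF assms]]
      L2_inner_add_right[OF assms assms(1)] L2_inner_add_right[OF assms assms(2)]
      L2_inner_diff_right[OF assms assms(1)] L2_inner_diff_right[OF assms assms(2)]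
      L2_inner_commute[of M g f]
    by (simp only: L2_inner_scale_left L2_inner_scale_right L2_inner_add_left[OF assms L2_add[OF assms]]
      L2_inner_add_right[OF assms assms(1)] L2_inner_add_right[OF assms assms(2)]
      L2_inner_commute[of M g f]) (simp add: field_simps)
qed

section \<open>Sums as integrals\<close>

text \<open>Both sides are suprema of finite partial sums. An enumeration of \<open>A\<close>
  provides an increasing sequence of finite sets, to which monotone convergence applies.\<close>

lemma infsum_ennreal_eq_nn_integral:
  fixes f :: "'a \<Rightarrow> ennreal"
  assumes "countable A"
  shows "infsum f A = (\<integral>\<^sup>+x. f x \<partial>count_space A)"
proof (rule antisym)
  have sup: "infsum f A = (SUP F\<in>{F. finite F \<and> F \<subseteq> A}. sum f F)"
    by (rule nonneg_infsum_complete) simp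
  have fin: "sum f F = (\<integral>\<^sup>+x. f x * indicator F x \<partial>count_space A)" if "finite F" "F \<subseteq> A" for F
  proof -
    have "(\<integral>\<^sup>+x. f x * indicator F x \<partial>count_space A) = (\<Sum>x\<in>F. f x * indicator F x)"
      by (rule nn_integral_count_space') (use that in auto)
    then show ?thesis by simp
  qed
  show "infsum f A \<le> (\<integral>\<^sup>+x. f x \<partial>count_space A)"
    unfolding sup
    by (rule SUP_least) (auto simp: fin intro!: nn_integral_mono split: split_indicator)
  define B where "B n = {a \<in> A. to_nat_on A a < n}" for n
  have B: "finite (B n)" "B n \<subseteq> A" for n
  proof -
    have "B n \<subseteq> to_nat_on A -` {..<n} \<inter> A" by (auto simp: B_def)
    then show "finite (B n)"
      by (rule finite_subset) (auto intro!: finite_vimage_IntI inj_on_to_nat_on assms)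
  qed (auto simp: B_def)
  have "(\<integral>\<^sup>+x. f x \<partial>count_space A) = (\<integral>\<^sup>+x. (SUP n. f x * indicator (B n) x) \<partial>count_space A)"
  proof (rule nn_integral_cong)
    fix x assume "x \<in> space (count_space A)"
    then have x: "x \<in> B (Suc (to_nat_on A x))" by (auto simp: B_def)
    show "f x = (SUP n. f x * indicator (B n) x)"
    proof (rule antisym)
      have "f x = f x * indicator (B (Suc (to_nat_on A x))) x" using x by simp
      also have "\<dots> \<le> (SUP n. f x * indicator (B n) x)" by (rule SUP_upper) simp
      finally show "f x \<le> (SUP n. f x * indicator (B n) x)" .
    qed (auto intro!: SUP_least split: split_indicator)
  qed
  also have "\<dots> = (SUP n. \<integral>\<^sup>+x. f x * indicator (B n) x \<partial>count_space A)"
    by (rule nn_integral_monotone_convergence_SUP)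
      (auto simp: incseq_def le_fun_def B_def split: split_indicator)
  also have "\<dots> = (SUP n. sum f (B n))" by (intro SUP_cong refl fin[symmetric] B)
  also have "\<dots> \<le> infsum f A" unfolding sup
  proof (rule SUP_least)
    fix n show "sum f (B n) \<le> (SUP F\<in>{F. finite F \<and> F \<subseteq> A}. sum f F)"
      by (rule SUP_upper) (use B[of n] in auto)
  qed
  finally show "(\<integral>\<^sup>+x. f x \<partial>count_space A) \<le> infsum f A" .
qed

lemma summable_on_iff_integrable_count_space:
  fixes f :: "'a \<Rightarrow> real"
  shows "f summable_on A \<longleftrightarrow> integrable (count_space A) f"
  using abs_summable_equivalent[of f A] summable_on_iff_abs_summable_on_real[of f A]
  unfolding Infinite_Set_Sum.abs_summable_on_def by blast

lemma summable_real_bound: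
  fixes f g :: "'b \<Rightarrow> real"
  assumes "g summable_on A" "\<And>x. x \<in> A \<Longrightarrow> \<bar>f x\<bar> \<le> g x"
  shows "f summable_on A"
  using assms unfolding summable_on_iff_integrable_count_space
  by (elim Bochner_Integration.integrable_bound) (auto intro!: AE_I2 intro: order_trans[OF _ abs_ge_self])

lemma infsum_eq_integral_count_space:
  fixes f :: "'a \<Rightarrow> real"
  shows "infsum f A = integral\<^sup>L (count_space A) f"
proof (cases "f summable_on A")
  case True
  then have "Infinite_Set_Sum.abs_summable_on f A"
    using abs_summable_equivalent[of f A] summable_on_iff_abs_summable_on_real[of f A] by blast
  then show ?thesis
    using infsetsum_infsum[of f A] by (simp add: infsetsum_def)
next
  case False
  then show ?thesis
    by (simp add: infsum_not_exists summable_on_iff_integrable_count_space not_integrable_integral_eq)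
qed

lemma integrable_point_measure_iff:
  fixes f g :: "'a \<Rightarrow> real"
  assumes "\<And>x. 0 \<le> g x"
  shows "integrable (point_measure UNIV (\<lambda>x. ennreal (g x))) f \<longleftrightarrow> (\<lambda>x. g x * f x) summable_on UNIV"
  unfolding point_measure_def summable_on_iff_integrable_count_space
  by (subst integrable_density) (use assms in auto)

lemma integral_point_measure:
  fixes f g :: "'a \<Rightarrow> real"
  assumes "\<And>x. 0 \<le> g x"
  shows "integral\<^sup>L (point_measure UNIV (\<lambda>x. ennreal (g x))) f = (\<Sum>\<^sub>\<infinity>x. g x * f x)"
  unfolding point_measure_def infsum_eq_integral_count_space
  by (subst integral_density) (use assms in auto)

lemma nn_integral_point_measure':
  "(\<integral>\<^sup>+x. f x \<partial>point_measure UNIV (\<lambda>x. ennreal (g x))) = (\<integral>\<^sup>+x. ennreal (g x) * f x \<partial>count_space UNIV)"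
  unfolding point_measure_def by (subst nn_integral_density) auto

lemma L2_point_measure_iff:
  assumes "\<And>x. 0 \<le> g x"
  shows "f \<in> L2 (point_measure UNIV (\<lambda>x. ennreal (g x))) \<longleftrightarrow> (\<lambda>x. g x * (f x)\<^sup>2) summable_on UNIV"
  using integrable_point_measure_iff[OF assms] by (simp add: L2_def)

lemma L2_inner_point_measure:
  assumes "\<And>x. 0 \<le> g x"
  shows "L2_inner (point_measure UNIV (\<lambda>x. ennreal (g x))) f h = (\<Sum>\<^sub>\<infinity>x. g x * (f x * h x))"
  using integral_point_measure[OF assms] by (simp add: L2_inner_def)

lemma infsum_single_point:
  fixes f :: "'a \<Rightarrow> real"
  assumes "\<And>x. x \<noteq> a \<Longrightarrow> f x = 0"
  shows "f summable_on UNIV" "(\<Sum>\<^sub>\<infinity>x. f x) = f a"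
  using assms by (auto intro!: infsumI finite_nonzero_values_imp_summable_on
      has_sum_finite_neutralI[of "{a}"] finite_subset[of _ "{a}"])

lemma infsum_ge_single:
  fixes f :: "'a \<Rightarrow> real"
  assumes "f summable_on UNIV" "\<And>x. 0 \<le> f x"
  shows "f a \<le> (\<Sum>\<^sub>\<infinity>x. f x)"
  using finite_sum_le_infsum[OF assms(1), of "{a}"] assms(2) by simp

text \<open>The gradient of \<open>delta z\<close> lives on one row and one column of the ordered
  pairs; this lemma and \<open>summable_col\<close> reduce such sums over pairs to sums over
  vertices.\<close>

lemma summable_row:
  assumes "G summable_on (UNIV :: 'b set)"
  shows "(\<lambda>p. if fst p = z then G (snd p) else (0::real)) summable_on UNIV"
    and "(\<Sum>\<^sub>\<infinity>p. if fst p = z then G (snd p) else 0) = (\<Sum>\<^sub>\<infinity>y. G y)"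
proof -
  let ?F = "\<lambda>p. if fst p = z then G (snd p) else 0"
  have inj: "inj (Pair z :: 'b \<Rightarrow> 'a \<times> 'b)" by (auto intro: injI)
  have eq: "?F \<circ> Pair z = G" by auto
  have 1: "?F summable_on range (Pair z) \<longleftrightarrow> ?F summable_on UNIV"
    by (rule summable_on_cong_neutral) auto
  have 2: "infsum ?F (range (Pair z)) = infsum ?F UNIV"
    by (rule infsum_cong_neutral) auto
  show "?F summable_on UNIV"
    using summable_on_reindex[OF inj, of ?F] assms unfolding 1 eq by simp
  show "infsum ?F UNIV = infsum G UNIV"
    using infsum_reindex[OF inj, of ?F] unfolding 2 eq by simp
qed

lemma summable_col:
  assumes "G summable_on (UNIV :: 'b set)"
  shows "(\<lambda>p. if snd p = z then G (fst p) else (0::real)) summable_on UNIV"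
    and "(\<Sum>\<^sub>\<infinity>p. if snd p = z then G (fst p) else 0) = (\<Sum>\<^sub>\<infinity>y. G y)"
proof -
  have bij: "bij (prod.swap :: 'b \<times> 'a \<Rightarrow> 'a \<times> 'b)" by simp
  show "(\<lambda>p. if snd p = z then G (fst p) else (0::real)) summable_on UNIV"
    using summable_row(1)[OF assms, of z]
      summable_on_reindex_bij_betw[OF bij, of "\<lambda>p. if fst p = z then G (snd p) else 0"]
    by (simp cong: if_cong)
  show "(\<Sum>\<^sub>\<infinity>p. if snd p = z then G (fst p) else 0) = (\<Sum>\<^sub>\<infinity>y. G y)"
    using summable_row(2)[OF assms, of z]
      infsum_reindex_bij_betw[OF bij, of "\<lambda>p. if fst p = z then G (snd p) else 0"]
    by (simp cong: if_cong)
qed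

section \<open>Networks\<close>

locale network = conductance_graph E c for E :: "'v set set" and c :: "'v set \<Rightarrow> real" +
  assumes countable_V: "countable (UNIV :: 'v set)"
    and infinite_V: "infinite (UNIV :: 'v set)"
    and connected: "graph_connected E"
    and finite_total: "finite_total_conductance E c"
begin

text \<open>Extension by zero to non-edges, so that sums can range over the whole type instead of
  neighbourhoods.\<close>

definition cond :: "'v \<Rightarrow> 'v \<Rightarrow> real" where
  "cond x y = (if {x, y} \<in> E then c {x, y} else 0)"

abbreviation "tc \<equiv> total_conductance E c"

lemma cond_sym: "cond x y = cond y x"
  by (simp add: cond_def insert_commute)

lemma cond_nonneg [simp]: "0 \<le> cond x y"
  using conductance_pos[of "{x, y}"] by (auto simp: cond_def)

lemma cond_pos_iff: "0 < cond x y \<longleftrightarrow> {x, y} \<in> E"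
  using conductance_pos[of "{x, y}"] by (simp add: cond_def)

lemma cond_refl [simp]: "cond x x = 0"
  using edge_pair[of "{x, x}"] by (auto simp: cond_def doubleton_eq_iff)

lemma infsum_nbrs: "(\<Sum>\<^sub>\<infinity>y\<in>nbrs E x. c {x, y} * g y) = (\<Sum>\<^sub>\<infinity>y. cond x y * g y)"
  by (rule infsum_cong_neutral) (auto simp: cond_def nbrs_def)

lemma summable_nbrs: "(\<lambda>y. c {x, y} * g y) summable_on nbrs E x \<longleftrightarrow> (\<lambda>y. cond x y * g y) summable_on UNIV"
  by (rule summable_on_cong_neutral) (auto simp: cond_def nbrs_def)

lemma cond_summable: "cond x summable_on UNIV"
  using finite_total summable_nbrs[of x "\<lambda>_. 1"] by (simp add: finite_total_conductance_def)

lemma tc_eq: "tc x = (\<Sum>\<^sub>\<infinity>y. cond x y)"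
  using infsum_nbrs[of x "\<lambda>_. 1"] by (simp add: total_conductance_def)

lemma cond_le_tc: "cond x y \<le> tc x"
  unfolding tc_eq by (rule infsum_ge_single[OF cond_summable]) simp

lemma path_induct [case_names refl step]:
  assumes "P x" "\<And>y z. P y \<Longrightarrow> {y, z} \<in> E \<Longrightarrow> P z"
  shows "P y"
proof -
  have "(x, y) \<in> {(a, b). {a, b} \<in> E}\<^sup>*" using connected by (simp add: graph_connected_def)
  then show ?thesis by (induction) (use assms in auto)
qed

text \<open>By connectedness an isolated vertex would be the only vertex, but the graph is
  infinite.\<close>

lemma tc_pos: "0 < tc x"
proof -
  obtain y where "{x, y} \<in> E"
  proof -
    have "\<exists>y. {x, y} \<in> E"
    proof (rule ccontr)
      assume none: "\<nexists>y. {x, y} \<in> E"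
      have "y = x" for y
        by (rule path_induct[of "\<lambda>y. y = x" x y]) (use none in auto)
      then have "UNIV = {x}" by auto
      then show False using infinite_V by (metis finite.emptyI finite_insert)
    qed
    then show ?thesis using that by blast
  qed
  then show ?thesis using cond_le_tc[of x y] cond_pos_iff[of x y] by linarith
qed

text \<open>The weight is halved because every edge is counted as two ordered pairs.\<close>

definition edge_measure :: "('v \<times> 'v) measure" where
  "edge_measure = point_measure UNIV (\<lambda>p. ennreal (cond (fst p) (snd p) / 2))"

text \<open>The energy is the squared norm of the gradient in \<open>L2 edge_measure\<close>. All
  properties of \<open>EE\<close> are pulled back from there.\<close>

definition grad :: "('v \<Rightarrow> real) \<Rightarrow> 'v \<times> 'v \<Rightarrow> real" where
  "grad f p = f (fst p) - f (snd p)"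

definition finite_energy :: "('v \<Rightarrow> real) \<Rightarrow> bool" where
  "finite_energy f \<longleftrightarrow> grad f \<in> L2 edge_measure"

definition EE :: "('v \<Rightarrow> real) \<Rightarrow> ('v \<Rightarrow> real) \<Rightarrow> real" where
  "EE f g = L2_inner edge_measure (grad f) (grad g)"

lemma measurable_edge_measure [simp]: "f \<in> borel_measurable edge_measure"
  by (simp add: edge_measure_def)

text \<open>An enumeration of the vertices orients every edge: \<open>A\<close> contains exactly one
  of the two ordered pairs of each edge, hence is in bijection with \<open>E\<close>. The two
  orientations contribute equally, which cancels the weight one half.\<close>

lemma energy_eq_nn_integral:
  "energy E c f = (\<integral>\<^sup>+p. ennreal ((grad f p)\<^sup>2) \<partial>edge_measure)"
proof -
  define i where "i = to_nat_on (UNIV :: 'v set)"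
  have inj: "i x = i y \<longleftrightarrow> x = y" for x y
    unfolding i_def using inj_on_to_nat_on[OF countable_V] by (auto dest: injD)
  define A where "A = {p. {fst p, snd p} \<in> E \<and> i (fst p) < i (snd p)}"
  define F where "F p = ennreal (cond (fst p) (snd p) / 2) * ennreal ((grad f p)\<^sup>2)" for p
  have swap: "F (prod.swap p) = F p" for p
    by (simp add: F_def grad_def cond_sym[of "fst p"] power2_commute)
  have bij: "bij_betw (\<lambda>p. {fst p, snd p}) A E"
    unfolding bij_betw_def
  proof
    show "inj_on (\<lambda>p. {fst p, snd p}) A"
      unfolding inj_on_def A_def doubleton_eq_iff by (auto intro: prod_eqI)
    show "(\<lambda>p. {fst p, snd p}) ` A = E"
    proof (intro set_eqI iffI)
      fix e assume "e \<in> E"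
      then obtain x y where xy: "x \<noteq> y" "e = {x, y}" using edge_pair by blast
      then have "i x < i y \<or> i y < i x" using inj[of x y] by linarith
      then have "(x, y) \<in> A \<or> (y, x) \<in> A" using \<open>e \<in> E\<close> xy by (auto simp: A_def insert_commute)
      then show "e \<in> (\<lambda>p. {fst p, snd p}) ` A"
        using xy by (force simp: insert_commute)
    qed (auto simp: A_def)
  qed
  have cV: "countable (UNIV :: ('v \<times> 'v) set)"
    using countable_SIGMA[OF countable_V countable_V] by simp
  have cA: "countable A" by (rule countable_subset[OF subset_UNIV cV])
  have "(\<integral>\<^sup>+p. ennreal ((grad f p)\<^sup>2) \<partial>edge_measure) = (\<integral>\<^sup>+p. F p \<partial>count_space UNIV)"
    unfolding edge_measure_def nn_integral_point_measure' F_def ..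
  \<comment> \<open>For an edge exactly one of \<open>p\<close> and its swap lies in
    \<open>A\<close>; for a non-edge \<open>F p\<close> is zero.\<close>
  also have "\<dots> = (\<integral>\<^sup>+p. F p * indicator A p + F (prod.swap p) * indicator A (prod.swap p) \<partial>count_space UNIV)"
  proof (rule nn_integral_cong)
    fix p :: "'v \<times> 'v"
    show "F p = F p * indicator A p + F (prod.swap p) * indicator A (prod.swap p)"
    proof (cases "{fst p, snd p} \<in> E")
      case True
      then have "fst p \<noteq> snd p" using edge_pair by fastforce
      then show ?thesis using True inj[of "fst p" "snd p"] unfolding swap
        by (auto simp: A_def insert_commute split: split_indicator)
    next
      case False
      then have "F p = 0" by (simp add: F_def cond_def)
      then show ?thesis by (simp add: swap)
    qed
  qed
  also have "\<dots> = (\<integral>\<^sup>+p. F p * indicator A p \<partial>count_space UNIV)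
      + (\<integral>\<^sup>+p. F (prod.swap p) * indicator A (prod.swap p) \<partial>count_space UNIV)"
    by (rule nn_integral_add) auto
  also have "(\<integral>\<^sup>+p. F (prod.swap p) * indicator A (prod.swap p) \<partial>count_space UNIV)
      = (\<integral>\<^sup>+p. F p * indicator A p \<partial>count_space UNIV)"
    by (rule nn_integral_bij_count_space) (auto simp: bij_def)
  also have "(\<integral>\<^sup>+p. F p * indicator A p \<partial>count_space UNIV) + (\<integral>\<^sup>+p. F p * indicator A p \<partial>count_space UNIV)
      = (\<integral>\<^sup>+p. (F p + F p) * indicator A p \<partial>count_space UNIV)"
    by (subst nn_integral_add[symmetric]) (auto simp: distrib_right)
  also have "\<dots> = (\<integral>\<^sup>+p. F p + F p \<partial>count_space A)"
    by (subst nn_integral_count_space_indicator) auto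
  also have "\<dots> = (\<integral>\<^sup>+p. ennreal (c {fst p, snd p} * edge_sq_diff f {fst p, snd p}) \<partial>count_space A)"
  proof (rule nn_integral_cong)
    fix p assume "p \<in> space (count_space A)"
    then show "F p + F p = ennreal (c {fst p, snd p} * edge_sq_diff f {fst p, snd p})"
      using conductance_pos[of "{fst p, snd p}"]
      by (simp add: F_def A_def cond_def grad_def power2_commute ennreal_mult[symmetric] ennreal_plus[symmetric]
          del: ennreal_plus)
  qed
  also have "\<dots> = (\<Sum>\<^sub>\<infinity>p\<in>A. ennreal (c {fst p, snd p} * edge_sq_diff f {fst p, snd p}))"
    by (simp only: infsum_ennreal_eq_nn_integral[OF cA])
  also have "\<dots> = (\<Sum>\<^sub>\<infinity>e\<in>E. ennreal (c e * edge_sq_diff f e))"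
    by (rule infsum_reindex_bij_betw[OF bij])
  finally show ?thesis by (simp add: energy_def)
qed

lemma energy_eq_EE: "finite_energy f \<Longrightarrow> energy E c f = ennreal (EE f f)"
  unfolding energy_eq_nn_integral finite_energy_def EE_def L2_inner_def L2_def
  by (simp add: power2_eq_square nn_integral_eq_integral)

lemma finite_energy_iff: "finite_energy f \<longleftrightarrow> energy E c f < \<infinity>"
proof
  assume "energy E c f < \<infinity>"
  then have "integrable edge_measure (\<lambda>p. (grad f p)\<^sup>2)"
    unfolding energy_eq_nn_integral by (intro integrableI_bounded) auto
  then show "finite_energy f" by (simp add: finite_energy_def L2_def)
qed (simp add: energy_eq_EE)

lemma finite_energy_summable:
  "finite_energy f \<longleftrightarrow> (\<lambda>p. cond (fst p) (snd p) / 2 * (f (fst p) - f (snd p))\<^sup>2) summable_on UNIV"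
  unfolding finite_energy_def edge_measure_def by (subst L2_point_measure_iff) (auto simp: grad_def)

lemma EE_eq_infsum:
  "EE f g = (\<Sum>\<^sub>\<infinity>p. cond (fst p) (snd p) / 2 * ((f (fst p) - f (snd p)) * (g (fst p) - g (snd p))))"
  unfolding EE_def edge_measure_def by (subst L2_inner_point_measure) (auto simp: grad_def)

lemma EE_summable:
  assumes "finite_energy f" "finite_energy g"
  shows "(\<lambda>p. cond (fst p) (snd p) / 2 * ((f (fst p) - f (snd p)) * (g (fst p) - g (snd p)))) summable_on UNIV"
  using L2_mult_integrable[of "grad f" edge_measure "grad g"] assms
  unfolding finite_energy_def edge_measure_def
  by (subst (asm) integrable_point_measure_iff) (auto simp: grad_def)

lemma energy_form_eq:
  assumes "finite_energy f" "finite_energy g"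
  shows "energy_form E c f g = EE f g"
proof -
  let ?h = "\<lambda>x y. cond x y / 2 * ((f x - f y) * (g x - g y))"
  have s: "(\<lambda>(x, y). ?h x y) summable_on UNIV \<times> UNIV"
    using EE_summable[OF assms] by (simp add: case_prod_unfold)
  have "EE f g = (\<Sum>\<^sub>\<infinity>x. \<Sum>\<^sub>\<infinity>y. ?h x y)"
    using infsum_Sigma'_banach[OF s] by (simp add: EE_eq_infsum case_prod_unfold)
  also have "\<dots> = (\<Sum>\<^sub>\<infinity>x. 1 / 2 * (\<Sum>\<^sub>\<infinity>y. cond x y * ((f x - f y) * (g x - g y))))"
    by (subst infsum_cmult_right'[symmetric]) (simp add: mult_ac)
  also have "\<dots> = 1 / 2 * (\<Sum>\<^sub>\<infinity>x. \<Sum>\<^sub>\<infinity>y. cond x y * ((f x - f y) * (g x - g y)))"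
    by (rule infsum_cmult_right')
  also have "\<dots> = energy_form E c f g"
    by (simp add: energy_form_def infsum_nbrs[symmetric] mult.assoc)
  finally show ?thesis ..
qed

end

section \<open>The energy as a semi-inner product on functions of finite energy\<close>

context network
begin

lemma grad_add: "grad (\<lambda>x. f x + g x) = (\<lambda>p. grad f p + grad g p)"
  and grad_diff: "grad (\<lambda>x. f x - g x) = (\<lambda>p. grad f p - grad g p)"
  and grad_scale: "grad (\<lambda>x. a * f x) = (\<lambda>p. a * grad f p)"
  and grad_const: "grad (\<lambda>x. a) = (\<lambda>p. 0)"
  and grad_mid: "grad (\<lambda>x. (f x + g x) / 2) = (\<lambda>p. (grad f p + grad g p) / 2)"
  by (auto simp: grad_def fun_eq_iff algebra_simps diff_divide_distrib add_divide_distrib)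

lemma finite_energy_add: "finite_energy f \<Longrightarrow> finite_energy g \<Longrightarrow> finite_energy (\<lambda>x. f x + g x)"
  and finite_energy_diff: "finite_energy f \<Longrightarrow> finite_energy g \<Longrightarrow> finite_energy (\<lambda>x. f x - g x)"
  and finite_energy_scale: "finite_energy f \<Longrightarrow> finite_energy (\<lambda>x. a * f x)"
  and finite_energy_const [simp]: "finite_energy (\<lambda>x. a)"
  unfolding finite_energy_def grad_add grad_diff grad_scale grad_const
  by (auto intro: L2_add L2_diff L2_scale)

lemma finite_energy_mid: "finite_energy f \<Longrightarrow> finite_energy g \<Longrightarrow> finite_energy (\<lambda>x. (f x + g x) / 2)"
  using finite_energy_scale[OF finite_energy_add, of f g "1/2"] by simp

lemma EE_commute: "EE f g = EE g f"
  by (simp add: EE_def L2_inner_commute)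

lemma EE_nonneg: "0 \<le> EE f f"
  by (simp add: EE_def L2_inner_self_nonneg)

lemma EE_scale_left: "EE (\<lambda>x. a * f x) g = a * EE f g"
  and EE_scale_right: "EE g (\<lambda>x. a * f x) = a * EE g f"
  by (simp_all add: EE_def grad_scale L2_inner_scale_left L2_inner_scale_right)

lemma EE_const [simp]: "EE (\<lambda>x. a) g = 0" "EE g (\<lambda>x. a) = 0"
  by (simp_all add: EE_def grad_const)

lemma EE_add_left: "finite_energy f \<Longrightarrow> finite_energy g \<Longrightarrow> finite_energy h \<Longrightarrow>
    EE (\<lambda>x. f x + g x) h = EE f h + EE g h"
  and EE_diff_left: "finite_energy f \<Longrightarrow> finite_energy g \<Longrightarrow> finite_energy h \<Longrightarrow>
    EE (\<lambda>x. f x - g x) h = EE f h - EE g h"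
  and EE_add_right: "finite_energy f \<Longrightarrow> finite_energy g \<Longrightarrow> finite_energy h \<Longrightarrow>
    EE h (\<lambda>x. f x + g x) = EE h f + EE h g"
  and EE_diff_right: "finite_energy f \<Longrightarrow> finite_energy g \<Longrightarrow> finite_energy h \<Longrightarrow>
    EE h (\<lambda>x. f x - g x) = EE h f - EE h g"
  unfolding EE_def finite_energy_def grad_add grad_diff
  by (auto intro: L2_inner_add_left L2_inner_diff_left L2_inner_add_right L2_inner_diff_right)

lemma EE_diff_self:
  assumes "finite_energy f" "finite_energy g"
  shows "EE (\<lambda>x. f x - g x) (\<lambda>x. f x - g x) = EE f f - 2 * EE f g + EE g g"
  using assms EE_diff_left[OF assms finite_energy_diff[OF assms]] EE_diff_right[OF assms assms(1)]
    EE_diff_right[OF assms assms(2)] EE_commute[of g f] by simp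

lemma EE_add_self:
  assumes "finite_energy f" "finite_energy g"
  shows "EE (\<lambda>x. f x + g x) (\<lambda>x. f x + g x) = EE f f + 2 * EE f g + EE g g"
  using assms EE_add_left[OF assms finite_energy_add[OF assms]] EE_add_right[OF assms assms(1)]
    EE_add_right[OF assms assms(2)] EE_commute[of g f] by simp

lemma cond_sq_diff_le_EE:
  assumes "finite_energy f"
  shows "cond x y * (f x - f y)\<^sup>2 \<le> EE f f"
proof (cases "x = y")
  case False
  let ?F = "\<lambda>p. cond (fst p) (snd p) / 2 * ((f (fst p) - f (snd p)) * (f (fst p) - f (snd p)))"
  have "sum ?F {(x, y), (y, x)} \<le> (\<Sum>\<^sub>\<infinity>p. ?F p)"
    by (rule finite_sum_le_infsum[OF EE_summable[OF assms assms]]) auto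
  then show ?thesis using False
    by (simp add: EE_eq_infsum cond_sym[of y x] power2_eq_square algebra_simps)
qed (simp add: EE_nonneg)

text \<open>Along a path from \<open>x\<close> to \<open>y\<close>, every step is controlled by one
  edge term of the energy, and \<open>(a + b)^2 <= 2 * a^2 + 2 * b^2\<close> joins the steps. Since
  \<open>K\<close> does not depend on \<open>f\<close>, convergence in energy becomes pointwise
  convergence as soon as one value is pinned.\<close>

lemma sq_diff_le_EE:
  "\<exists>K\<ge>0. \<forall>f. finite_energy f \<longrightarrow> (f x - f y)\<^sup>2 \<le> K * EE f f"
proof (induction y rule: path_induct[of _ x])
  case refl
  then show ?case by (auto intro!: exI[of _ 0])
next
  case (step y z)
  then obtain K where K: "K \<ge> 0" "\<And>f. finite_energy f \<Longrightarrow> (f x - f y)\<^sup>2 \<le> K * EE f f" by blast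
  have pos: "0 < cond y z" using step.hyps by (simp add: cond_pos_iff)
  show ?case
  proof (intro exI[of _ "2 * K + 2 / cond y z"] conjI allI impI)
    show "0 \<le> 2 * K + 2 / cond y z" using K(1) pos by simp
    fix f assume f: "finite_energy f"
    have "(f y - f z)\<^sup>2 \<le> EE f f / cond y z"
      using cond_sq_diff_le_EE[OF f, of y z] pos by (simp add: field_simps)
    moreover have "(f x - f z)\<^sup>2 \<le> 2 * (f x - f y)\<^sup>2 + 2 * (f y - f z)\<^sup>2"
      using zero_le_power2[of "(f x - f y) - (f y - f z)"] by (simp add: power2_eq_square algebra_simps)
    ultimately show "(f x - f z)\<^sup>2 \<le> (2 * K + 2 / cond y z) * EE f f"
      using K(2)[OF f] by (simp add: algebra_simps)
  qed
qed

lemma EE_zero_imp_const: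
  assumes "finite_energy f" "EE f f = 0"
  shows "f x = f y"
  using sq_diff_le_EE[of x y] assms by auto

definition delta :: "'v \<Rightarrow> 'v \<Rightarrow> real" where
  "delta z x = (if x = z then 1 else 0)"

text \<open>Degrees may be infinite. As \<open>|t| <= 1 + t^2\<close>, the sum is dominated by the
  total conductance plus the energy of the edges at \<open>z\<close>.\<close>

lemma summable_cond_diff:
  assumes "finite_energy f"
  shows "(\<lambda>y. cond z y * (f z - f y)) summable_on UNIV"
proof (rule summable_real_bound)
  let ?F = "\<lambda>p. cond (fst p) (snd p) / 2 * (f (fst p) - f (snd p))\<^sup>2"
  have "?F summable_on range (Pair z)"
    using assms finite_energy_summable summable_on_subset_banach subset_UNIV by blast
  then have "(?F \<circ> Pair z) summable_on UNIV"
    by (subst (asm) summable_on_reindex) (auto intro: injI)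
  then have "(\<lambda>y. 2 * (?F \<circ> Pair z) y) summable_on UNIV"
    by (rule summable_on_cmult_right)
  then have "(\<lambda>y. cond z y * (f z - f y)\<^sup>2) summable_on UNIV" by simp
  then show "(\<lambda>y. cond z y + cond z y * (f z - f y)\<^sup>2) summable_on UNIV"
    by (intro summable_on_add cond_summable)
  show "\<bar>cond z y * (f z - f y)\<bar> \<le> cond z y + cond z y * (f z - f y)\<^sup>2" for y
  proof -
    have "\<bar>t\<bar> \<le> 1 + t\<^sup>2" for t :: real
      using sum_squares_bound[of "\<bar>t\<bar>" 1] by simp
    then have "cond z y * \<bar>f z - f y\<bar> \<le> cond z y * (1 + (f z - f y)\<^sup>2)"
      by (intro mult_left_mono) auto
    then show ?thesis by (simp only: abs_mult abs_of_nonneg[OF cond_nonneg] distrib_left mult_1_right)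
  qed
qed

text \<open>The gradient is supported on the row and the column of \<open>z\<close>, each of half
  weight, so the energy is the total conductance at \<open>z\<close>.\<close>

lemma finite_energy_delta [simp]: "finite_energy (delta z)"
  unfolding finite_energy_summable
proof (rule summable_real_bound)
  have *: "(\<lambda>y. cond z y / 2) summable_on UNIV"
    using summable_on_cmult_right[OF cond_summable[of z], of "1/2"] by simp
  show "(\<lambda>p. (if fst p = z then cond z (snd p) / 2 else 0) + (if snd p = z then cond z (fst p) / 2 else 0))
     summable_on UNIV"
    by (intro summable_on_add summable_row(1)[OF *] summable_col(1)[OF *])
qed (auto simp: delta_def cond_sym)

text \<open>Green's identity: testing with a point mass yields minus the graph Laplacian. Row and
  column of \<open>z\<close> contribute equally, which removes the factor one half.\<close>

lemma EE_delta:
  assumes "finite_energy f"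
  shows "EE f (delta z) = (\<Sum>\<^sub>\<infinity>y. cond z y * (f z - f y))"
proof -
  let ?G = "\<lambda>y. 1 / 2 * (cond z y * (f z - f y))"
  have *: "?G summable_on UNIV"
    by (rule summable_on_cmult_right) (rule summable_cond_diff[OF assms])
  have "EE f (delta z) = (\<Sum>\<^sub>\<infinity>p. (if fst p = z then ?G (snd p) else 0) + (if snd p = z then ?G (fst p) else 0))"
    unfolding EE_eq_infsum
    by (rule infsum_cong) (auto simp: delta_def cond_sym algebra_simps)
  also have "\<dots> = (\<Sum>\<^sub>\<infinity>y. ?G y) + (\<Sum>\<^sub>\<infinity>y. ?G y)"
    by (subst infsum_add[OF summable_row(1)[OF *] summable_col(1)[OF *]])
      (simp only: summable_row(2)[OF *] summable_col(2)[OF *])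
  also have "\<dots> = (\<Sum>\<^sub>\<infinity>y. cond z y * (f z - f y))"
    by (simp only: infsum_cmult_right')
  finally show ?thesis .
qed

lemma finite_support_expansion:
  assumes "finite S"
  shows "finite_energy (\<lambda>x. if x \<in> S then f x else 0) \<and>
    (\<forall>g. finite_energy g \<longrightarrow> EE g (\<lambda>x. if x \<in> S then f x else 0) = (\<Sum>a\<in>S. f a * EE g (delta a)))"
  using assms
proof (induction S)
  case (insert a S)
  have eq: "(\<lambda>x. if x \<in> insert a S then f x else 0) = (\<lambda>x. f a * delta a x + (if x \<in> S then f x else 0))"
    using insert.hyps by (auto simp: delta_def)
  show ?case unfolding eq using insert
    by (auto simp: EE_add_right EE_scale_right finite_energy_scale intro!: finite_energy_add finite_energy_scale)
qed simp

text \<open>Absolute convergence is automatic for finite energy, by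
  \<open>summable_cond_diff\<close>, so harmonicity is orthogonality to all point masses.\<close>

lemma discrete_harmonic_iff:
  assumes "finite_energy h"
  shows "discrete_harmonic E c h \<longleftrightarrow> (\<forall>z. EE h (delta z) = 0)"
proof -
  have s: "(\<lambda>y. cond z y * (h y - h z)) summable_on UNIV" for z
    using summable_on_cmult_right[OF summable_cond_diff[OF assms, of z], of "-1"]
    by (simp add: algebra_simps)
  have "(\<lambda>y. c {z, y} * (h y - h z)) summable_on nbrs E z" for z
    using s[of z] summable_nbrs[of z "\<lambda>y. h y - h z"] by simp
  then have "(\<lambda>y. \<bar>c {z, y} * (h y - h z)\<bar>) summable_on nbrs E z" for z
    using summable_on_iff_abs_summable_on_real[of "\<lambda>y. c {z, y} * (h y - h z)" "nbrs E z"] by simp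
  moreover have "(\<Sum>\<^sub>\<infinity>y\<in>nbrs E z. c {z, y} * (h y - h z)) = - EE h (delta z)" for z
    unfolding infsum_nbrs EE_delta[OF assms]
    by (subst infsum_uminus[symmetric]) (simp add: algebra_simps)
  ultimately show ?thesis by (simp add: discrete_harmonic_def)
qed

lemma EE_tendsto:
  assumes "\<And>n. finite_energy (u n)" "finite_energy v" "finite_energy g"
    and "(\<lambda>n. EE (\<lambda>x. u n x - v x) (\<lambda>x. u n x - v x)) \<longlonglongrightarrow> 0"
  shows "(\<lambda>n. EE (u n) g) \<longlonglongrightarrow> EE v g"
  using assms unfolding EE_def finite_energy_def grad_diff by (rule L2_inner_tendsto)

text \<open>The direct method, stated once for three uses: with the null measure and
  \<open>K = 0\<close> for minimal extensions and for the energy projection, and with the measure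
  \<open>m\<close> for the resolvent. The energy does not see constants, so \<open>control\<close>
  has to pin the value at \<open>a\<close>. \<open>C\<close> is not assumed closed: the minimiser
  \<open>v\<close> comes as the limit of members \<open>w n\<close>, and membership is left to the
  caller.\<close>

lemma energy_minimizer:
  fixes \<mu> :: "'v measure" and b :: "'v \<Rightarrow> real" and l :: real
  assumes C: "C \<noteq> {}" "\<And>u. u \<in> C \<Longrightarrow> finite_energy u" "\<And>u. u \<in> C \<Longrightarrow> (\<lambda>x. u x - b x) \<in> L2 \<mu>"
    and mid: "\<And>u v. u \<in> C \<Longrightarrow> v \<in> C \<Longrightarrow> (\<lambda>x. (u x + v x) / 2) \<in> C"
    and l: "0 < l" and K: "0 \<le> K"
    and control: "\<And>u v. u \<in> C \<Longrightarrow> v \<in> C \<Longrightarrow>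
      (u a - v a)\<^sup>2 \<le> K * L2_inner \<mu> (\<lambda>x. u x - v x) (\<lambda>x. u x - v x)"
  obtains v w where "\<And>n. w n \<in> C" "\<And>x. (\<lambda>n. w n x) \<longlonglongrightarrow> v x" "finite_energy v"
    "(\<lambda>x. v x - b x) \<in> L2 \<mu>"
    "(\<lambda>n. EE (\<lambda>x. w n x - v x) (\<lambda>x. w n x - v x)) \<longlonglongrightarrow> 0"
    "\<And>u. u \<in> C \<Longrightarrow> EE v v + l * L2_inner \<mu> (\<lambda>x. v x - b x) (\<lambda>x. v x - b x)
       \<le> EE u u + l * L2_inner \<mu> (\<lambda>x. u x - b x) (\<lambda>x. u x - b x)"
proof -
  define nm where "nm u = L2_inner \<mu> u u" for u
  define J where "J u = EE u u + l * nm (\<lambda>x. u x - b x)" for u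
  define N where "N u = EE u u + l * nm u" for u
  have nm0: "0 \<le> nm u" for u by (simp add: nm_def L2_inner_self_nonneg)
  obtain w where w: "\<And>n. w n \<in> C" "\<And>n u. u \<in> C \<Longrightarrow> J (w n) \<le> J u + 1 / real (Suc n)"
    and cauchy: "\<And>n k. N (\<lambda>x. w n x - w k x) \<le> 2 / real (Suc n) + 2 / real (Suc k)"
  proof (rule minimizing_sequence[of C J N])
    show "0 \<le> J u" if "u \<in> C" for u using l nm0 EE_nonneg by (simp add: J_def)
    show "N (\<lambda>x. u x - v x) = 2 * J u + 2 * J v - 4 * J (\<lambda>x. (u x + v x) / 2)" if uv: "u \<in> C" "v \<in> C" for u v
    proof -
      have 1: "EE (\<lambda>x. u x - v x) (\<lambda>x. u x - v x) = 2 * EE u u + 2 * EE v v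
          - 4 * EE (\<lambda>x. (u x + v x) / 2) (\<lambda>x. (u x + v x) / 2)"
        using C(2)[OF uv(1)] C(2)[OF uv(2)] unfolding EE_def finite_energy_def grad_diff grad_mid
        by (rule L2_parallelogram)
      have eq: "((u x - b x) + (v x - b x)) / 2 = (u x + v x) / 2 - b x"
        "(u x - b x) - (v x - b x) = u x - v x" for x
        by (auto simp: field_simps)
      have 2: "nm (\<lambda>x. u x - v x) = 2 * nm (\<lambda>x. u x - b x) + 2 * nm (\<lambda>x. v x - b x)
          - 4 * nm (\<lambda>x. (u x + v x) / 2 - b x)"
        using L2_parallelogram[OF C(3)[OF uv(1)] C(3)[OF uv(2)]] by (simp only: eq nm_def)
      show ?thesis unfolding N_def J_def 1 2 by (simp add: algebra_simps)
    qed
  qed (use C(1) mid in auto)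
  have B0: "(\<lambda>n. 2 / real (Suc n) * t) \<longlonglongrightarrow> 0" for t
    using tendsto_mult_left_zero[OF lim_const_over_n[THEN LIMSEQ_Suc, of 2]] by simp
  have EEw: "EE (\<lambda>x. w n x - w k x) (\<lambda>x. w n x - w k x) \<le> 2 / real (Suc n) * 1 + 2 / real (Suc k) * 1" for n k
    using cauchy[of n k] mult_nonneg_nonneg[OF less_imp_le[OF l] nm0[of "\<lambda>x. w n x - w k x"]]
    unfolding N_def by linarith
  have nmw: "nm (\<lambda>x. w n x - w k x) \<le> 2 / real (Suc n) * (1 / l) + 2 / real (Suc k) * (1 / l)" for n k
  proof -
    have "l * nm (\<lambda>x. w n x - w k x) \<le> 2 / real (Suc n) + 2 / real (Suc k)"
      using cauchy[of n k] EE_nonneg[of "\<lambda>x. w n x - w k x"] unfolding N_def by linarith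
    then have "nm (\<lambda>x. w n x - w k x) \<le> (2 / real (Suc n) + 2 / real (Suc k)) / l"
      using l by (simp add: pos_le_divide_eq mult.commute)
    then show ?thesis by (simp add: add_divide_distrib)
  qed
  have "\<exists>v. (\<lambda>n. w n x) \<longlonglongrightarrow> v" for x
  proof -
    obtain K1 where K1: "K1 \<ge> 0" "\<And>f. finite_energy f \<Longrightarrow> (f x - f a)\<^sup>2 \<le> K1 * EE f f"
      using sq_diff_le_EE[of x a] by blast
    \<comment> \<open>The value at \<open>x\<close> is split into its difference from the value at
      \<open>a\<close>, bounded by the energy with \<open>K1\<close>, and the value at
      \<open>a\<close>, bounded by the \<open>L2\<close> part with \<open>K\<close>. The factors 2
      come from squaring a sum, and \<open>1 / l\<close> from the weight of the \<open>L2\<close>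
      part.\<close>
    define t where "t = 2 * K1 + 2 * K / l"
    have sq: "(w n x - w k x)\<^sup>2 \<le> 2 / real (Suc n) * t + 2 / real (Suc k) * t" for n k
    proof -
      let ?d = "\<lambda>x. w n x - w k x"
      have "(?d x)\<^sup>2 \<le> 2 * (?d x - ?d a)\<^sup>2 + 2 * (?d a)\<^sup>2"
        using zero_le_power2[of "?d x - 2 * ?d a"] by (simp add: power2_eq_square algebra_simps)
      also have "\<dots> \<le> 2 * (K1 * EE ?d ?d) + 2 * (K * nm ?d)"
        using K1(2)[OF finite_energy_diff[OF C(2)[OF w(1)] C(2)[OF w(1)]], of n k]
          control[OF w(1) w(1), of n k] unfolding nm_def by linarith
      also have "\<dots> \<le> 2 * (K1 * (2 / real (Suc n) * 1 + 2 / real (Suc k) * 1))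
          + 2 * (K * (2 / real (Suc n) * (1 / l) + 2 / real (Suc k) * (1 / l)))"
        using K1(1) K by (intro add_mono mult_left_mono EEw nmw) auto
      also have "\<dots> = 2 / real (Suc n) * t + 2 / real (Suc k) * t"
        unfolding t_def by (simp add: algebra_simps)
      finally show ?thesis .
    qed
    have "Cauchy (\<lambda>n. w n x)"
    proof (rule metric_CauchyI)
      fix e :: real assume "0 < e"
      then have "\<forall>\<^sub>F n in sequentially. 2 / real (Suc n) * t < e\<^sup>2 / 2"
        by (intro order_tendstoD(2)[OF B0]) auto
      then obtain M where M: "\<And>n. n \<ge> M \<Longrightarrow> 2 / real (Suc n) * t < e\<^sup>2 / 2"
        by (auto simp: eventually_sequentially)
      show "\<exists>M. \<forall>m\<ge>M. \<forall>n\<ge>M. dist (w m x) (w n x) < e"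
      proof (intro exI[of _ M] allI impI)
        fix m n assume "M \<le> m" "M \<le> n"
        then have "(w m x - w n x)\<^sup>2 < e\<^sup>2" using sq[of m n] M[of m] M[of n] by linarith
        then show "dist (w m x) (w n x) < e"
          using \<open>0 < e\<close> abs_square_less_1 power2_less_imp_less[of "\<bar>w m x - w n x\<bar>" e]
          by (simp add: dist_real_def)
      qed
    qed
    then show ?thesis by (simp add: convergent_eq_Cauchy convergent_def)
  qed
  then obtain v where v: "\<And>x. (\<lambda>n. w n x) \<longlonglongrightarrow> v x" by metis
  have gl: "(\<lambda>n. grad (w n) p) \<longlonglongrightarrow> grad v p" for p
    unfolding grad_def by (intro tendsto_intros v)
  have wf: "grad (w n) \<in> L2 edge_measure" for n
    using C(2)[OF w(1)[of n]] by (simp add: finite_energy_def)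
  note lim1 = L2_Cauchy_limit[OF wf EEw[unfolded EE_def grad_diff] B0 gl]
  have wb: "(\<lambda>x. w n x - b x) \<in> L2 \<mu>" for n by (rule C(3)[OF w(1)])
  have eqb: "(w n x - b x) - (w k x - b x) = w n x - w k x" for n k x by simp
  have cb: "L2_inner \<mu> (\<lambda>x. (w n x - b x) - (w k x - b x)) (\<lambda>x. (w n x - b x) - (w k x - b x))
      \<le> 2 / real (Suc n) * (1 / l) + 2 / real (Suc k) * (1 / l)" for n k
    using nmw[of n k] unfolding eqb nm_def .
  have lb: "(\<lambda>n. w n x - b x) \<longlonglongrightarrow> v x - b x" for x by (intro tendsto_intros v)
  note lim2 = L2_Cauchy_limit[OF wb cb B0 lb]
  have fv: "finite_energy v" using lim1(1) by (simp add: finite_energy_def)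
  have J: "(\<lambda>n. J (w n)) \<longlonglongrightarrow> J v"
    unfolding J_def nm_def EE_def
    by (intro tendsto_add tendsto_mult tendsto_const L2_inner_self_tendsto wf wb lim1 lim2)
  have "J v \<le> J u" if "u \<in> C" for u
  proof (rule LIMSEQ_le[OF J])
    show "(\<lambda>n. J u + 1 / real (Suc n)) \<longlonglongrightarrow> J u"
      using tendsto_add[OF tendsto_const B0[of "1/2"], of "J u"] by (simp del: of_nat_Suc)
    show "\<exists>N. \<forall>n\<ge>N. J (w n) \<le> J u + 1 / real (Suc n)" using w(2)[OF that] by blast
  qed
  then show ?thesis
    using that[of w v] w(1) v fv lim1(2) lim2(1) unfolding J_def nm_def EE_def grad_diff by blast
qed

end

section \<open>Minimal extensions and the orthogonal decomposition\<close>

context network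
begin

lemma EE_variation:
  assumes h: "finite_energy h" and v: "finite_energy v"
    and min: "\<And>t. EE h h \<le> EE (\<lambda>x. h x + t * v x) (\<lambda>x. h x + t * v x)"
  shows "EE h v = 0"
proof -
  have "2 * EE h v = 0"
  proof (rule quadratic_nonneg_imp_linear_zero)
    show "0 \<le> t * (2 * EE h v) + t\<^sup>2 * EE v v" for t
      using min[of t] EE_add_self[OF h finite_energy_scale[OF v, of t]]
      by (simp add: EE_scale_left EE_scale_right power2_eq_square algebra_simps)
  qed
  then show ?thesis by simp
qed

text \<open>Existence is the direct method; here the pointwise limit keeps the values on
  \<open>A\<close>, so the minimiser stays in \<open>C\<close>. For uniqueness, the midpoint of two
  minimisers also competes, so their difference has energy zero, is constant by connectedness, and
  vanishes on \<open>A\<close>. The last claim is the first-order condition.\<close>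

lemma min_energy_ext:
  fixes A :: "'v set" and \<phi> :: "'v \<Rightarrow> real"
  assumes A: "finite A" "A \<noteq> {}"
  defines "h \<equiv> min_energy_ext E c A \<phi>"
  shows "finite_energy h" and "\<And>x. x \<in> A \<Longrightarrow> h x = \<phi> x"
    and "\<And>v. finite_energy v \<Longrightarrow> (\<And>x. x \<in> A \<Longrightarrow> v x = 0) \<Longrightarrow> EE h v = 0"
proof -
  define C where "C = {u. finite_energy u \<and> (\<forall>x\<in>A. u x = \<phi> x)}"
  obtain a where a: "a \<in> A" using A by blast
  let ?N = "null_measure (count_space UNIV) :: 'v measure"
  obtain v w where w: "\<And>n. w n \<in> C" "\<And>x. (\<lambda>n. w n x) \<longlonglongrightarrow> v x" and v: "finite_energy v"
    and min: "\<And>u. u \<in> C \<Longrightarrow> EE v v \<le> EE u u"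
  proof (rule energy_minimizer[of C "\<lambda>_. 0" ?N 1 0 a])
    have "(\<lambda>x. if x \<in> A then \<phi> x else 0) \<in> C"
      using finite_support_expansion[OF A(1)] by (simp add: C_def)
    then show "C \<noteq> {}" by blast
    \<comment> \<open>Both functions take the prescribed value at \<open>a\<close>, so
      \<open>K = 0\<close> will do.\<close>
    show "(u a - v a)\<^sup>2 \<le> 0 * L2_inner ?N (\<lambda>x. u x - v x) (\<lambda>x. u x - v x)" if "u \<in> C" "v \<in> C" for u v
      using that a by (simp add: C_def)
  qed (auto simp: C_def L2_null_measure finite_energy_mid)
  have "v x = \<phi> x" if "x \<in> A" for x
    using LIMSEQ_unique[OF w(2)[of x]] w(1) that by (simp add: C_def)
  then have vC: "v \<in> C" using v by (simp add: C_def)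
  have "h = v" unfolding h_def min_energy_ext_def
  proof (rule the_equality)
    show "(\<forall>x\<in>A. v x = \<phi> x) \<and> (\<forall>f. (\<forall>x\<in>A. f x = \<phi> x) \<longrightarrow> energy E c v \<le> energy E c f)"
    proof (intro conjI allI impI)
      fix f assume f: "\<forall>x\<in>A. f x = \<phi> x"
      show "energy E c v \<le> energy E c f"
      proof (cases "finite_energy f")
        case True
        then show ?thesis using min[of f] f by (simp add: energy_eq_EE v C_def ennreal_leI)
      next
        case False
        then show ?thesis by (simp add: finite_energy_iff less_top[symmetric])
      qed
    qed (use vC in \<open>auto simp: C_def\<close>)
    fix h' assume h': "(\<forall>x\<in>A. h' x = \<phi> x) \<and> (\<forall>f. (\<forall>x\<in>A. f x = \<phi> x) \<longrightarrow> energy E c h' \<le> energy E c f)"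
    then have le: "energy E c h' \<le> energy E c v" using vC by (auto simp: C_def)
    then have fh: "finite_energy h'"
      unfolding finite_energy_iff using energy_eq_EE[OF v] by (simp add: le_less_trans[OF _ ennreal_less_top])
    then have h'C: "h' \<in> C" using h' by (simp add: C_def)
    have "EE h' h' \<le> EE v v" using le by (simp add: energy_eq_EE v fh EE_nonneg)
    moreover have "EE (\<lambda>x. h' x - v x) (\<lambda>x. h' x - v x) = 2 * EE h' h' + 2 * EE v v
        - 4 * EE (\<lambda>x. (h' x + v x) / 2) (\<lambda>x. (h' x + v x) / 2)"
      using fh v unfolding EE_def finite_energy_def grad_diff grad_mid by (rule L2_parallelogram)
    moreover have "EE v v \<le> EE (\<lambda>x. (h' x + v x) / 2) (\<lambda>x. (h' x + v x) / 2)"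
      using h'C vC by (intro min) (auto simp: C_def finite_energy_mid)
    ultimately have "EE (\<lambda>x. h' x - v x) (\<lambda>x. h' x - v x) = 0"
      using EE_nonneg[of "\<lambda>x. h' x - v x"] by linarith
    then have "h' x - v x = h' a - v a" for x
      using EE_zero_imp_const[OF finite_energy_diff[OF fh v], of x a] by simp
    then show "h' = v" using h'C vC a by (auto simp: C_def)
  qed
  then show "finite_energy h" "\<And>x. x \<in> A \<Longrightarrow> h x = \<phi> x" using vC by (auto simp: C_def)
  show "EE h u = 0" if u: "finite_energy u" "\<And>x. x \<in> A \<Longrightarrow> u x = 0" for u
    unfolding \<open>h = v\<close>
  proof (rule EE_variation[OF v u(1)])
    show "EE v v \<le> EE (\<lambda>x. v x + t * u x) (\<lambda>x. v x + t * u x)" for t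
      using vC u by (intro min) (auto simp: C_def intro!: finite_energy_add finite_energy_scale)
  qed
qed

text \<open>The element of least energy in \<open>f\<close> plus finitely supported functions is
  orthogonal to every point mass, hence harmonic, while its difference from \<open>f\<close> is an
  energy limit of functions that are orthogonal to all harmonic ones.\<close>

lemma energy_projection:
  assumes f: "finite_energy f"
  obtains v where "finite_energy v" "discrete_harmonic E c v"
    "\<And>h. finite_energy h \<Longrightarrow> discrete_harmonic E c h \<Longrightarrow> EE (\<lambda>x. f x - v x) h = 0"
proof -
  obtain a :: 'v where True by blast
  define fs where "fs S g x = (if x \<in> S then g x else 0)" for S :: "'v set" and g :: "'v \<Rightarrow> real" and x
  \<comment> \<open>The constant \<open>t\<close> costs no energy; it is spent on normalising
    \<open>u a = 0\<close>, which turns convergence in energy into pointwise convergence.\<close>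
  define C where "C = {u. \<exists>S g t. finite S \<and> u = (\<lambda>x. f x - fs S g x - t) \<and> u a = 0}"
  have fs: "finite_energy (fs S g)" "\<And>h. finite_energy h \<Longrightarrow> EE h (fs S g) = (\<Sum>x\<in>S. g x * EE h (delta x))"
    if "finite S" for S g
    using finite_support_expansion[OF that, of g] unfolding fs_def[abs_def] by auto
  have CI: "u \<in> C" if "finite S" "\<And>x. x \<notin> S \<Longrightarrow> u x = f x - t" "u a = 0" for u S t
    unfolding C_def using that
    by (auto simp: fs_def intro!: exI[of _ S] exI[of _ "\<lambda>x. f x - u x - t"] exI[of _ t])
  have CE: "\<exists>S t. finite S \<and> (\<forall>x. x \<notin> S \<longrightarrow> u x = f x - t) \<and> u a = 0 \<and> finite_energy u" if uC: "u \<in> C" for u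
  proof -
    obtain S g t where *: "finite S" "u = (\<lambda>x. f x - fs S g x - t)" "u a = 0"
      using uC by (auto simp: C_def)
    have "finite_energy u"
      unfolding *(2) by (intro finite_energy_diff f fs(1)[OF *(1)] finite_energy_const)
    moreover have "\<forall>x. x \<notin> S \<longrightarrow> u x = f x - t" by (simp add: *(2) fs_def)
    ultimately show ?thesis using *(1,3) by blast
  qed
  let ?N = "null_measure (count_space UNIV) :: 'v measure"
  obtain v w where w: "\<And>n. w n \<in> C" and lim: "(\<lambda>n. EE (\<lambda>x. w n x - v x) (\<lambda>x. w n x - v x)) \<longlonglongrightarrow> 0"
    and v: "finite_energy v" and min: "\<And>u. u \<in> C \<Longrightarrow> EE v v \<le> EE u u"
  proof (rule energy_minimizer[of C "\<lambda>_. 0" ?N 1 0 a])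
    have "(\<lambda>x. f x - f a) \<in> C" by (rule CI[of "{}" _ "f a"]) auto
    then show "C \<noteq> {}" by blast
    show "(\<lambda>x. (u x + v x) / 2) \<in> C" if uv: "u \<in> C" "v \<in> C" for u v
    proof -
      obtain S t S' t' where "finite S" "\<forall>x. x \<notin> S \<longrightarrow> u x = f x - t" "u a = 0"
        "finite S'" "\<forall>x. x \<notin> S' \<longrightarrow> v x = f x - t'" "v a = 0"
        using CE[OF uv(1)] CE[OF uv(2)] by blast
      then have *: "finite (S \<union> S')" "(u a + v a) / 2 = 0"
        "\<And>x. x \<notin> S \<union> S' \<Longrightarrow> u x = f x - t \<and> v x = f x - t'" by auto
      show ?thesis
      proof (rule CI)
        show "finite (S \<union> S')" "(u a + v a) / 2 = 0" by fact+
        show "(u x + v x) / 2 = f x - (t + t') / 2" if "x \<notin> S \<union> S'" for x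
          using *(3)[OF that] by (simp add: field_simps)
      qed
    qed
    show "(u a - v a)\<^sup>2 \<le> 0 * L2_inner ?N (\<lambda>x. u x - v x) (\<lambda>x. u x - v x)" if "u \<in> C" "v \<in> C" for u v
    proof -
      have "u a = 0" "v a = 0" using CE[OF that(1)] CE[OF that(2)] by blast+
      then show ?thesis by simp
    qed
  qed (use CE in \<open>auto simp: L2_null_measure\<close>)
  have fw: "finite_energy (w n)" for n using CE[OF w] by blast
  have "EE v (delta z) = 0" for z
  proof (rule EE_variation[OF v finite_energy_delta])
    fix t
    \<comment> \<open>\<open>v\<close> may lie outside \<open>C\<close>, so the perturbation is
      applied to \<open>w n\<close>, renormalised at \<open>a\<close> by a constant, and
      \<open>n\<close> is sent to infinity afterwards.\<close>
    have le: "EE v v \<le> EE (w n) (w n) + 2 * t * EE (w n) (delta z) + t\<^sup>2 * EE (delta z) (delta z)" for n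
    proof -
      let ?u = "\<lambda>x. (w n x + t * delta z x) + - t * delta z a"
      have fe: "finite_energy (\<lambda>x. w n x + t * delta z x)"
        by (intro finite_energy_add fw finite_energy_scale finite_energy_delta)
      obtain S s where "finite S" "\<forall>x. x \<notin> S \<longrightarrow> w n x = f x - s" "w n a = 0" using CE[OF w] by blast
      then have "?u \<in> C"
        by (intro CI[of "insert z S" _ "s + t * delta z a"]) (auto simp: delta_def)
      then have "EE v v \<le> EE ?u ?u" by (rule min)
      also have "\<dots> = EE (\<lambda>x. w n x + t * delta z x) (\<lambda>x. w n x + t * delta z x)"
        using EE_add_self[OF fe finite_energy_const, of "- t * delta z a"] by simp
      also have "\<dots> = EE (w n) (w n) + 2 * t * EE (w n) (delta z) + t\<^sup>2 * EE (delta z) (delta z)"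
        using EE_add_self[OF fw finite_energy_scale[OF finite_energy_delta], of n t z]
        by (simp add: EE_scale_left EE_scale_right power2_eq_square)
      finally show ?thesis .
    qed
    have "(\<lambda>n. EE (w n) (w n)) \<longlonglongrightarrow> EE v v"
      using fw v lim unfolding finite_energy_def EE_def grad_diff by (rule L2_inner_self_tendsto)
    then have "(\<lambda>n. EE (w n) (w n) + 2 * t * EE (w n) (delta z) + t\<^sup>2 * EE (delta z) (delta z))
        \<longlonglongrightarrow> EE v v + 2 * t * EE v (delta z) + t\<^sup>2 * EE (delta z) (delta z)"
      by (intro tendsto_intros EE_tendsto[OF fw v finite_energy_delta lim])
    then have "EE v v \<le> EE v v + 2 * t * EE v (delta z) + t\<^sup>2 * EE (delta z) (delta z)"
      by (rule LIMSEQ_le_const) (use le in blast)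
    then show "EE v v \<le> EE (\<lambda>x. v x + t * delta z x) (\<lambda>x. v x + t * delta z x)"
      using EE_add_self[OF v finite_energy_scale[OF finite_energy_delta], of t z]
      by (simp add: EE_scale_left EE_scale_right power2_eq_square)
  qed
  then have hv: "discrete_harmonic E c v" by (simp add: discrete_harmonic_iff[OF v])
  have "EE (\<lambda>x. f x - v x) h = 0" if h: "finite_energy h" "discrete_harmonic E c h" for h
  proof -
    \<comment> \<open>Finitely supported functions and constants are both orthogonal to
      \<open>h\<close>, so the product with \<open>h\<close> is the same for all members of
      \<open>C\<close>.\<close>
    have "EE (w n) h = EE f h" for n
    proof -
      obtain S g t where *: "finite S" "w n = (\<lambda>x. f x - fs S g x - t)" using w[of n] by (auto simp: C_def)
      have "EE (fs S g) h = 0"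
        using fs(2)[OF *(1) h(1)] h discrete_harmonic_iff[OF h(1)] by (simp add: EE_commute[of _ h])
      then show ?thesis
        using EE_diff_left[OF f fs(1)[OF *(1)] h(1), of g]
          EE_diff_left[OF finite_energy_diff[OF f fs(1)[OF *(1)]] finite_energy_const h(1), of g t]
        by (simp add: *(2))
    qed
    then have "EE v h = EE f h"
      using LIMSEQ_unique[OF EE_tendsto[OF fw v h(1) lim]] by simp
    then show ?thesis by (simp add: EE_diff_left f v h)
  qed
  then show ?thesis using that v hv by blast
qed

lemma energy_orthogonal_sum:
  "energy_orthogonal_sum E c (reflected_dirichlet_space E c)
      (extended_dirichlet_space E c) (finite_energy_harmonic E c)"
proof -
  have H: "h \<in> finite_energy_harmonic E c \<longleftrightarrow> finite_energy h \<and> (\<forall>z. EE h (delta z) = 0)" for h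
    unfolding finite_energy_harmonic_def finite_energy_iff[symmetric]
    using discrete_harmonic_iff by blast
  have X: "f \<in> extended_dirichlet_space E c \<longleftrightarrow>
      finite_energy f \<and> (\<forall>h\<in>finite_energy_harmonic E c. EE f h = 0)" for f
    unfolding extended_dirichlet_space_def finite_energy_iff[symmetric]
    using H energy_form_eq[of f] by auto
  have R: "f \<in> reflected_dirichlet_space E c \<longleftrightarrow> finite_energy f" for f
    by (simp add: reflected_dirichlet_space_def finite_energy_iff)
  show ?thesis
    unfolding energy_orthogonal_sum_def
  proof (intro conjI)
    have HF: "finite_energy h" if "h \<in> finite_energy_harmonic E c" for h using that H by blast
    show "function_subspace (extended_dirichlet_space E c)"
      unfolding function_subspace_def
    proof (intro conjI ballI allI)
      show "(\<lambda>_. 0) \<in> extended_dirichlet_space E c" by (simp add: X)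
      show "(\<lambda>x. f x + g x) \<in> extended_dirichlet_space E c"
        if "f \<in> extended_dirichlet_space E c" "g \<in> extended_dirichlet_space E c" for f g
        using that HF unfolding X by (simp add: EE_add_left finite_energy_add)
      show "(\<lambda>x. a * f x) \<in> extended_dirichlet_space E c"
        if "f \<in> extended_dirichlet_space E c" for a f
        using that unfolding X by (simp add: EE_scale_left finite_energy_scale)
    qed
    show "function_subspace (finite_energy_harmonic E c)"
      unfolding function_subspace_def
    proof (intro conjI ballI allI)
      show "(\<lambda>_. 0) \<in> finite_energy_harmonic E c" by (simp add: H)
      show "(\<lambda>x. f x + g x) \<in> finite_energy_harmonic E c"
        if "f \<in> finite_energy_harmonic E c" "g \<in> finite_energy_harmonic E c" for f g
        using that unfolding H by (simp add: EE_add_left finite_energy_add)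
      show "(\<lambda>x. a * f x) \<in> finite_energy_harmonic E c"
        if "f \<in> finite_energy_harmonic E c" for a f
        using that unfolding H by (simp add: EE_scale_left finite_energy_scale)
    qed
    show "\<forall>f\<in>extended_dirichlet_space E c. \<forall>g\<in>finite_energy_harmonic E c. energy_form E c f g = 0"
      by (auto simp: extended_dirichlet_space_def)
    show "reflected_dirichlet_space E c =
        {\<lambda>x. f x + g x |f g. f \<in> extended_dirichlet_space E c \<and> g \<in> finite_energy_harmonic E c}"
    proof (intro set_eqI iffI)
      fix f assume "f \<in> reflected_dirichlet_space E c"
      then have f: "finite_energy f" by (simp add: R)
      obtain v where v: "finite_energy v" "discrete_harmonic E c v"
        "\<And>h. finite_energy h \<Longrightarrow> discrete_harmonic E c h \<Longrightarrow> EE (\<lambda>x. f x - v x) h = 0"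
        using energy_projection[OF f] by blast
      have "v \<in> finite_energy_harmonic E c"
        using v by (simp add: finite_energy_harmonic_def finite_energy_iff)
      moreover have "(\<lambda>x. f x - v x) \<in> extended_dirichlet_space E c"
        unfolding X using v finite_energy_diff[OF f v(1)] by (auto simp: finite_energy_harmonic_def finite_energy_iff)
      ultimately show "f \<in> {\<lambda>x. f x + g x |f g. f \<in> extended_dirichlet_space E c \<and> g \<in> finite_energy_harmonic E c}"
        by - (intro CollectI, rule exI[of _ "\<lambda>x. f x - v x"], rule exI[of _ v], simp)
    qed (auto simp: R X H intro: finite_energy_add)
  qed
qed

end

section \<open>Resolvents\<close>

locale weighted_network = network E c for E :: "'v set set" and c :: "'v set \<Rightarrow> real" +
  fixes mm :: "'v \<Rightarrow> real"
  assumes mm_pos: "0 < mm x"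
begin

lemma mm_nonneg [simp]: "0 \<le> mm x"
  using mm_pos[of x] by simp

definition m :: "'v measure" where
  "m = point_measure UNIV (\<lambda>x. ennreal (mm x))"

abbreviation "ip \<equiv> L2_inner m"

lemma measurable_m [simp]: "f \<in> borel_measurable m"
  by (simp add: m_def)

lemma L2_m_iff: "f \<in> L2 m \<longleftrightarrow> (\<lambda>x. mm x * (f x)\<^sup>2) summable_on UNIV"
  unfolding m_def by (rule L2_point_measure_iff) simp

lemma ip_eq: "ip f g = (\<Sum>\<^sub>\<infinity>x. mm x * (f x * g x))"
  unfolding m_def by (rule L2_inner_point_measure) simp

lemma ip_summable: "f \<in> L2 m \<Longrightarrow> g \<in> L2 m \<Longrightarrow> (\<lambda>x. mm x * (f x * g x)) summable_on UNIV"
  using L2_mult_integrable[of f m g] unfolding m_def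
  by (subst (asm) integrable_point_measure_iff) auto

lemma delta_L2 [simp]: "delta y \<in> L2 m"
  unfolding L2_m_iff by (rule infsum_single_point(1)[of y]) (simp add: delta_def)

lemma ip_delta: "ip (delta y) v = mm y * v y"
  unfolding ip_eq by (subst infsum_single_point(2)[of y]) (simp_all add: delta_def)

lemma point_le_ip: "f \<in> L2 m \<Longrightarrow> mm x * (f x)\<^sup>2 \<le> ip f f"
  using infsum_ge_single[OF ip_summable, of f f x] by (simp add: ip_eq power2_eq_square)

lemma ip_zero_imp: "f \<in> L2 m \<Longrightarrow> ip f f \<le> 0 \<Longrightarrow> f x = 0"
  using order_trans[OF point_le_ip[of f x], of 0] mm_pos[of x] by (auto simp: mult_le_0_iff)

text \<open>Weak form of \<open>(l - L) g = f\<close> for the generator \<open>L\<close> of the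
  energy form. Testing against all square integrable \<open>v\<close> of finite energy, instead of
  finitely supported ones, is what selects the reflected form.\<close>

definition is_resolvent :: "real \<Rightarrow> ('v \<Rightarrow> real) \<Rightarrow> ('v \<Rightarrow> real) \<Rightarrow> bool" where
  "is_resolvent l f g \<longleftrightarrow> finite_energy g \<and> g \<in> L2 m \<and>
     (\<forall>v. finite_energy v \<longrightarrow> v \<in> L2 m \<longrightarrow> EE g v + l * ip g v = ip f v)"

lemma is_resolventD:
  assumes "is_resolvent l f g"
  shows "finite_energy g" "g \<in> L2 m"
    "\<And>v. finite_energy v \<Longrightarrow> v \<in> L2 m \<Longrightarrow> EE g v + l * ip g v = ip f v"
  using assms by (auto simp: is_resolvent_def)

lemma resolvent_exists:
  assumes l: "0 < l" and f: "f \<in> L2 m"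
  shows "\<exists>g. is_resolvent l f g"
proof -
  define C where "C = {u. finite_energy u \<and> u \<in> L2 m}"
  \<comment> \<open>Centring the \<open>L2\<close> penalty at \<open>f / l\<close> makes the
    first-order condition of the minimiser the resolvent equation for \<open>f\<close>.\<close>
  define b where "b x = (1 / l) * f x" for x
  have b: "b \<in> L2 m" unfolding b_def[abs_def] by (rule L2_scale[OF f])
  obtain a :: 'v where True by blast
  obtain g where g: "finite_energy g" "(\<lambda>x. g x - b x) \<in> L2 m"
    and min: "\<And>u. u \<in> C \<Longrightarrow> EE g g + l * ip (\<lambda>x. g x - b x) (\<lambda>x. g x - b x)
       \<le> EE u u + l * ip (\<lambda>x. u x - b x) (\<lambda>x. u x - b x)"
  \<comment> \<open>A single term of the norm controls the value at \<open>a\<close>, with constant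
    \<open>1 / mm a\<close>.\<close>
  proof (rule energy_minimizer[of C b m l "1 / mm a" a])
    have "(\<lambda>x. 0) \<in> C" by (simp add: C_def)
    then show "C \<noteq> {}" by blast
    show "(u a - v a)\<^sup>2 \<le> 1 / mm a * ip (\<lambda>x. u x - v x) (\<lambda>x. u x - v x)" if "u \<in> C" "v \<in> C" for u v
      using point_le_ip[of "\<lambda>x. u x - v x" a] that mm_pos[of a]
      by (simp add: C_def L2_diff field_simps)
    show "(\<lambda>x. (u x + v x) / 2) \<in> C" if "u \<in> C" "v \<in> C" for u v
      using that L2_scale[OF L2_add, of u m v "1/2"] by (simp add: C_def finite_energy_mid)
  qed (use l b in \<open>auto simp: C_def L2_diff\<close>)
  have gL: "g \<in> L2 m" using L2_add[OF g(2) b] by simp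
  have "EE g v + l * ip g v = ip f v" if v: "finite_energy v" "v \<in> L2 m" for v
  proof -
    have "2 * (EE g v + l * ip (\<lambda>x. g x - b x) v) = 0"
    proof (rule quadratic_nonneg_imp_linear_zero)
      fix t
      let ?g = "\<lambda>x. g x - b x"
      have tv: "finite_energy (\<lambda>x. t * v x)" "(\<lambda>x. t * v x) \<in> L2 m"
        using v by (auto intro: finite_energy_scale L2_scale)
      have u: "(\<lambda>x. g x + t * v x) \<in> C"
        using g gL tv by (auto simp: C_def intro: finite_energy_add L2_add)
      have "(\<lambda>x. g x + t * v x - b x) = (\<lambda>x. ?g x + t * v x)" by auto
      then have "ip (\<lambda>x. g x + t * v x - b x) (\<lambda>x. g x + t * v x - b x)
          = ip ?g ?g + 2 * t * ip ?g v + t\<^sup>2 * ip v v"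
        using L2_inner_add_left[OF g(2) tv(2) L2_add[OF g(2) tv(2)]] L2_inner_add_right[OF g(2) tv(2) g(2)]
          L2_inner_add_right[OF g(2) tv(2) v(2)] L2_inner_commute[of m v ?g]
        by (simp add: L2_inner_scale_left L2_inner_scale_right power2_eq_square algebra_simps)
      then show "0 \<le> t * (2 * (EE g v + l * ip ?g v)) + t\<^sup>2 * (EE v v + l * ip v v)"
        using min[OF u] EE_add_self[OF g(1) tv(1)]
        by (simp add: EE_scale_left EE_scale_right power2_eq_square algebra_simps)
    qed
    moreover have "l * ip (\<lambda>x. g x - b x) v = l * ip g v - ip f v"
      using L2_inner_diff_left[OF gL b v(2)] L2_inner_scale_left[of m "1 / l" f v] l
      by (simp add: b_def[abs_def] right_diff_distrib)
    ultimately show ?thesis by simp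
  qed
  then show ?thesis using g gL by (auto simp: is_resolvent_def)
qed

text \<open>Truncation is monotone and a contraction, so the increment of \<open>max d 0\<close>
  along an edge has the sign of that of \<open>d\<close> and is no larger. This is the Markov
  property of the energy form.\<close>

lemma finite_energy_pos_part:
  assumes "finite_energy d"
  shows "finite_energy (\<lambda>x. max (d x) 0)"
    and "EE (\<lambda>x. max (d x) 0) (\<lambda>x. max (d x) 0) \<le> EE d (\<lambda>x. max (d x) 0)"
proof -
  let ?v = "\<lambda>x. max (d x) 0"
  show fv: "finite_energy ?v"
    using assms unfolding finite_energy_def
    by (elim L2_dominated) (auto simp: grad_def)
  show "EE ?v ?v \<le> EE d ?v"
    unfolding EE_eq_infsum
  proof (rule infsum_mono[OF EE_summable[OF fv fv] EE_summable[OF assms fv]])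
    fix p :: "'v \<times> 'v"
    have "(max s 0 - max t 0) * (max s 0 - max t 0) \<le> (s - t) * (max s 0 - max t 0)" for s t :: real
      by (cases "0 \<le> s"; cases "0 \<le> t")
        (auto simp: max_def not_le mult_nonpos_nonneg mult_nonneg_nonpos mult_right_mono mult_right_mono_neg algebra_simps)
    then show "cond (fst p) (snd p) / 2 * ((?v (fst p) - ?v (snd p)) * (?v (fst p) - ?v (snd p)))
        \<le> cond (fst p) (snd p) / 2 * ((d (fst p) - d (snd p)) * (?v (fst p) - ?v (snd p)))"
      by (intro mult_left_mono) auto
  qed
qed

text \<open>Weak maximum principle: the test function is the positive part of \<open>u - g\<close>,
  and both its energy and its norm come out as at most zero.\<close>

lemma subsolution_le_resolvent:
  assumes l: "0 < l" and g: "is_resolvent l f g" and u: "finite_energy u" "u \<in> L2 m"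
    and sub: "\<And>v. finite_energy v \<Longrightarrow> v \<in> L2 m \<Longrightarrow> (\<And>x. 0 \<le> v x) \<Longrightarrow> EE u v + l * ip u v \<le> ip f v"
  shows "u x \<le> g x"
proof -
  let ?d = "\<lambda>x. u x - g x"
  let ?v = "\<lambda>x. max (?d x) 0"
  note gD = is_resolventD[OF g]
  have d: "finite_energy ?d" "?d \<in> L2 m" using u gD by (auto intro: finite_energy_diff L2_diff)
  have v: "finite_energy ?v" "?v \<in> L2 m"
    using finite_energy_pos_part[OF d(1)] L2_dominated[OF d(2), of ?v] by auto
  have dv: "?d x * ?v x = ?v x * ?v x" for x by (auto simp: max_def)
  have eq: "ip ?d ?v = ip ?v ?v" unfolding ip_eq dv ..
  have "EE ?v ?v + l * ip ?v ?v \<le> EE ?d ?v + l * ip ?d ?v"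
    using finite_energy_pos_part[OF d(1)] eq by simp
  also have "\<dots> = (EE u ?v + l * ip u ?v) - (EE g ?v + l * ip g ?v)"
    using u gD(1,2) v by (simp add: EE_diff_left L2_inner_diff_left algebra_simps)
  also have "\<dots> \<le> 0" using sub[OF v] gD(3)[OF v] by simp
  finally have "l * ip ?v ?v \<le> 0" using EE_nonneg[of ?v] by linarith
  then have "ip ?v ?v \<le> 0" using l by (simp add: mult_le_0_iff)
  then have "?v x = 0" by (rule ip_zero_imp[OF v(2)])
  then show ?thesis by simp
qed

text \<open>Maximum principle with the positive part of \<open>g - 1 / l\<close> as test function.
  The constant \<open>1 / l\<close> has no energy but may fail to be square integrable; the
  truncated function is dominated by \<open>|g|\<close> and therefore admissible.\<close>

lemma resolvent_le_one:
  assumes l: "0 < l" and g: "is_resolvent l f g" and f: "f \<in> L2 m" "\<And>x. f x \<le> 1"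
  shows "l * g x \<le> 1"
proof -
  let ?d = "\<lambda>x. g x - 1 / l"
  let ?v = "\<lambda>x. max (?d x) 0"
  note gD = is_resolventD[OF g]
  have d: "finite_energy ?d" using gD by (auto intro: finite_energy_diff)
  have "\<bar>max (a - k) 0\<bar> \<le> \<bar>a\<bar>" if "0 < k" for a k :: real using that by (auto simp: max_def)
  then have "\<bar>?v x\<bar> \<le> \<bar>g x\<bar>" for x using l by simp
  then have v: "finite_energy ?v" "?v \<in> L2 m"
    using finite_energy_pos_part[OF d(1)] L2_dominated[OF gD(2), of ?v] by auto
  have lg: "(\<lambda>x. l * g x - f x) \<in> L2 m" using gD f by (auto intro: L2_diff L2_scale)
  have "l * ip ?v ?v = ip (\<lambda>x. l * ?v x) ?v" by (simp add: L2_inner_scale_left)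
  also have "\<dots> \<le> ip (\<lambda>x. l * g x - f x) ?v"
    unfolding ip_eq
  proof (rule infsum_mono[OF ip_summable[OF L2_scale[OF v(2)] v(2)] ip_summable[OF lg v(2)]])
    fix x
    \<comment> \<open>Where the test function is nonzero, \<open>l * ?v x\<close> equals
      \<open>l * g x - 1\<close>, which is at most \<open>l * g x - f x\<close>.\<close>
    have "l * ?v x * ?v x \<le> (l * g x - f x) * ?v x"
    proof (cases "?d x \<le> 0")
      case False
      then have "l * ?v x = l * g x - 1" using l by (simp add: max_def field_simps)
      then show ?thesis using f(2)[of x] by (intro mult_right_mono) auto
    qed simp
    then show "mm x * (l * ?v x * ?v x) \<le> mm x * ((l * g x - f x) * ?v x)"
      by (intro mult_left_mono) auto
  qed
  also have "\<dots> = l * ip g ?v - ip f ?v"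
    using L2_inner_diff_left[OF L2_scale[OF gD(2)] f(1) v(2), of l] by (simp add: L2_inner_scale_left)
  also have "\<dots> = - EE g ?v" using gD(3)[OF v] by simp
  also have "\<dots> = - EE ?d ?v"
    using EE_diff_left[OF gD(1) finite_energy_const v(1), of "1 / l"] by simp
  also have "\<dots> \<le> 0" using finite_energy_pos_part(2)[OF d] EE_nonneg[of ?v] by linarith
  finally have "ip ?v ?v \<le> 0" using l by (simp add: mult_le_0_iff)
  then have "?v x = 0" by (rule ip_zero_imp[OF v(2)])
  then show ?thesis using l by (simp add: max_def field_simps split: if_splits)
qed

lemma is_resolvent_sum:
  assumes "finite B" "\<And>y. y \<in> B \<Longrightarrow> is_resolvent l (f y) (g y)" "\<And>y. y \<in> B \<Longrightarrow> f y \<in> L2 m"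
  shows "is_resolvent l (\<lambda>x. \<Sum>y\<in>B. f y x) (\<lambda>x. \<Sum>y\<in>B. g y x) \<and> (\<lambda>x. \<Sum>y\<in>B. f y x) \<in> L2 m"
  using assms
proof (induction B)
  case (insert y B)
  then show ?case
    by (auto simp: is_resolvent_def L2_add finite_energy_add EE_add_left L2_inner_add_left algebra_simps)
qed (simp add: is_resolvent_def)

text \<open>Each \<open>u y\<close> lies below the resolvent \<open>G\<^sub>l \<delta>\<^sub>y\<close>. Summed over \<open>y\<close>, the left-hand sides already give
  \<open>1 / l\<close>, while the right-hand sides give at most \<open>1 / l\<close> by the Markov property of the energy form;
  so there is no room for a strict inequality.\<close>

lemma resolvent_of_subsolutions:
  assumes l: "0 < l" and u: "\<And>y. finite_energy (u y)" "\<And>y. u y \<in> L2 m"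
    and sub: "\<And>y v. finite_energy v \<Longrightarrow> v \<in> L2 m \<Longrightarrow> (\<And>x. 0 \<le> v x) \<Longrightarrow>
      EE (u y) v + l * ip (u y) v \<le> mm y * v y"
    and total: "\<And>x. ((\<lambda>y. l * u y x) has_sum 1) UNIV"
  shows "is_resolvent l (delta y) (u y)"
proof -
  obtain G where G: "\<And>y. is_resolvent l (delta y) (G y)"
    using resolvent_exists[OF l delta_L2] by metis
  have le: "u y x \<le> G y x" for x y
    by (rule subsolution_le_resolvent[OF l G u]) (simp add: ip_delta sub)
  have "u y x = G y x" for x
  proof (rule ccontr)
    assume "u y x \<noteq> G y x"
    then have pos: "0 < l * (G y x - u y x)" using le[of y x] l by simp
    \<comment> \<open>The tolerance is the supposed gap itself: a finite set containing
      \<open>y\<close> whose partial sum is this close to 1 would push the partial sum for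
      \<open>G\<close> above 1.\<close>
    have "\<forall>\<^sub>F B in finite_subsets_at_top UNIV. dist (\<Sum>y\<in>B. l * u y x) 1 < l * (G y x - u y x)"
      using total[of x] pos unfolding has_sum_def by (rule tendstoD)
    then obtain B0 where B0: "finite B0"
      "\<And>B. finite B \<Longrightarrow> B0 \<subseteq> B \<Longrightarrow> dist (\<Sum>y\<in>B. l * u y x) 1 < l * (G y x - u y x)"
      unfolding eventually_finite_subsets_at_top by auto
    define B where "B = insert y B0"
    have B: "finite B" "y \<in> B" "B0 \<subseteq> B" using B0 by (auto simp: B_def)
    have R: "is_resolvent l (\<lambda>x. \<Sum>y\<in>B. delta y x) (\<lambda>x. \<Sum>y\<in>B. G y x)" "(\<lambda>x. \<Sum>y\<in>B. delta y x) \<in> L2 m"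
      using is_resolvent_sum[OF B(1), of l delta G] G by auto
    have "(\<Sum>y\<in>B. delta y x') \<le> 1" for x' :: 'v
      using B(1) by (simp add: delta_def)
    then have "l * (\<Sum>y\<in>B. G y x) \<le> 1" by (rule resolvent_le_one[OF l R])
    moreover have "(\<Sum>y'\<in>B. l * (G y' x - u y' x)) \<ge> (\<Sum>y'\<in>{y}. l * (G y' x - u y' x))"
      using B l le by (intro sum_mono2) (auto simp: mult_nonneg_nonneg)
    moreover have "(\<Sum>y'\<in>B. l * (G y' x - u y' x)) = l * (\<Sum>y\<in>B. G y x) - (\<Sum>y\<in>B. l * u y x)"
      by (simp add: algebra_simps sum_subtractf sum_distrib_left)
    ultimately show False using B0(2)[OF B(1,3)] by (simp add: dist_real_def)
  qed
  then have "u y = G y" by auto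
  then show ?thesis using G by simp
qed

text \<open>The extensions of \<open>u\<close> from an exhausting sequence of finite sets agree with \<open>u\<close> there and dominate
  it elsewhere, so their energies are controlled by the generator inequality for \<open>u\<close>; they converge to
  \<open>u\<close> in energy because they are projections of \<open>u\<close>.\<close>

lemma subsolution_form_bound:
  assumes l: "0 < l" and nonneg: "\<And>x. 0 \<le> u x" and bounded: "\<And>x. u x \<le> B"
    and le_ext: "\<And>A x. finite A \<Longrightarrow> y \<in> A \<Longrightarrow> u x \<le> min_energy_ext E c A u x"
    and sub: "\<And>z. l * mm z * u z + (\<Sum>\<^sub>\<infinity>x. cond z x * (u z - u x)) \<le> mm z * delta y z"
  shows "finite_energy u" and "u \<in> L2 m"
    and "\<And>v. finite_energy v \<Longrightarrow> v \<in> L2 m \<Longrightarrow> (\<And>x. 0 \<le> v x) \<Longrightarrow> EE u v + l * ip u v \<le> mm y * v y"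
proof -
  \<comment> \<open>\<open>y\<close> belongs to every set of the exhaustion because
    \<open>le_ext\<close> speaks only of sets containing it.\<close>
  define A where "A n = insert y {x. to_nat_on (UNIV :: 'v set) x < n}" for n
  have finA: "finite (A n)" "y \<in> A n" for n
  proof -
    have "finite (to_nat_on (UNIV :: 'v set) -` {..<n})"
      by (rule finite_vimageI) (auto intro: inj_on_to_nat_on countable_V)
    then show "finite (A n)" by (simp add: A_def vimage_def)
  qed (simp add: A_def)
  have A_mono: "A n \<subseteq> A k" if "n \<le> k" for n k using that by (auto simp: A_def)
  have A_ev: "x \<in> A n" if "to_nat_on (UNIV :: 'v set) x < n" for x n using that by (simp add: A_def)
  have A_fin: "\<exists>n. F \<subseteq> A n" if "finite F" for F
    using that
  proof (induction F)
    case (insert x F)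
    then obtain n where "F \<subseteq> A n" by blast
    then have "insert x F \<subseteq> A (max n (Suc (to_nat_on (UNIV :: 'v set) x)))"
      using A_mono[of n "max n (Suc (to_nat_on (UNIV :: 'v set) x))"] A_ev[of x] by auto
    then show ?case by blast
  qed simp
  define h where "h n = min_energy_ext E c (A n) u" for n
  have A0: "A n \<noteq> {}" for n using finA by blast
  note h = min_energy_ext[OF finA(1) A0, where \<phi> = u, folded h_def]
  have h_ge: "u x \<le> h n x" for n x unfolding h_def by (rule le_ext[OF finA])
  \<comment> \<open>The extension \<open>h n\<close> is orthogonal to functions vanishing on
    \<open>A n\<close>, so \<open>v\<close> may be cut off outside \<open>A n\<close>. What remains
    is a finite combination of Laplacians of \<open>h n\<close> at points of
    \<open>A n\<close>.\<close>
  have Eh: "EE (h n) v + l * (\<Sum>a\<in>A n. mm a * u a * v a) \<le> mm y * v y"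
    if v: "finite_energy v" "\<And>x. 0 \<le> v x" for n v
  proof -
    let ?v = "\<lambda>x. if x \<in> A n then v x else 0"
    have fv: "finite_energy ?v" "EE (h n) ?v = (\<Sum>a\<in>A n. v a * EE (h n) (delta a))"
      using finite_support_expansion[OF finA(1), of n v] h(1)[of n] by auto
    have "EE (h n) (\<lambda>x. v x - ?v x) = 0"
      by (rule h(3)) (auto intro: finite_energy_diff v fv)
    then have "EE (h n) v = (\<Sum>a\<in>A n. v a * EE (h n) (delta a))"
      using EE_diff_right[OF v(1) fv(1) h(1)[of n]] fv(2) by simp
    also have "\<dots> \<le> (\<Sum>a\<in>A n. v a * (mm a * delta y a - l * mm a * u a))"
    proof (intro sum_mono mult_left_mono v(2))
      fix a assume a: "a \<in> A n"
      have "(\<lambda>x. cond a x * (u a - u x)) summable_on UNIV"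
      proof (rule summable_real_bound[OF summable_on_cmult_left[OF cond_summable]])
        fix x
        have "\<bar>u a - u x\<bar> \<le> B" using nonneg[of a] nonneg[of x] bounded[of a] bounded[of x] by linarith
        then show "\<bar>cond a x * (u a - u x)\<bar> \<le> cond a x * B"
          by (simp add: abs_mult mult_left_mono)
      qed
      \<comment> \<open>At \<open>a\<close> the extension equals \<open>u\<close>, elsewhere it is
        at least \<open>u\<close>, so passing from \<open>u\<close> to \<open>h n\<close> only
        decreases the differences in this sum.\<close>
      then have "EE (h n) (delta a) \<le> (\<Sum>\<^sub>\<infinity>x. cond a x * (u a - u x))"
        unfolding EE_delta[OF h(1)] using h(2)[OF a] h_ge
        by (intro infsum_mono[OF summable_cond_diff[OF h(1)]] mult_left_mono) auto
      then show "EE (h n) (delta a) \<le> mm a * delta y a - l * mm a * u a"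
        using sub[of a] by linarith
    qed
    also have "\<dots> = (\<Sum>a\<in>A n. v a * (mm a * delta y a)) - l * (\<Sum>a\<in>A n. mm a * u a * v a)"
      by (simp add: right_diff_distrib sum_subtractf sum_distrib_left mult_ac)
    also have "(\<Sum>a\<in>A n. v a * (mm a * delta y a)) = (\<Sum>a\<in>A n. if a = y then mm y * v y else 0)"
      by (rule sum.cong) (auto simp: delta_def)
    also have "\<dots> = mm y * v y" using finA by simp
    finally show ?thesis by simp
  qed
  \<comment> \<open>Taking \<open>h n\<close> itself as test function bounds energy and norm by
    \<open>mm y * u y\<close>, uniformly in \<open>n\<close>.\<close>
  have Ehh: "EE (h n) (h n) + l * (\<Sum>a\<in>A n. mm a * (u a)\<^sup>2) \<le> mm y * u y" for n
  proof -
    have "0 \<le> h n x" for x using nonneg[of x] h_ge[of x n] by linarith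
    then have "EE (h n) (h n) + l * (\<Sum>a\<in>A n. mm a * u a * h n a) \<le> mm y * h n y"
      by (rule Eh[OF h(1)])
    moreover have "(\<Sum>a\<in>A n. mm a * u a * h n a) = (\<Sum>a\<in>A n. mm a * (u a)\<^sup>2)"
      by (rule sum.cong) (auto simp: h(2) power2_eq_square)
    ultimately show ?thesis using h(2)[OF finA(2)] by simp
  qed
  have sumA: "0 \<le> (\<Sum>a\<in>A n. mm a * (u a)\<^sup>2)" for n by (intro sum_nonneg) auto
  have h_lim: "(\<lambda>n. h n x) \<longlonglongrightarrow> u x" for x
  proof (rule tendsto_eventually)
    show "\<forall>\<^sub>F n in sequentially. h n x = u x"
      using eventually_gt_at_top[of "to_nat_on (UNIV :: 'v set) x"]
      by eventually_elim (auto intro: h(2) A_ev)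
  qed
  have grad_lim: "(\<lambda>n. grad (h n) p) \<longlonglongrightarrow> grad u p" for p
    unfolding grad_def by (intro tendsto_intros h_lim)
  have gh: "grad (h n) \<in> L2 edge_measure" for n using h(1)[of n] by (simp add: finite_energy_def)
  have "EE (h n) (h n) \<le> mm y * u y" for n
    using Ehh[of n] mult_nonneg_nonneg[OF less_imp_le[OF l] sumA[of n]] by linarith
  then show fu: "finite_energy u"
    unfolding finite_energy_def EE_def
    using L2_Fatou[OF gh _ grad_lim] by blast
  show uL: "u \<in> L2 m"
    unfolding L2_m_iff
  proof (rule nonneg_bdd_above_summable_on)
    show "bdd_above (sum (\<lambda>x. mm x * (u x)\<^sup>2) ` {F. F \<subseteq> UNIV \<and> finite F})"
    proof (rule bdd_aboveI2)
      fix F :: "'v set" assume "F \<in> {F. F \<subseteq> UNIV \<and> finite F}"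
      then obtain n where n: "F \<subseteq> A n" using A_fin by blast
      have "sum (\<lambda>x. mm x * (u x)\<^sup>2) F \<le> (\<Sum>a\<in>A n. mm a * (u a)\<^sup>2)"
        by (rule sum_mono2[OF finA(1) n]) auto
      also have "\<dots> \<le> mm y * u y / l"
        using Ehh[of n] EE_nonneg[of "h n"] l by (simp add: pos_le_divide_eq mult.commute)
      finally show "sum (\<lambda>x. mm x * (u x)\<^sup>2) F \<le> mm y * u y / l" .
    qed
  qed simp
  \<comment> \<open>\<open>h n\<close> is the projection of every finite-energy function with the
    same values on \<open>A n\<close>, in particular of \<open>u\<close> and of later
    extensions.\<close>
  have cross: "EE (h n) v = EE (h n) (h n)" if "finite_energy v" "\<And>x. x \<in> A n \<Longrightarrow> v x = u x" for n v
  proof -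
    have "EE (h n) (\<lambda>x. v x - h n x) = 0"
      by (rule h(3)) (auto intro: finite_energy_diff that h simp: that h(2))
    then show ?thesis by (simp add: EE_diff_right that h)
  qed
  \<comment> \<open>Pythagoras: \<open>h n\<close> is the projection of \<open>h (Suc n)\<close>, so
    the energies increase.\<close>
  have "incseq (\<lambda>n. EE (h n) (h n))"
  proof (rule incseq_SucI)
    fix n
    have "EE (h n) (h (Suc n)) = EE (h n) (h n)"
      using A_mono[of n "Suc n"] by (intro cross h) auto
    then show "EE (h n) (h n) \<le> EE (h (Suc n)) (h (Suc n))"
      using EE_diff_self[OF h(1)[of "Suc n"] h(1)[of n]] EE_nonneg[of "\<lambda>x. h (Suc n) x - h n x"]
        EE_commute[of "h n" "h (Suc n)"] by simp
  qed
  moreover have diff: "EE (\<lambda>x. h n x - u x) (\<lambda>x. h n x - u x) = EE u u - EE (h n) (h n)" for n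
    using EE_diff_self[OF h(1)[of n] fu] cross[OF fu, of n] by simp
  then have le_u: "EE (h n) (h n) \<le> EE u u" for n
    using EE_nonneg[of "\<lambda>x. h n x - u x"] by (simp add: diff[of n])
  ultimately obtain L where L: "(\<lambda>n. EE (h n) (h n)) \<longlonglongrightarrow> L" "\<And>n. EE (h n) (h n) \<le> L"
    using incseq_convergent[of "\<lambda>n. EE (h n) (h n)" "EE u u"] by blast
  \<comment> \<open>Fatou gives this inequality and the projection property the opposite one. Hence
    the energies converge to that of \<open>u\<close>, and by Pythagoras the extensions converge to
    \<open>u\<close> in energy.\<close>
  have "EE u u \<le> L"
    using L2_Fatou[OF gh _ grad_lim, of L] L(2) by (simp add: EE_def)
  moreover have "L \<le> EE u u" by (rule LIMSEQ_le_const2[OF L(1)]) (use le_u in blast)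
  ultimately have "(\<lambda>n. EE (h n) (h n)) \<longlonglongrightarrow> EE u u" using L(1) by simp
  then have lim0: "(\<lambda>n. EE (\<lambda>x. h n x - u x) (\<lambda>x. h n x - u x)) \<longlonglongrightarrow> 0"
    unfolding diff using tendsto_diff[OF tendsto_const, of _ _ _ "EE u u"] by fastforce
  fix v assume v: "finite_energy v" "v \<in> L2 m" "\<And>x. 0 \<le> v x"
  have "ip u v \<le> (mm y * v y - EE u v) / l"
    unfolding ip_eq
  \<comment> \<open>The sequence controls only sums over \<open>A n\<close>. As all terms are
    nonnegative and every finite \<open>F\<close> is contained in \<open>A n\<close> for large
    \<open>n\<close>, it is enough to bound the partial sums.\<close>
  proof (rule infsum_le_finite_sums[OF ip_summable[OF uL v(2)]])
    fix F :: "'v set" assume F: "finite F" "F \<subseteq> UNIV"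
    then obtain k where k: "F \<subseteq> A k" using A_fin by blast
    have "(\<lambda>n. EE (h n) v + l * (\<Sum>a\<in>F. mm a * (u a * v a))) \<longlonglongrightarrow> EE u v + l * (\<Sum>a\<in>F. mm a * (u a * v a))"
      by (intro tendsto_intros EE_tendsto[OF h(1) fu v(1) lim0])
    then have "EE u v + l * (\<Sum>a\<in>F. mm a * (u a * v a)) \<le> mm y * v y"
    proof (rule LIMSEQ_le_const2, intro exI allI impI)
      fix n assume "k \<le> n"
      then have "F \<subseteq> A n" using k A_mono by blast
      then have "(\<Sum>a\<in>F. mm a * (u a * v a)) \<le> (\<Sum>a\<in>A n. mm a * (u a * v a))"
        by (intro sum_mono2 finA) (auto simp: nonneg v(3))
      then have "l * (\<Sum>a\<in>F. mm a * (u a * v a)) \<le> l * (\<Sum>a\<in>A n. mm a * u a * v a)"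
        using l by (simp add: mult.assoc)
      then show "EE (h n) v + l * (\<Sum>a\<in>F. mm a * (u a * v a)) \<le> mm y * v y"
        using Eh[OF v(1,3), of n] by linarith
    qed
    then show "(\<Sum>a\<in>F. mm a * (u a * v a)) \<le> (mm y * v y - EE u v) / l"
      using l by (simp add: pos_le_divide_eq algebra_simps)
  qed
  then show "EE u v + l * ip u v \<le> mm y * v y"
    using l by (simp add: pos_le_divide_eq algebra_simps)
qed

end

section \<open>Laplace transforms\<close>

definition laplace :: "real \<Rightarrow> (real \<Rightarrow> real) \<Rightarrow> real" where
  "laplace l g = (\<integral>t. indicator {0..} t * (exp (- l * t) * g t) \<partial>lborel)"

text \<open>The indicator restricts the condition to \<open>t >= 0\<close>, since the process
  carries no information at negative times.\<close>

definition bounded_measurable :: "(real \<Rightarrow> real) \<Rightarrow> real \<Rightarrow> bool" where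
  "bounded_measurable g B \<longleftrightarrow>
     (\<lambda>t. indicator {0..} t * g t) \<in> borel_measurable borel \<and> (\<forall>t\<ge>0. \<bar>g t\<bar> \<le> B)"

lemma nn_integral_exp:
  assumes l: "0 < l"
  shows "(\<integral>\<^sup>+t. ennreal (indicator {0..} t * exp (- l * t)) \<partial>lborel) = ennreal (1 / l)"
proof -
  have "(\<integral>\<^sup>+t. ennreal (indicator {0..} t * exp (- l * t)) \<partial>lborel)
      = (\<integral>\<^sup>+t. ennreal (1 / l) * ennreal (erlang_density 0 l t * t ^ 0) \<partial>lborel)"
    using l by (intro nn_integral_cong)
      (auto simp: erlang_density_def ennreal_mult[symmetric] split: split_indicator)
  also have "\<dots> = ennreal (1 / l) * (\<integral>\<^sup>+t. ennreal (erlang_density 0 l t * t ^ 0) \<partial>lborel)"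
    by (rule nn_integral_cmult) measurable
  also have "(\<integral>\<^sup>+t. ennreal (erlang_density 0 l t * t ^ 0) \<partial>lborel) = 1"
    by (subst nn_integral_erlang_ith_moment[OF l]) simp
  finally show ?thesis by simp
qed

lemma integrable_exp:
  assumes "0 < l"
  shows "integrable lborel (\<lambda>t. indicator {0..} t * exp (- l * t) :: real)"
  by (rule integrableI_bounded) (use nn_integral_exp[OF assms] in \<open>auto simp: abs_mult\<close>)

lemma laplace_const: "0 < l \<Longrightarrow> laplace l (\<lambda>t. 1) = 1 / l"
  using nn_integral_exp[of l] nn_integral_eq_integral[OF integrable_exp[of l]]
  by (simp add: laplace_def integral_nonneg_AE ennreal_inj)

lemma laplace_integrable:
  assumes l: "0 < l" and g: "bounded_measurable g B"
  shows "integrable lborel (\<lambda>t. indicator {0..} t * (exp (- l * t) * g t))"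
proof (rule Bochner_Integration.integrable_bound[OF integrable_mult_right[OF integrable_exp[OF l], of B]])
  have "(\<lambda>t. exp (- l * t) * (indicator {0..} t * g t)) \<in> borel_measurable lborel"
    using g by (auto simp: bounded_measurable_def)
  then show "(\<lambda>t. indicator {0..} t * (exp (- l * t) * g t)) \<in> borel_measurable lborel"
    by (simp add: mult_ac)
  show "AE t in lborel. norm (indicator {0..} t * (exp (- l * t) * g t)) \<le> norm (B * (indicator {0..} t * exp (- l * t)))"
  proof (rule AE_I2)
    fix t :: real
    show "norm (indicator {0..} t * (exp (- l * t) * g t)) \<le> norm (B * (indicator {0..} t * exp (- l * t)))"
      using g by (cases "0 \<le> t")
        (auto simp: bounded_measurable_def abs_mult intro: order_trans[OF _ abs_ge_self])
  qed
qed

lemma laplace_nonneg: "(\<And>t. 0 \<le> t \<Longrightarrow> 0 \<le> g t) \<Longrightarrow> 0 \<le> laplace l g"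
  unfolding laplace_def by (rule integral_nonneg_AE) (auto split: split_indicator)

lemma laplace_nn:
  assumes l: "0 < l" and g: "bounded_measurable g B" and nonneg: "\<And>t. 0 \<le> t \<Longrightarrow> 0 \<le> g t"
  shows "(\<integral>\<^sup>+t. indicator {0..} t * ennreal (exp (- l * t) * g t) \<partial>lborel) = ennreal (laplace l g)"
proof -
  have "(\<integral>\<^sup>+t. indicator {0..} t * ennreal (exp (- l * t) * g t) \<partial>lborel)
      = (\<integral>\<^sup>+t. ennreal (indicator {0..} t * (exp (- l * t) * g t)) \<partial>lborel)"
    by (rule nn_integral_cong) (auto split: split_indicator)
  also have "\<dots> = ennreal (laplace l g)"
    unfolding laplace_def
    by (rule nn_integral_eq_integral[OF laplace_integrable[OF l g]])
      (use nonneg in \<open>auto split: split_indicator\<close>)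
  finally show ?thesis .
qed

lemma laplace_mono:
  assumes l: "0 < l" and "bounded_measurable f B" "bounded_measurable g B'"
    and "\<And>t. 0 \<le> t \<Longrightarrow> f t \<le> g t"
  shows "laplace l f \<le> laplace l g"
  unfolding laplace_def
  by (rule integral_mono[OF laplace_integrable[OF l assms(2)] laplace_integrable[OF l assms(3)]])
    (use assms(4) in \<open>auto split: split_indicator\<close>)

lemma bounded_measurable_const: "bounded_measurable (\<lambda>t. a) \<bar>a\<bar>"
  by (simp add: bounded_measurable_def)

lemma laplace_le:
  assumes l: "0 < l" and "bounded_measurable f B" "\<And>t. 0 \<le> t \<Longrightarrow> f t \<le> 1"
  shows "laplace l f \<le> 1 / l"
  using laplace_mono[OF l assms(2) bounded_measurable_const[of 1] assms(3)] laplace_const[OF l] by simp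

lemma bounded_measurable_continuous:
  assumes "continuous_on {0..} g" "\<And>t. 0 \<le> t \<Longrightarrow> \<bar>g t\<bar> \<le> B"
  shows "bounded_measurable g B"
  using borel_measurable_continuous_on_indicator[of "{0..}" g] assms
  by (simp add: bounded_measurable_def)

text \<open>Lerch's theorem by way of Weierstrass. Under \<open>s = exp (- t)\<close> the transforms
  at the integers \<open>1 + i\<close> become moments, so \<open>g\<close> is orthogonal to all
  polynomials in \<open>exp (- t)\<close>; approximating \<open>G\<close> by such a polynomial makes
  the integral of \<open>exp (- 2 * t) * g^2\<close> arbitrarily small.\<close>

lemma laplace_unique_zero:
  assumes cont: "continuous_on {0..} g" and B: "\<And>t. 0 \<le> t \<Longrightarrow> \<bar>g t\<bar> \<le> B"
    and zero: "\<And>l. 0 < l \<Longrightarrow> laplace l g = 0" and t0: "0 \<le> t0"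
  shows "g t0 = 0"
proof -
  have bm: "bounded_measurable g B" by (rule bounded_measurable_continuous[OF cont B])
  have B0: "0 \<le> B" using B[of 0] by simp
  \<comment> \<open>The factor \<open>s\<close> forces \<open>G\<close> to tend to 0 at 0, because
    \<open>g\<close> is bounded; without it \<open>g (- ln s)\<close> need not extend continuously
    to \<open>[0, 1]\<close>.\<close>
  define G where "G s = (if s = 0 then 0 else s * g (- ln s))" for s :: real
  have G_exp: "G (exp (- t)) = exp (- t) * g t" for t by (simp add: G_def)
  have contG: "continuous_on {0..1} G"
    unfolding continuous_on_eq_continuous_within
  proof
    fix s :: real assume s: "s \<in> {0..1}"
    show "continuous (at s within {0..1}) G"
    proof (cases "s = 0")
      case False
      have "continuous_on {0<..1} (\<lambda>s. s * g (- ln s))"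
        by (intro continuous_intros continuous_on_compose2[OF cont]) auto
      then have "continuous_on {0<..1} G"
        by (rule continuous_on_eq) (auto simp: G_def)
      moreover have "s \<in> {0<..1}" using s False by simp
      ultimately have "continuous (at s within {0<..1}) G"
        by (simp add: continuous_on_eq_continuous_within)
      moreover have "at s within {0<..1} = at s within {0..1}"
        using s False by (intro at_within_nhd[of s "{0<..}"]) auto
      ultimately show ?thesis by simp
    next
      case True
      have "(G \<longlongrightarrow> 0) (at 0 within {0..1})"
      proof (rule Lim_null_comparison)
        have "\<bar>G x\<bar> \<le> B * x" if "x \<in> {0..1}" for x
          using that B[of "- ln x"] B0 by (auto simp: G_def abs_mult mult.commute intro!: mult_right_mono)
        then show "\<forall>\<^sub>F x in at 0 within {0..1}. norm (G x) \<le> B * x"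
          by (auto simp: eventually_at_filter)
        show "((\<lambda>x. B * x) \<longlongrightarrow> 0) (at 0 within {0..1})"
          by (rule tendsto_eq_intros refl)+ simp
      qed
      then show ?thesis using True by (simp add: continuous_within G_def)
    qed
  qed
  \<comment> \<open>The factor \<open>exp (- t)\<close> in front makes every exponent
    \<open>1 + i\<close> positive, also for the constant term of \<open>q\<close>.\<close>
  have poly0: "(\<integral>t. indicator {0..} t * (exp (- t) * q (exp (- t)) * g t) \<partial>lborel) = 0
      \<and> integrable lborel (\<lambda>t. indicator {0..} t * (exp (- t) * q (exp (- t)) * g t))"
    if "real_polynomial_function q" for q
  proof -
    obtain a n where q: "q = (\<lambda>x. \<Sum>i\<le>n. a i * x ^ i)"
      using \<open>real_polynomial_function q\<close> unfolding real_polynomial_function_iff_sum by blast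
    have eq: "indicator {0..} t * (exp (- t) * q (exp (- t)) * g t)
        = (\<Sum>i\<le>n. a i * (indicator {0..} t * (exp (- (1 + real i) * t) * g t)))" for t
    proof -
      have "exp (- t) * exp (- t) ^ i = exp (- (1 + real i) * t)" for i
        by (simp add: exp_of_nat_mult[symmetric] exp_add[symmetric] algebra_simps)
      then have trm: "a i * (indicator {0..} t * (exp (- (1 + real i) * t) * g t))
          = indicator {0..} t * (exp (- t) * (a i * exp (- t) ^ i) * g t)" for i
        by (metis (no_types, opaque_lifting) mult.assoc mult.left_commute)
      show ?thesis
        by (simp only: trm q sum_distrib_left sum_distrib_right)
    qed
    have int: "integrable lborel (\<lambda>t. a i * (indicator {0..} t * (exp (- (1 + real i) * t) * g t)))" for i
      by (intro integrable_mult_right laplace_integrable[OF _ bm]) simp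
    have Z: "(\<integral>t. a i * (indicator {0..} t * (exp (- (1 + real i) * t) * g t)) \<partial>lborel) = 0" for i
      using zero[of "1 + real i"] by (simp add: laplace_def)
    show ?thesis unfolding eq
      by (simp only: Bochner_Integration.integral_sum[OF int] Bochner_Integration.integrable_sum[OF int]
        Z sum.neutral_const simp_thms)
  qed
  let ?F = "\<lambda>t. indicator {0..} t * (exp (- 2 * t) * (g t)\<^sup>2)"
  have bm2: "bounded_measurable (\<lambda>t. (g t)\<^sup>2) (B\<^sup>2)"
    using cont B by (intro bounded_measurable_continuous continuous_intros)
      (auto simp: abs_le_square_iff[symmetric] B0)
  have intF: "integrable lborel ?F" using laplace_integrable[OF _ bm2, of 2] by simp
  \<comment> \<open>Since \<open>exp (- t) * g t = G (exp (- t))\<close>, the integrand is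
    \<open>exp (- t) * G (exp (- t)) * g t\<close>. Replacing \<open>G\<close> by
    \<open>G - q\<close> changes nothing, by \<open>poly0\<close>, and leaves an error of at most
    \<open>e * B\<close> times the mass of \<open>exp (- t)\<close>.\<close>
  have le: "integral\<^sup>L lborel ?F \<le> e * B" if "0 < e" for e
  proof -
    obtain q where q: "real_polynomial_function q" "\<And>x. x \<in> {0..1} \<Longrightarrow> \<bar>G x - q x\<bar> < e"
      using Stone_Weierstrass_real_polynomial_function[OF _ contG \<open>0 < e\<close>] by auto
    note p0 = poly0[OF q(1)]
    have "integral\<^sup>L lborel ?F = (\<integral>t. ?F t - indicator {0..} t * (exp (- t) * q (exp (- t)) * g t) \<partial>lborel)"
      using p0 intF by simp
    also have "\<dots> \<le> (\<integral>t. (e * B) * (indicator {0..} t * exp (- 1 * t)) \<partial>lborel)"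
    proof (rule integral_mono)
      show "integrable lborel (\<lambda>t. ?F t - indicator {0..} t * (exp (- t) * q (exp (- t)) * g t))"
        using p0 intF by simp
      show "integrable lborel (\<lambda>t. (e * B) * (indicator {0..} t * exp (- 1 * t)))"
        by (intro integrable_mult_right integrable_exp) simp
      fix t :: real
      show "?F t - indicator {0..} t * (exp (- t) * q (exp (- t)) * g t) \<le> (e * B) * (indicator {0..} t * exp (- 1 * t))"
      proof (cases "0 \<le> t")
        case True
        have "exp (- 2 * t) * (g t)\<^sup>2 - exp (- t) * q (exp (- t)) * g t
            = exp (- t) * ((G (exp (- t)) - q (exp (- t))) * g t)"
          by (simp add: G_exp power2_eq_square algebra_simps exp_add[symmetric])
        also have "\<dots> \<le> exp (- t) * (e * B)"
        proof (intro mult_left_mono)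
          have "(G (exp (- t)) - q (exp (- t))) * g t \<le> \<bar>G (exp (- t)) - q (exp (- t))\<bar> * \<bar>g t\<bar>"
            by (metis abs_ge_self abs_mult)
          also have "\<dots> \<le> e * B"
            using q(2)[of "exp (- t)"] B[OF True] True \<open>0 < e\<close> by (intro mult_mono) auto
          finally show "(G (exp (- t)) - q (exp (- t))) * g t \<le> e * B" .
        qed simp
        finally show ?thesis using True by (simp add: mult.commute)
      qed simp
    qed
    also have "\<dots> = e * B"
      using laplace_const[of 1] by (simp add: laplace_def)
    finally show ?thesis .
  qed
  have "integral\<^sup>L lborel ?F \<le> 0"
  proof (rule field_le_epsilon)
    fix e :: real assume "0 < e"
    have "integral\<^sup>L lborel ?F \<le> e / (B + 1) * B" using \<open>0 < e\<close> B0 by (intro le) auto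
    also have "\<dots> \<le> e" using \<open>0 < e\<close> B0 by (simp add: divide_simps)
    finally show "integral\<^sup>L lborel ?F \<le> 0 + e" by simp
  qed
  moreover have "0 \<le> integral\<^sup>L lborel ?F" by (rule integral_nonneg_AE) auto
  ultimately have "integral\<^sup>L lborel ?F = 0" by (rule antisym)
  then have "AE t in lborel. ?F t = 0"
    using integral_nonneg_eq_0_iff_AE[OF intF] by simp
  then have ae: "AE t in lborel. 0 \<le> t \<longrightarrow> g t = 0"
    by eventually_elim (auto split: split_indicator_asm)
  show ?thesis
  proof (rule ccontr)
    assume "g t0 \<noteq> 0"
    have "continuous (at t0 within {0..}) g"
      using cont t0 by (simp add: continuous_on_eq_continuous_within)
    then have "\<forall>\<^sub>F t in at t0 within {0..}. dist (g t) (g t0) < \<bar>g t0\<bar>"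
      using \<open>g t0 \<noteq> 0\<close> by (intro tendstoD) (auto simp: continuous_within)
    then obtain d where d: "d > 0" "\<And>t. 0 \<le> t \<Longrightarrow> t \<noteq> t0 \<Longrightarrow> dist t t0 < d \<Longrightarrow> dist (g t) (g t0) < \<bar>g t0\<bar>"
      unfolding eventually_at by auto
    \<comment> \<open>Only the interval to the right of \<open>t0\<close> is used, so that
      \<open>t0 = 0\<close> is covered too.\<close>
    have nz: "g t \<noteq> 0" if "t0 < t" "t < t0 + d" for t
      using d(2)[of t] that t0 by (auto simp: dist_real_def)
    from ae have "AE t in lborel. t \<notin> {t0<..<t0 + d}"
      by eventually_elim (use nz t0 in auto)
    then have "emeasure lborel {t0<..<t0 + d} = 0"
      by (subst (asm) AE_iff_measurable[of "{t0<..<t0 + d}"]) auto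
    then show False using d(1) by simp
  qed
qed

section \<open>Symmetric Markov kernels\<close>

lemma has_sum_diff:
  fixes f g :: "'a \<Rightarrow> real"
  shows "(f has_sum a) A \<Longrightarrow> (g has_sum b) A \<Longrightarrow> ((\<lambda>x. f x - g x) has_sum (a - b)) A"
  using has_sum_add[of f A a "\<lambda>x. -1 * g x" "-1 * b"] has_sum_cmult_right[of g A b "-1"] by simp

lemma nn_integral_count_space_swap:
  assumes "countable (UNIV :: 'a set)" and N: "sigma_finite_measure N"
    and f: "\<And>x. f x \<in> borel_measurable N"
  shows "(\<integral>\<^sup>+(x::'a). (\<integral>\<^sup>+t. f x t \<partial>N) \<partial>count_space UNIV) = (\<integral>\<^sup>+t. (\<integral>\<^sup>+x. f x t \<partial>count_space UNIV) \<partial>N)"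
    and "(\<lambda>t. \<integral>\<^sup>+(x::'a). f x t \<partial>count_space UNIV) \<in> borel_measurable N"
proof -
  interpret N: sigma_finite_measure N by (rule N)
  interpret C: sigma_finite_measure "count_space (UNIV :: 'a set)"
    by (rule sigma_finite_measure_count_space_countable[OF assms(1)])
  interpret pair_sigma_finite N "count_space (UNIV :: 'a set)" ..
  have "(\<lambda>p. f (fst p) (snd p)) \<in> borel_measurable (count_space UNIV \<Otimes>\<^sub>M N)"
    by (rule measurable_pair_measure_countable1[OF assms(1)]) (use f in simp)
  from measurable_compose[OF measurable_pair_swap' this]
  have m: "(\<lambda>(t, x). f x t) \<in> borel_measurable (N \<Otimes>\<^sub>M count_space UNIV)"
    by (simp add: case_prod_unfold)
  then show "(\<integral>\<^sup>+(x::'a). (\<integral>\<^sup>+t. f x t \<partial>N) \<partial>count_space UNIV) = (\<integral>\<^sup>+t. (\<integral>\<^sup>+x. f x t \<partial>count_space UNIV) \<partial>N)"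
    by (subst Fubini') auto
  from C.borel_measurable_nn_integral_fst[OF m]
  show "(\<lambda>t. \<integral>\<^sup>+(x::'a). f x t \<partial>count_space UNIV) \<in> borel_measurable N" by simp
qed

lemma has_sum_of_nn_integral:
  fixes g :: "'a \<Rightarrow> real"
  assumes "(\<integral>\<^sup>+x. ennreal (g x) \<partial>count_space UNIV) = ennreal r" "\<And>x. 0 \<le> g x" "0 \<le> r"
  shows "(g has_sum r) UNIV"
proof -
  have i: "integrable (count_space UNIV) g"
    by (rule integrableI_bounded) (use assms in auto)
  then have "ennreal (integral\<^sup>L (count_space UNIV) g) = ennreal r"
    using nn_integral_eq_integral[OF i] assms by simp
  then have "infsum g UNIV = r"
    using assms by (simp add: infsum_eq_integral_count_space integral_nonneg_AE)
  moreover have "g summable_on UNIV" using i by (simp add: summable_on_iff_integrable_count_space)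
  ultimately show ?thesis using has_sum_infsum by blast
qed

lemma nn_integral_of_has_sum:
  fixes g :: "'a \<Rightarrow> real"
  assumes "(g has_sum r) UNIV" "\<And>x. 0 \<le> g x"
  shows "(\<integral>\<^sup>+x. ennreal (g x) \<partial>count_space UNIV) = ennreal r"
proof -
  have "integrable (count_space UNIV) g"
    using assms(1) has_sum_imp_summable summable_on_iff_integrable_count_space by blast
  then have "(\<integral>\<^sup>+x. ennreal (g x) \<partial>count_space UNIV) = ennreal (infsum g UNIV)"
    using nn_integral_eq_integral[of "count_space UNIV" g] assms(2)
    by (simp add: infsum_eq_integral_count_space)
  then show ?thesis using infsumI[OF assms(1)] by simp
qed

lemma has_sum_sum:
  assumes "finite F" "\<And>x. x \<in> F \<Longrightarrow> (f x has_sum s x) A"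
  shows "((\<lambda>z. \<Sum>x\<in>F. f x z) has_sum (\<Sum>x\<in>F. s x :: real)) A"
  using assms by (induction F) (auto intro: has_sum_add has_sum_0)

context weighted_network
begin

definition sym_kernel :: "('v \<Rightarrow> 'v \<Rightarrow> real) \<Rightarrow> bool" where
  "sym_kernel q \<longleftrightarrow> (\<forall>x y. 0 \<le> q x y) \<and> (\<forall>x. (q x has_sum 1) UNIV) \<and> (\<forall>x y. mm x * q x y = mm y * q y x)"

text \<open>For a symmetric kernel this is \<open><f - q f, f>\<close>. Written with squares it is
  nonnegative and linear in the kernel, which is what Tonelli in \<open>jump_form_laplace\<close>
  requires.\<close>

definition jump_form :: "('v \<Rightarrow> 'v \<Rightarrow> real) \<Rightarrow> ('v \<Rightarrow> real) \<Rightarrow> real" where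
  "jump_form q f = 1 / 2 * (\<Sum>\<^sub>\<infinity>p. mm (fst p) * q (fst p) (snd p) * (f (fst p) - f (snd p))\<^sup>2)"

text \<open>The weights \<open>mm x * q x y\<close> have both marginals equal to \<open>mm\<close>:
  the rows by total mass one, the columns by symmetry. Hence the square can be expanded into
  summable pieces, the mixed term being dominated by the other two.\<close>

lemma sym_kernel_form:
  assumes q: "sym_kernel q" and f: "f \<in> L2 m"
  shows "(\<lambda>p. mm (fst p) * q (fst p) (snd p) * (f (fst p) * f (snd p))) summable_on UNIV"
    and "(\<lambda>p. mm (fst p) * q (fst p) (snd p) * (f (fst p) - f (snd p))\<^sup>2) summable_on UNIV"
    and "jump_form q f = ip f f - (\<Sum>\<^sub>\<infinity>p. mm (fst p) * q (fst p) (snd p) * (f (fst p) * f (snd p)))"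
    and "jump_form q f = ip (\<lambda>x. f x - (\<Sum>\<^sub>\<infinity>y. q x y * f y)) f"
    and "jump_form q f = ip f f - ip f (\<lambda>x. (\<Sum>\<^sub>\<infinity>y. q x y * f y))"
proof -
  have qn: "0 \<le> q x y" and q1: "(q x has_sum 1) UNIV" and qs: "mm x * q x y = mm y * q y x" for x y
    using q by (auto simp: sym_kernel_def)
  let ?k = "\<lambda>p. mm (fst p) * q (fst p) (snd p)"
  have k0: "0 \<le> ?k p" for p using qn by simp
  have f2: "((\<lambda>x. mm x * (f x)\<^sup>2) has_sum ip f f) UNIV"
    using ip_summable[OF f f] by (simp add: ip_eq power2_eq_square)
  have row: "((\<lambda>y. mm x * q x y * (f x)\<^sup>2) has_sum mm x * (f x)\<^sup>2) UNIV" for x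
    using has_sum_cmult_right[OF q1[of x], of "mm x * (f x)\<^sup>2"] by (simp add: mult_ac)
  have s1: "(\<lambda>p. ?k p * (f (fst p))\<^sup>2) summable_on UNIV \<times> UNIV"
    by (rule summable_on_SigmaI[where g = "\<lambda>x. mm x * (f x)\<^sup>2"])
      (use row f2 qn in \<open>auto intro: has_sum_imp_summable\<close>)
  have h1: "((\<lambda>p. ?k p * (f (fst p))\<^sup>2) has_sum ip f f) (UNIV \<times> UNIV)"
    by (rule has_sum_SigmaI[where g = "\<lambda>x. mm x * (f x)\<^sup>2"]) (use row f2 s1 in auto)
  then have h2: "((\<lambda>p. ?k p * (f (snd p))\<^sup>2) has_sum ip f f) (UNIV \<times> UNIV)"
    by (subst (asm) has_sum_swap) (simp add: case_prod_unfold qs mult_ac)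
  show s: "(\<lambda>p. ?k p * (f (fst p) * f (snd p))) summable_on UNIV"
  proof (rule summable_real_bound)
    show "(\<lambda>p. ?k p * (f (fst p))\<^sup>2 + ?k p * (f (snd p))\<^sup>2) summable_on UNIV"
      using summable_on_add[OF has_sum_imp_summable[OF h1] has_sum_imp_summable[OF h2]] by simp
    fix p
    have "\<bar>a * b\<bar> \<le> a\<^sup>2 + b\<^sup>2" for a b :: real
      using sum_squares_bound[of "\<bar>a\<bar>" "\<bar>b\<bar>"] mult_nonneg_nonneg[of "\<bar>a\<bar>" "\<bar>b\<bar>"]
      unfolding abs_mult by (simp del: mult_nonneg_nonneg)
    then have "?k p * \<bar>f (fst p) * f (snd p)\<bar> \<le> ?k p * ((f (fst p))\<^sup>2 + (f (snd p))\<^sup>2)"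
      by (intro mult_left_mono k0)
    then show "\<bar>?k p * (f (fst p) * f (snd p))\<bar> \<le> ?k p * (f (fst p))\<^sup>2 + ?k p * (f (snd p))\<^sup>2"
      using k0[of p] qn by (simp add: abs_mult distrib_left)
  qed
  let ?S = "\<Sum>\<^sub>\<infinity>p. ?k p * (f (fst p) * f (snd p))"
  have "((\<lambda>p. ?k p * (f (fst p))\<^sup>2 + ?k p * (f (snd p))\<^sup>2 + (- 2) * (?k p * (f (fst p) * f (snd p))))
      has_sum ip f f + ip f f + (- 2) * ?S) UNIV"
    by (intro has_sum_add has_sum_cmult_right has_sum_infsum s) (use h1 h2 in simp_all)
  moreover have "?k p * (f (fst p))\<^sup>2 + ?k p * (f (snd p))\<^sup>2 + (- 2) * (?k p * (f (fst p) * f (snd p)))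
      = ?k p * (f (fst p) - f (snd p))\<^sup>2" for p
    by (simp add: power2_eq_square algebra_simps)
  ultimately have h3: "((\<lambda>p. ?k p * (f (fst p) - f (snd p))\<^sup>2) has_sum 2 * ip f f - 2 * ?S) UNIV"
    by simp
  then show "(\<lambda>p. ?k p * (f (fst p) - f (snd p))\<^sup>2) summable_on UNIV" by (rule has_sum_imp_summable)
  show j: "jump_form q f = ip f f - ?S"
    unfolding jump_form_def infsumI[OF h3] by simp
  let ?T = "\<lambda>x. \<Sum>\<^sub>\<infinity>y. q x y * f y"
  have s': "(\<lambda>(x, y). mm x * q x y * (f x * f y)) summable_on UNIV \<times> UNIV"
    using s by (simp add: case_prod_unfold)
  have T: "(\<Sum>\<^sub>\<infinity>y. mm x * q x y * (f x * f y)) = mm x * (?T x * f x)" for x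
  proof -
    have "(\<Sum>\<^sub>\<infinity>y. mm x * q x y * (f x * f y)) = (\<Sum>\<^sub>\<infinity>y. (mm x * f x) * (q x y * f y))"
      by (simp add: mult_ac)
    also have "\<dots> = (mm x * f x) * ?T x" by (rule infsum_cmult_right')
    finally show ?thesis by (simp add: mult_ac)
  qed
  have "(\<lambda>x. \<Sum>\<^sub>\<infinity>y. mm x * q x y * (f x * f y)) summable_on UNIV"
    using summable_on_Sigma_banach[OF s'] by simp
  then have sT: "(\<lambda>x. mm x * (?T x * f x)) summable_on UNIV" by (simp only: T)
  have S: "?S = (\<Sum>\<^sub>\<infinity>x. mm x * (?T x * f x))"
    using infsum_Sigma'_banach[OF s'] by (simp add: T case_prod_unfold)
  then show "jump_form q f = ip f f - ip f ?T" using j by (simp add: ip_eq mult.commute)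
  have "ip (\<lambda>x. f x - ?T x) f = (\<Sum>\<^sub>\<infinity>x. mm x * (f x * f x) - mm x * (?T x * f x))"
    unfolding ip_eq by (simp add: algebra_simps)
  also have "\<dots> = (\<Sum>\<^sub>\<infinity>x. mm x * (f x * f x)) - (\<Sum>\<^sub>\<infinity>x. mm x * (?T x * f x))"
    by (rule infsumI[OF has_sum_diff]) (intro has_sum_infsum ip_summable[OF f f] sT)+
  finally show "jump_form q f = ip (\<lambda>x. f x - ?T x) f" using j S by (simp add: ip_eq)
qed

lemma jump_form_nonneg: "sym_kernel q \<Longrightarrow> 0 \<le> jump_form q f"
  unfolding jump_form_def sym_kernel_def by (intro mult_nonneg_nonneg infsum_nonneg) auto

end

section \<open>Transition functions whose resolvent is a subsolution\<close>

text \<open>A continuous midpoint-convex function lies below its chords. The hypothesis has the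
  shape that the semigroup law produces.\<close>

lemma midpoint_convex_chord:
  fixes \<phi> :: "real \<Rightarrow> real"
  assumes cont: "continuous_on {0..} \<phi>"
    and mid: "\<And>a b. 0 \<le> a \<Longrightarrow> 0 \<le> b \<Longrightarrow> 2 * \<phi> (a + b) \<le> \<phi> (2 * a) + \<phi> (2 * b)"
    and s: "0 \<le> s" "s \<le> t"
  shows "t * \<phi> s \<le> (t - s) * \<phi> 0 + s * \<phi> t"
proof (cases "t = 0")
  case False
  then have t: "0 < t" using s by simp
  define D where "D r = t * \<phi> r - ((t - r) * \<phi> 0 + r * \<phi> t)" for r
  have "continuous_on {0..t} \<phi>" by (rule continuous_on_subset[OF cont]) auto
  then have cD: "continuous_on {0..t} D" unfolding D_def by (intro continuous_intros)
  obtain r where r: "r \<in> {0..t}" "\<And>r'. r' \<in> {0..t} \<Longrightarrow> D r' \<le> D r"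
    using continuous_attains_sup[OF compact_Icc _ cD] t by auto
  have ends: "D 0 = 0" "D t = 0" by (simp_all add: D_def algebra_simps)
  \<comment> \<open>The distance from the maximum point \<open>r\<close> to the nearer end. One of
    \<open>r - h\<close>, \<open>r + h\<close> is then an end, where \<open>D\<close> is zero, and
    the other value is at most \<open>D r\<close>, so \<open>2 * D r <= D r\<close>.\<close>
  define h where "h = min r (t - r)"
  have h: "0 \<le> h" "r - h \<in> {0..t}" "r + h \<in> {0..t}" "r - h = 0 \<or> r + h = t"
    using r(1) by (auto simp: h_def min_def)
  have "2 * \<phi> r \<le> \<phi> (r - h) + \<phi> (r + h)"
  proof -
    have e: "(r - h) / 2 + (r + h) / 2 = r" "2 * ((r - h) / 2) = r - h" "2 * ((r + h) / 2) = r + h"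
      by (simp_all add: field_simps)
    show ?thesis using mid[of "(r - h) / 2" "(r + h) / 2"] h unfolding e by simp
  qed
  then have "t * (2 * \<phi> r) \<le> t * (\<phi> (r - h) + \<phi> (r + h))" using t by simp
  then have "2 * D r \<le> D (r - h) + D (r + h)" by (simp add: D_def algebra_simps)
  then have "D r \<le> 0" using h(4) r(2)[OF h(2)] r(2)[OF h(3)] ends by auto
  then have "D s \<le> 0" using r(2)[of s] s by simp
  then show ?thesis by (simp add: D_def)
qed (use s in simp)

locale markov_transition = network E c
  for E :: "'v set set" and c :: "'v set \<Rightarrow> real" +
  fixes p :: "real \<Rightarrow> 'v \<Rightarrow> 'v \<Rightarrow> real"
  assumes p_nonneg: "0 \<le> p t x y"
    and p_total: "0 \<le> t \<Longrightarrow> (p t x has_sum 1) UNIV"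
    and p_continuous: "continuous_on {0..} (\<lambda>t. p t x y)"
    and p_zero: "p 0 x y = delta x y"
    and chapman_kolmogorov: "0 \<le> s \<Longrightarrow> 0 \<le> t \<Longrightarrow> p (s + t) x y = (\<Sum>\<^sub>\<infinity>z. p s x z * p t z y)"
begin

definition R :: "real \<Rightarrow> 'v \<Rightarrow> 'v \<Rightarrow> real" where
  "R l x y = laplace l (\<lambda>t. p t x y)"

lemma p_le_1: "0 \<le> t \<Longrightarrow> p t x y \<le> 1"
  using infsum_ge_single[OF has_sum_imp_summable[OF p_total[of t x]], of y] p_nonneg
    infsumI[OF p_total[of t x]] by simp

lemma p_bm: "bounded_measurable (\<lambda>t. p t x y) 1"
  by (rule bounded_measurable_continuous[OF p_continuous]) (simp add: p_nonneg p_le_1)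

lemma p_measurable:
  "(\<lambda>t. indicator {0..} t * ennreal (a * (exp (- l * t) * p t x y))) \<in> borel_measurable lborel"
proof -
  have 1: "(\<lambda>t. indicator {0..} t * p t x y) \<in> borel_measurable lborel"
    using p_bm[of x y] by (simp add: bounded_measurable_def)
  have 2: "(\<lambda>t. a * exp (- l * t)) \<in> borel_measurable lborel" by measurable
  have "(\<lambda>t. ennreal ((a * exp (- l * t)) * (indicator {0..} t * p t x y))) \<in> borel_measurable lborel"
    by (rule measurable_compose[OF borel_measurable_times[OF 2 1] measurable_ennreal])
  also have "(\<lambda>t. ennreal ((a * exp (- l * t)) * (indicator {0..} t * p t x y)))
      = (\<lambda>t. indicator {0..} t * ennreal (a * (exp (- l * t) * p t x y)))"
    by (auto simp: fun_eq_iff mult.assoc split: split_indicator)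
  finally show ?thesis .
qed

lemma R_nonneg: "0 \<le> R l x y"
  unfolding R_def by (rule laplace_nonneg) (rule p_nonneg)

lemma R_total:
  assumes l: "0 < l"
  shows "((\<lambda>y. l * R l x y) has_sum 1) UNIV"
proof -
  have "(\<integral>\<^sup>+y. ennreal (R l x y) \<partial>count_space UNIV)
      = (\<integral>\<^sup>+y. (\<integral>\<^sup>+t. indicator {0..} t * ennreal (exp (- l * t) * p t x y) \<partial>lborel) \<partial>count_space UNIV)"
    unfolding R_def by (subst laplace_nn[OF l p_bm]) (auto simp: p_nonneg)
  also have "\<dots> = (\<integral>\<^sup>+t. (\<integral>\<^sup>+y. indicator {0..} t * ennreal (exp (- l * t) * p t x y) \<partial>count_space UNIV) \<partial>lborel)"
    using p_measurable[of 1] by (intro nn_integral_count_space_swap(1)[OF countable_V lborel.sigma_finite_measure_axioms]) simp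
  also have "\<dots> = (\<integral>\<^sup>+t. ennreal (indicator {0..} t * exp (- l * t)) \<partial>lborel)"
  proof (rule nn_integral_cong)
    fix t :: real
    show "(\<integral>\<^sup>+y. indicator {0..} t * ennreal (exp (- l * t) * p t x y) \<partial>count_space UNIV)
        = ennreal (indicator {0..} t * exp (- l * t))"
    proof (cases "0 \<le> t")
      case True
      have "((\<lambda>y. exp (- l * t) * p t x y) has_sum exp (- l * t) * 1) UNIV"
        by (rule has_sum_cmult_right[OF p_total[OF True]])
      from nn_integral_of_has_sum[OF this] show ?thesis using True by (simp add: p_nonneg)
    qed simp
  qed
  also have "\<dots> = ennreal (1 / l)" by (rule nn_integral_exp[OF l])
  finally have "((\<lambda>y. R l x y) has_sum 1 / l) UNIV"
    using l by (intro has_sum_of_nn_integral) (auto simp: R_nonneg)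
  from has_sum_cmult_right[OF this, of l] show ?thesis using l by simp
qed

lemma R_le: "0 < l \<Longrightarrow> R l x y \<le> 1 / l"
  unfolding R_def by (rule laplace_le[OF _ p_bm]) (auto intro: p_le_1)

end

text \<open>The interface between process and form: besides its transition function, the walk enters
  the analysis only through these two inequalities for the resolvent.\<close>

locale reflected_transition = weighted_network E c mm + markov_transition E c p
  for E :: "'v set set" and c :: "'v set \<Rightarrow> real" and mm :: "'v \<Rightarrow> real"
    and p :: "real \<Rightarrow> 'v \<Rightarrow> 'v \<Rightarrow> real" +
  assumes resolvent_le_ext: "0 < l \<Longrightarrow> finite A \<Longrightarrow> y \<in> A \<Longrightarrow>
      R l x y \<le> min_energy_ext E c A (\<lambda>z. R l z y) x"
    and resolvent_subsolution: "0 < l \<Longrightarrow>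
      l * mm z * R l z y + (\<Sum>\<^sub>\<infinity>x. cond z x * (R l z y - R l x y)) \<le> mm z * delta y z"
begin

lemma is_resolvent_R:
  assumes l: "0 < l"
  shows "is_resolvent l (delta y) (\<lambda>x. R l x y)"
proof -
  note * = subsolution_form_bound[of l "\<lambda>x. R l x y" "1 / l" y for y,
      OF l R_nonneg R_le[OF l] resolvent_le_ext[OF l] resolvent_subsolution[OF l]]
  show ?thesis
    by (rule resolvent_of_subsolutions[OF l, where u = "\<lambda>y x. R l x y"]) (auto intro: * R_total l)
qed

text \<open>Each of the two resolvent equations is tested with the other solution; the left-hand
  sides agree because \<open>EE\<close> and \<open>ip\<close> are symmetric.\<close>

lemma R_sym:
  assumes l: "0 < l"
  shows "mm x * R l x y = mm y * R l y x"
  using is_resolventD(3)[OF is_resolvent_R[OF l, of y] is_resolventD(1,2)[OF is_resolvent_R[OF l, of x]]]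
    is_resolventD(3)[OF is_resolvent_R[OF l, of x] is_resolventD(1,2)[OF is_resolvent_R[OF l, of y]]]
    EE_commute[of "\<lambda>x'. R l x' y" "\<lambda>x'. R l x' x"] L2_inner_commute[of m "\<lambda>x'. R l x' y" "\<lambda>x'. R l x' x"]
  by (simp add: ip_delta)

lemma p_sym:
  assumes t: "0 \<le> t"
  shows "mm x * p t x y = mm y * p t y x"
proof -
  let ?g = "\<lambda>t. mm x * p t x y - mm y * p t y x"
  have "?g t = 0"
  proof (rule laplace_unique_zero[OF _ _ _ t])
    show "continuous_on {0..} ?g" by (intro continuous_intros p_continuous)
    show "\<bar>?g t\<bar> \<le> mm x + mm y" if "0 \<le> t" for t
    proof -
      have "mm x * p t x y \<le> mm x * 1" "mm y * p t y x \<le> mm y * 1"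
        "0 \<le> mm x * p t x y" "0 \<le> mm y * p t y x"
        using mult_left_mono[OF p_le_1[OF that, of x y] mm_nonneg[of x]]
          mult_left_mono[OF p_le_1[OF that, of y x] mm_nonneg[of y]] p_nonneg by auto
      then show ?thesis by linarith
    qed
    fix l :: real assume l: "0 < l"
    have "laplace l ?g = (\<integral>t. mm x * (indicator {0..} t * (exp (- l * t) * p t x y))
        - mm y * (indicator {0..} t * (exp (- l * t) * p t y x)) \<partial>lborel)"
      unfolding laplace_def by (rule Bochner_Integration.integral_cong) (auto simp: algebra_simps)
    also have "\<dots> = mm x * R l x y - mm y * R l y x"
      unfolding R_def laplace_def using laplace_integrable[OF l p_bm] by simp
    finally show "laplace l ?g = 0" using R_sym[OF l] by simp
  qed
  then show ?thesis by simp
qed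

lemma sym_kernel_p: "0 \<le> t \<Longrightarrow> sym_kernel (p t)"
  using p_nonneg p_total p_sym by (simp add: sym_kernel_def)

lemma sym_kernel_R: "0 < l \<Longrightarrow> sym_kernel (\<lambda>x y. l * R l x y)"
  using R_nonneg R_total R_sym by (simp add: sym_kernel_def mult.left_commute)

text \<open>Testing the equation for \<open>f\<close> with the column of \<open>x\<close>, and
  conversely, expresses \<open>mm x * g x\<close> as \<open><f, R_l(., x)>\<close>; symmetry turns
  the column into a row.\<close>

lemma resolvent_kernel:
  assumes l: "0 < l" and f: "f \<in> L2 m" and g: "is_resolvent l f g"
  shows "(\<Sum>\<^sub>\<infinity>y. l * R l x y * f y) = l * g x"
proof -
  note r = is_resolvent_R[OF l, of x]
  have "mm x * g x = ip f (\<lambda>y. R l y x)"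
    using is_resolventD(3)[OF g is_resolventD(1,2)[OF r]] is_resolventD(3)[OF r is_resolventD(1,2)[OF g]]
      EE_commute[of g] L2_inner_commute[of m g] by (simp add: ip_delta)
  also have "\<dots> = (\<Sum>\<^sub>\<infinity>y. mm x * (R l x y * f y))"
    unfolding ip_eq
  proof (rule infsum_cong)
    fix y
    have "mm y * (f y * R l y x) = f y * (mm y * R l y x)" by simp
    also have "\<dots> = mm x * (R l x y * f y)" unfolding R_sym[OF l, of y x] by simp
    finally show "mm y * (f y * R l y x) = mm x * (R l x y * f y)" .
  qed
  also have "\<dots> = mm x * (\<Sum>\<^sub>\<infinity>y. R l x y * f y)" by (rule infsum_cmult_right')
  finally have "g x = (\<Sum>\<^sub>\<infinity>y. R l x y * f y)" using mm_pos[of x] by simp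
  then show ?thesis using infsum_cmult_right'[of l "\<lambda>y. R l x y * f y" UNIV] by (simp add: mult.assoc)
qed

text \<open>The energy approximated from the resolvent is the minimum of \<open>\<E>(v, v) + l \<parallel>v - f\<parallel>\<^sup>2\<close>, attained at
  \<open>v = l G\<^sub>l f\<close>.\<close>

lemma resolvent_energy:
  assumes l: "0 < l" and f: "f \<in> L2 m" and g: "is_resolvent l f g"
  defines "u \<equiv> \<lambda>x. l * g x"
  shows "finite_energy u" "u \<in> L2 m"
    and "EE u u + l * ip (\<lambda>x. u x - f x) (\<lambda>x. u x - f x) = l * jump_form (\<lambda>x y. l * R l x y) f"
    and "finite_energy f \<Longrightarrow> l * jump_form (\<lambda>x y. l * R l x y) f \<le> EE f f"
proof -
  show u: "finite_energy u" "u \<in> L2 m"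
    unfolding u_def using is_resolventD[OF g] by (auto intro: finite_energy_scale L2_scale)
  have eq: "EE u v + l * ip u v = l * ip f v" if "finite_energy v" "v \<in> L2 m" for v
    using is_resolventD(3)[OF g that] unfolding u_def
    by (simp add: EE_scale_left L2_inner_scale_left algebra_simps)
      (metis distrib_left)
  have J: "jump_form (\<lambda>x y. l * R l x y) f = ip f f - ip f u"
    using sym_kernel_form(5)[OF sym_kernel_R[OF l] f] unfolding u_def resolvent_kernel[OF l f g] .
  have N: "ip (\<lambda>x. u x - f x) (\<lambda>x. u x - f x) = ip u u - 2 * ip f u + ip f f"
    using L2_inner_diff_left[OF u(2) f L2_diff[OF u(2) f]] L2_inner_diff_right[OF u(2) f u(2)]
      L2_inner_diff_right[OF u(2) f f] L2_inner_commute[of m u f] by simp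
  show E: "EE u u + l * ip (\<lambda>x. u x - f x) (\<lambda>x. u x - f x) = l * jump_form (\<lambda>x y. l * R l x y) f"
    using eq[OF u] unfolding J N by (simp add: algebra_simps)
  assume ff: "finite_energy f"
  let ?I = "l * jump_form (\<lambda>x y. l * R l x y) f"
  have I0: "0 \<le> ?I" using jump_form_nonneg[OF sym_kernel_R[OF l], of f] l by simp
  \<comment> \<open>As \<open>f\<close> has finite energy, it may serve as test function. With
    \<open>EE u f\<close> equal to the bounded quantity \<open>?I\<close> and
    \<open>EE u u <= ?I\<close>, Cauchy-Schwarz gives \<open>?I^2 <= ?I * EE f f\<close>.\<close>
  have uf: "EE u f = ?I"
    using eq[OF ff f] L2_inner_commute[of m u f] unfolding J by (simp add: algebra_simps)
  have "0 \<le> l * ip (\<lambda>x. u x - f x) (\<lambda>x. u x - f x)" using l by (simp add: L2_inner_self_nonneg)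
  then have "EE u u \<le> ?I" using E by linarith
  have "?I * ?I \<le> EE u u * EE f f"
    using L2_Cauchy_Schwarz[of "grad u" edge_measure "grad f"] u ff
    unfolding finite_energy_def EE_def[symmetric] uf power2_eq_square by simp
  also have "\<dots> \<le> ?I * EE f f" by (rule mult_right_mono[OF \<open>EE u u \<le> ?I\<close> EE_nonneg])
  finally have le: "?I * ?I \<le> ?I * EE f f" .
  show "?I \<le> EE f f"
  proof (rule ccontr)
    assume "\<not> ?I \<le> EE f f"
    then have "?I * EE f f < ?I * ?I" using EE_nonneg[of f] by (intro mult_strict_left_mono) linarith+
    then show False using le by simp
  qed
qed

text \<open>The kernel \<open>l * R l\<close> is the average of \<open>p t\<close> over an
  exponential time of rate \<open>l\<close>, and \<open>jump_form\<close> is linear in the kernel.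
  All terms are nonnegative, so Tonelli applies even if the integral should be infinite.\<close>

lemma jump_form_laplace:
  assumes l: "0 < l" and f: "f \<in> L2 m"
  shows "(\<integral>\<^sup>+t. indicator {0..} t * ennreal (l * exp (- l * t) * jump_form (p t) f) \<partial>lborel)
    = ennreal (jump_form (\<lambda>x y. l * R l x y) f)"
proof -
  let ?w = "\<lambda>z. 1 / 2 * (mm (fst z) * (f (fst z) - f (snd z))\<^sup>2)"
  let ?F = "\<lambda>z t. indicator {0..} t * ennreal (l * ?w z * (exp (- l * t) * p t (fst z) (snd z)))"
  have w0: "0 \<le> ?w z" for z by simp
  have cV: "countable (UNIV :: ('v \<times> 'v) set)"
    using countable_SIGMA[OF countable_V countable_V] by simp
  have jf: "(\<integral>\<^sup>+z. ennreal (a * ?w z * q (fst z) (snd z)) \<partial>count_space UNIV) = ennreal (a * jump_form q f)"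
    if q: "sym_kernel q" and a: "0 \<le> a" for q a
  proof (rule nn_integral_of_has_sum)
    have "((\<lambda>z. a * (1 / 2 * (mm (fst z) * q (fst z) (snd z) * (f (fst z) - f (snd z))\<^sup>2)))
        has_sum a * jump_form q f) UNIV"
      unfolding jump_form_def
      by (intro has_sum_cmult_right has_sum_infsum sym_kernel_form(2)[OF q f])
    then show "((\<lambda>z. a * ?w z * q (fst z) (snd z)) has_sum a * jump_form q f) UNIV"
      by (simp add: mult_ac)
    show "0 \<le> a * ?w z * q (fst z) (snd z)" for z
      using q a w0[of z] unfolding sym_kernel_def by (intro mult_nonneg_nonneg) auto
  qed
  have Fm: "?F z \<in> borel_measurable lborel" for z by (rule p_measurable)
  have "(\<integral>\<^sup>+t. indicator {0..} t * ennreal (l * exp (- l * t) * jump_form (p t) f) \<partial>lborel)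
      = (\<integral>\<^sup>+t. (\<integral>\<^sup>+z. ?F z t \<partial>count_space UNIV) \<partial>lborel)"
  proof (rule nn_integral_cong)
    fix t :: real
    show "indicator {0..} t * ennreal (l * exp (- l * t) * jump_form (p t) f) = (\<integral>\<^sup>+z. ?F z t \<partial>count_space UNIV)"
    proof (cases "0 \<le> t")
      case True
      have eqz: "l * exp (- l * t) * ?w z * p t (fst z) (snd z) = l * ?w z * (exp (- l * t) * p t (fst z) (snd z))" for z
        by (simp only: mult_ac)
      have lt: "0 \<le> l * exp (- l * t)" using l by simp
      have "(\<integral>\<^sup>+z. ?F z t \<partial>count_space UNIV)
          = (\<integral>\<^sup>+z. ennreal (l * exp (- l * t) * ?w z * p t (fst z) (snd z)) \<partial>count_space UNIV)"
        unfolding eqz using True by (intro nn_integral_cong) simp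
      then show ?thesis unfolding jf[OF sym_kernel_p[OF True] lt] using True by simp
    qed simp
  qed
  also have "\<dots> = (\<integral>\<^sup>+z. (\<integral>\<^sup>+t. ?F z t \<partial>lborel) \<partial>count_space UNIV)"
    by (rule nn_integral_count_space_swap(1)[OF cV lborel.sigma_finite_measure_axioms Fm, symmetric])
  also have "\<dots> = (\<integral>\<^sup>+z. ennreal (1 * ?w z * (l * R l (fst z) (snd z))) \<partial>count_space UNIV)"
  proof (rule nn_integral_cong)
    fix z :: "'v \<times> 'v"
    have lw: "0 \<le> l * ?w z" using l w0[of z] by simp
    have "(\<integral>\<^sup>+t. ?F z t \<partial>lborel)
        = (\<integral>\<^sup>+t. ennreal (l * ?w z) * (indicator {0..} t * ennreal (exp (- l * t) * p t (fst z) (snd z))) \<partial>lborel)"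
      by (rule nn_integral_cong, subst ennreal_mult'[OF lw], rule mult.left_commute)
    also have "\<dots> = ennreal (l * ?w z) * (\<integral>\<^sup>+t. indicator {0..} t * ennreal (exp (- l * t) * p t (fst z) (snd z)) \<partial>lborel)"
      using p_measurable[of 1] by (intro nn_integral_cmult) simp
    also have "\<dots> = ennreal (l * ?w z) * ennreal (R l (fst z) (snd z))"
      unfolding R_def by (subst laplace_nn[OF l p_bm]) (auto simp: p_nonneg)
    also have "\<dots> = ennreal (1 * ?w z * (l * R l (fst z) (snd z)))"
      by (subst ennreal_mult'[OF lw, symmetric]) (simp only: mult_1 mult_ac)
    finally show "(\<integral>\<^sup>+t. ?F z t \<partial>lborel) = ennreal (1 * ?w z * (l * R l (fst z) (snd z)))" .
  qed
  also have "\<dots> = ennreal (jump_form (\<lambda>x y. l * R l x y) f)"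
    using jf[OF sym_kernel_R[OF l], of 1] by simp
  finally show ?thesis .
qed

lemma jump_form_finite_convex:
  fixes S :: "'v set" and f :: "'v \<Rightarrow> real" and s t :: real
  assumes S: "finite S"
  defines "\<phi> \<equiv> \<lambda>t. \<Sum>x\<in>S. \<Sum>y\<in>S. mm x * p t x y * (f x * f y)"
  assumes st: "0 \<le> s" "s \<le> t"
  shows "t * \<phi> s \<le> (t - s) * \<phi> 0 + s * \<phi> t"
proof (rule midpoint_convex_chord[OF _ _ st])
  show "continuous_on {0..} \<phi>" unfolding \<phi>_def by (intro continuous_intros p_continuous)
  \<comment> \<open>The semigroup at time \<open>t\<close> applied to \<open>f\<close> cut off
    outside \<open>S\<close>; finiteness of \<open>S\<close> lets the sums be interchanged
    freely.\<close>
  define F where "F t z = (\<Sum>y\<in>S. p t z y * f y)" for t z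
  have sm: "(\<lambda>z. mm z * (p a z x * p b z y)) summable_on UNIV"
    and eq: "(\<Sum>\<^sub>\<infinity>z. mm z * (p a z x * p b z y)) = mm x * p (a + b) x y"
    if ab: "0 \<le> a" "0 \<le> b" for a b x y
  proof -
    have k: "mm z * (p a z x * p b z y) = mm x * (p a x z * p b z y)" for z
    proof -
      have "mm z * (p a z x * p b z y) = (mm z * p a z x) * p b z y" by simp
      also have "\<dots> = mm x * (p a x z * p b z y)" unfolding p_sym[OF ab(1), of z x] by simp
      finally show ?thesis .
    qed
    show "(\<lambda>z. mm z * (p a z x * p b z y)) summable_on UNIV"
      unfolding k
    proof (rule summable_on_cmult_right, rule summable_real_bound[OF has_sum_imp_summable[OF p_total[OF ab(1)]]])
      show "\<bar>p a x z * p b z y\<bar> \<le> p a x z" for z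
        using p_nonneg p_le_1[OF ab(2)] by (simp add: abs_mult mult_left_le)
    qed
    show "(\<Sum>\<^sub>\<infinity>z. mm z * (p a z x * p b z y)) = mm x * p (a + b) x y"
      unfolding k by (subst infsum_cmult_right') (simp add: chapman_kolmogorov[OF ab])
  qed
  \<comment> \<open>By symmetry and the semigroup law, \<open><F a, F b>\<close> depends on
    \<open>a + b\<close> only.\<close>
  have hs: "((\<lambda>z. mm z * (F a z * F b z)) has_sum \<phi> (a + b)) UNIV" if ab: "0 \<le> a" "0 \<le> b" for a b
  proof -
    have "((\<lambda>z. \<Sum>x\<in>S. \<Sum>y\<in>S. (f x * f y) * (mm z * (p a z x * p b z y)))
        has_sum (\<Sum>x\<in>S. \<Sum>y\<in>S. (f x * f y) * (mm x * p (a + b) x y))) UNIV"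
    proof (intro has_sum_sum S has_sum_cmult_right)
      fix x y
      show "((\<lambda>z. mm z * (p a z x * p b z y)) has_sum mm x * p (a + b) x y) UNIV"
        using has_sum_infsum[OF sm[OF ab, of x y]] unfolding eq[OF ab] .
    qed
    moreover have "(\<Sum>x\<in>S. \<Sum>y\<in>S. (f x * f y) * (mm z * (p a z x * p b z y))) = mm z * (F a z * F b z)" for z
      unfolding F_def by (subst sum_product) (simp only: sum_distrib_left mult_ac)
    moreover have "(\<Sum>x\<in>S. \<Sum>y\<in>S. (f x * f y) * (mm x * p (a + b) x y)) = \<phi> (a + b)"
      unfolding \<phi>_def by (simp add: mult_ac)
    ultimately show ?thesis by simp
  qed
  fix a b :: real assume ab: "0 \<le> a" "0 \<le> b"
  have "((\<lambda>z. mm z * (F a z * F a z) + mm z * (F b z * F b z) + (- 2) * (mm z * (F a z * F b z)))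
      has_sum \<phi> (a + a) + \<phi> (b + b) + (- 2) * \<phi> (a + b)) UNIV"
    by (intro has_sum_add has_sum_cmult_right hs ab)
  moreover have "0 \<le> mm z * (F a z * F a z) + mm z * (F b z * F b z) + (- 2) * (mm z * (F a z * F b z))" for z
  proof -
    have "0 \<le> mm z * (F a z - F b z)\<^sup>2" by simp
    also have "mm z * (F a z - F b z)\<^sup>2 = mm z * (F a z * F a z) + mm z * (F b z * F b z) + (- 2) * (mm z * (F a z * F b z))"
      by (simp add: power2_eq_square algebra_simps)
    finally show ?thesis .
  qed
  ultimately have "0 \<le> \<phi> (a + a) + \<phi> (b + b) + (- 2) * \<phi> (a + b)"
    by (rule has_sum_nonneg)
  then show "2 * \<phi> (a + b) \<le> \<phi> (2 * a) + \<phi> (2 * b)" unfolding mult_2 by linarith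
qed

text \<open>\<open>t \<mapsto> \<langle>T\<^sub>t f, f\<rangle>\<close> is convex since \<open>\<langle>T\<^bsub>2s\<^esub> f, f\<rangle> + \<langle>T\<^bsub>2t\<^esub> f, f\<rangle> - 2 \<langle>T\<^bsub>s+t\<^esub> f, f\<rangle> = \<parallel>T\<^sub>s f - T\<^sub>t f\<parallel>\<^sup>2\<close>; this
  is used for finitely supported \<open>f\<close> only, and passed to the limit in \<open>f\<close>.\<close>

lemma jump_form_antimono:
  assumes f: "f \<in> L2 m" and st: "0 \<le> s" "s \<le> t"
  shows "s * jump_form (p t) f \<le> t * jump_form (p s) f"
proof -
  have t0: "0 \<le> t" using st by simp
  define h where "h r z = mm (fst z) * p r (fst z) (snd z) * (f (fst z) * f (snd z))" for r z
  define k where "k z = (t - s) * h 0 z + s * h t z - t * h s z" for z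
  have hs: "(h r has_sum ip f f - jump_form (p r) f) UNIV" if "0 \<le> r" for r
    using has_sum_infsum[OF sym_kernel_form(1)[OF sym_kernel_p[OF that] f]]
      sym_kernel_form(3)[OF sym_kernel_p[OF that] f] unfolding h_def by simp
  have jf0: "jump_form (p 0) f = 0"
    unfolding jump_form_def p_zero by (simp, rule infsum_0) (auto simp: delta_def)
  have "(k has_sum (t - s) * (ip f f - jump_form (p 0) f) + s * (ip f f - jump_form (p t) f)
      - t * (ip f f - jump_form (p s) f)) UNIV"
    unfolding k_def by (intro has_sum_add has_sum_diff has_sum_cmult_right hs st t0) simp
  then have k: "(k has_sum t * jump_form (p s) f - s * jump_form (p t) f) UNIV"
    by (simp add: jf0 algebra_simps)
  have kS: "0 \<le> sum k (S \<times> S)" if "finite S" for S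
  proof -
    have e: "sum (h r) (S \<times> S) = (\<Sum>x\<in>S. \<Sum>y\<in>S. mm x * p r x y * (f x * f y))" for r
      unfolding h_def by (subst sum.cartesian_product) (simp add: case_prod_unfold)
    show ?thesis
      using jump_form_finite_convex[OF that st, of f] unfolding e[symmetric] k_def
      by (simp add: sum.distrib sum_subtractf sum_distrib_left)
  qed
  show ?thesis
  \<comment> \<open>A negative total would make the sums over all large finite sets of pairs
    negative, but every finite set of pairs lies in a square \<open>S \<times> S\<close>, where
    \<open>kS\<close> applies.\<close>
  proof (rule ccontr)
    assume "\<not> ?thesis"
    then have "\<forall>\<^sub>F A in finite_subsets_at_top UNIV. sum k A < 0"
      using k unfolding has_sum_def by (intro order_tendstoD) auto
    then obtain A0 where A0: "finite A0" "\<And>A. finite A \<Longrightarrow> A0 \<subseteq> A \<Longrightarrow> sum k A < 0"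
      unfolding eventually_finite_subsets_at_top by auto
    define S where "S = fst ` A0 \<union> snd ` A0"
    have "finite S" "A0 \<subseteq> S \<times> S" using A0(1) by (force simp: S_def)+
    then show False using A0(2)[of "S \<times> S"] kS[of S] by simp
  qed
qed

text \<open>Monotonicity turns the limit into the bound \<open>jump_form (p t) f <= L * t\<close>
  for all \<open>t\<close>. An exponential time of rate \<open>l\<close> has mean
  \<open>1 / l\<close>, so averaging gives \<open>L\<close> as a bound for the resolvent energies.
  The functions \<open>l * G_l f\<close> then have energy at most \<open>L\<close> and converge to
  \<open>f\<close>, and Fatou concludes.\<close>

lemma energy_le_limit:
  assumes f: "f \<in> L2 m" and lim: "((\<lambda>t. jump_form (p t) f / t) \<longlongrightarrow> L) (at_right 0)"
  shows "finite_energy f \<and> EE f f \<le> L"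
proof -
  have le: "jump_form (p t) f \<le> L * t" if t: "0 < t" for t
  proof -
    have "jump_form (p t) f / t \<le> L"
    proof (rule tendsto_lowerbound[OF lim])
      show "\<forall>\<^sub>F s in at_right 0. jump_form (p t) f / t \<le> jump_form (p s) f / s"
        using eventually_at_right_less[of 0] eventually_at_right_real[OF t]
      proof eventually_elim
        case (elim s)
        then show ?case using jump_form_antimono[OF f, of s t] t by (simp add: field_simps)
      qed
    qed simp
    then show ?thesis using t by (simp add: field_simps)
  qed
  have jf0: "jump_form (p 0) f = 0"
    unfolding jump_form_def p_zero by (simp, rule infsum_0) (auto simp: delta_def)
  have L0: "0 \<le> L"
    using jump_form_nonneg[OF sym_kernel_p[of 1], of f] le[of 1] by simp
  have I: "l * jump_form (\<lambda>x y. l * R l x y) f \<le> L" if l: "0 < l" for l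
  proof -
    have "ennreal (l * jump_form (\<lambda>x y. l * R l x y) f) = ennreal l *
        (\<integral>\<^sup>+t. indicator {0..} t * ennreal (l * exp (- l * t) * jump_form (p t) f) \<partial>lborel)"
      unfolding jump_form_laplace[OF l f] using l by (simp add: ennreal_mult')
    \<comment> \<open>\<open>erlang_density 1 l t\<close> is \<open>l^2 * t * exp (- l * t)\<close>,
      a probability density; the power \<open>t ^ 0\<close> only serves to quote its moment of order
      zero.\<close>
    also have "\<dots> \<le> ennreal l * (\<integral>\<^sup>+t. ennreal (L / l) * ennreal (erlang_density 1 l t * t ^ 0) \<partial>lborel)"
    proof (intro mult_left_mono nn_integral_mono)
      fix t :: real
      show "indicator {0..} t * ennreal (l * exp (- l * t) * jump_form (p t) f)
          \<le> ennreal (L / l) * ennreal (erlang_density 1 l t * t ^ 0)"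
      proof (cases "0 \<le> t")
        case True
        have "l * exp (- l * t) * jump_form (p t) f \<le> l * exp (- l * t) * (L * t)"
          using le[of t] True jf0 l by (intro mult_left_mono) (auto simp: le_less)
        also have "\<dots> = L / l * (erlang_density 1 l t * t ^ 0)"
          using l True by (simp add: erlang_density_def power2_eq_square)
        finally show ?thesis using True L0 l
          by (simp add: ennreal_mult'[symmetric] ennreal_leI)
      qed simp
    qed simp
    also have "\<dots> = ennreal l * (ennreal (L / l) * (\<integral>\<^sup>+t. ennreal (erlang_density 1 l t * t ^ 0) \<partial>lborel))"
      by (subst nn_integral_cmult) auto
    also have "(\<integral>\<^sup>+t. ennreal (erlang_density 1 l t * t ^ 0) \<partial>lborel) = 1"
      by (subst nn_integral_erlang_ith_moment[OF l]) simp
    also have "ennreal l * (ennreal (L / l) * 1) = ennreal L"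
      using l L0 by (simp add: ennreal_mult'[symmetric])
    finally show ?thesis using L0 by simp
  qed
  have "\<exists>g. is_resolvent (real (Suc n)) f g" for n by (rule resolvent_exists[OF _ f]) simp
  then obtain g where g: "\<And>n. is_resolvent (real (Suc n)) f (g n)" by metis
  define u where "u n x = real (Suc n) * g n x" for n x
  have Sn: "0 < real (Suc n)" for n by simp
  have re1: "finite_energy (u n)" "u n \<in> L2 m"
    "EE (u n) (u n) + real (Suc n) * ip (\<lambda>x. u n x - f x) (\<lambda>x. u n x - f x) \<le> L" for n
    using resolvent_energy[OF Sn[of n] f g[of n]] I[OF Sn[of n]] unfolding u_def[abs_def] by auto
  have EEu: "EE (u n) (u n) \<le> L" for n
    using re1(3)[of n] mult_nonneg_nonneg[OF less_imp_le[OF Sn[of n]] L2_inner_self_nonneg[of m "\<lambda>x. u n x - f x"]]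
    by linarith
  have lim_u: "(\<lambda>n. u n x) \<longlonglongrightarrow> f x" for x
  proof -
    have "(\<lambda>n. (u n x - f x)\<^sup>2) \<longlonglongrightarrow> 0"
    proof (rule tendsto_sandwich[OF _ _ tendsto_const])
      show "(\<lambda>n. (L / mm x) / real (Suc n)) \<longlonglongrightarrow> 0" by (rule LIMSEQ_Suc[OF lim_const_over_n])
      have "(u n x - f x)\<^sup>2 \<le> (L / mm x) / real (Suc n)" for n
      proof -
        have "real (Suc n) * (mm x * (u n x - f x)\<^sup>2) \<le> real (Suc n) * ip (\<lambda>x. u n x - f x) (\<lambda>x. u n x - f x)"
          by (intro mult_left_mono point_le_ip L2_diff re1 f) simp
        also have "\<dots> \<le> L" using re1(3)[of n] EE_nonneg[of "u n"] by linarith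
        finally show ?thesis using mm_pos[of x] by (simp add: field_simps del: of_nat_Suc)
      qed
      then show "\<forall>\<^sub>F n in sequentially. (u n x - f x)\<^sup>2 \<le> (L / mm x) / real (Suc n)" by simp
    qed simp
    then have "(\<lambda>n. u n x - f x) \<longlonglongrightarrow> 0" by simp
    then show ?thesis by (simp add: LIM_zero_iff)
  qed
  have gl: "(\<lambda>n. grad (u n) z) \<longlonglongrightarrow> grad f z" for z
    unfolding grad_def by (intro tendsto_intros lim_u)
  have gu: "grad (u n) \<in> L2 edge_measure" for n using re1(1)[of n] by (simp add: finite_energy_def)
  show ?thesis
    using L2_Fatou[OF gu _ gl, of L] EEu by (simp add: finite_energy_def EE_def)
qed

text \<open>With \<open>?a\<close> the quotient at time \<open>s\<close>, monotonicity gives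
  \<open>jump_form (p t) f >= ?a * t\<close> for \<open>t <= s\<close>. Averaging over these times
  alone loses the tail beyond \<open>s\<close> of the density
  \<open>l^2 * t * exp (- l * t)\<close>, which vanishes as \<open>l\<close> grows, while the
  resolvent energy stays below \<open>EE f f\<close>.\<close>

lemma jump_form_le_energy:
  assumes f: "f \<in> L2 m" "finite_energy f" and s: "0 < s"
  shows "jump_form (p s) f / s \<le> EE f f"
proof -
  let ?a = "jump_form (p s) f / s"
  have a0: "0 \<le> ?a" using jump_form_nonneg[OF sym_kernel_p, of s f] s by simp
  have ge: "?a * t \<le> jump_form (p t) f" if "0 \<le> t" "t \<le> s" for t
    using jump_form_antimono[OF f(1) that] s by (simp add: field_simps)
  have le: "?a * erlang_CDF 1 l s \<le> EE f f" if l: "0 < l" for l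
  proof -
    obtain g where g: "is_resolvent l f g" using resolvent_exists[OF l f(1)] by blast
    have al: "0 \<le> ?a / l" by (rule divide_nonneg_pos[OF a0 l])
    have "ennreal (?a / l * erlang_CDF 1 l s)
        = ennreal (?a / l) * (\<integral>\<^sup>+t. ennreal (erlang_density 1 l t) * indicator {..s} t \<partial>lborel)"
      unfolding nn_integral_erlang_density[OF l] by (rule ennreal_mult'[OF al])
    also have "\<dots> = (\<integral>\<^sup>+t. ennreal (?a / l) * (ennreal (erlang_density 1 l t) * indicator {..s} t) \<partial>lborel)"
      by (rule nn_integral_cmult[symmetric]) measurable
    also have "\<dots> \<le> (\<integral>\<^sup>+t. indicator {0..} t * ennreal (l * exp (- l * t) * jump_form (p t) f) \<partial>lborel)"
    proof (rule nn_integral_mono)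
      fix t :: real
      show "ennreal (?a / l) * (ennreal (erlang_density 1 l t) * indicator {..s} t)
          \<le> indicator {0..} t * ennreal (l * exp (- l * t) * jump_form (p t) f)"
      proof (cases "0 \<le> t \<and> t \<le> s")
        case True
        have "?a / l * erlang_density 1 l t = l * exp (- l * t) * (?a * t)"
          using True l by (simp add: erlang_density_def power2_eq_square)
        also have "\<dots> \<le> l * exp (- l * t) * jump_form (p t) f"
          using ge[of t] True l by (intro mult_left_mono) auto
        finally have "ennreal (?a / l * erlang_density 1 l t) \<le> ennreal (l * exp (- l * t) * jump_form (p t) f)"
          by (rule ennreal_leI)
        then show ?thesis using True unfolding ennreal_mult'[OF al] by simp
      next
        case False
        then show ?thesis by (auto simp: erlang_density_def)
      qed
    qed
    also have "\<dots> = ennreal (jump_form (\<lambda>x y. l * R l x y) f)"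
      by (rule jump_form_laplace[OF l f(1)])
    finally have "?a / l * erlang_CDF 1 l s \<le> jump_form (\<lambda>x y. l * R l x y) f"
      using jump_form_nonneg[OF sym_kernel_R[OF l]] by simp
    from mult_left_mono[OF this less_imp_le[OF l]]
    have "l * (?a / l * erlang_CDF 1 l s) \<le> l * jump_form (\<lambda>x y. l * R l x y) f" .
    also have "l * (?a / l * erlang_CDF 1 l s) = ?a * erlang_CDF 1 l s" using l by simp
    finally have "?a * erlang_CDF 1 l s \<le> l * jump_form (\<lambda>x y. l * R l x y) f" .
    also have "\<dots> \<le> EE f f" by (rule resolvent_energy(4)[OF l f(1) g f(2)])
    finally show ?thesis .
  qed
  \<comment> \<open>The value is \<open>1 - (1 + l * s) * exp (- l * s)\<close>.\<close>
  have "((\<lambda>l. erlang_CDF 1 l s) \<longlongrightarrow> 1) at_top"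
  proof -
    have "((\<lambda>l. 1 - (exp (- (l * s)) + (l * s) * exp (- (l * s)))) \<longlongrightarrow> 1 - (0 + 0)) at_top"
    proof (intro tendsto_intros)
      have ls: "filterlim (\<lambda>l. l * s) at_top at_top"
        using filterlim_tendsto_pos_mult_at_top[OF tendsto_const s filterlim_ident] by (simp add: mult.commute)
      have "((\<lambda>x::real. exp (- x)) \<longlongrightarrow> 0) at_top"
        by (rule filterlim_compose[OF exp_at_bot filterlim_uminus_at_bot_at_top])
      from filterlim_compose[OF this ls] show "((\<lambda>l. exp (- (l * s))) \<longlongrightarrow> 0) at_top" .
      have "((\<lambda>x::real. x * exp (- x)) \<longlongrightarrow> 0) at_top"
        using tendsto_power_div_exp_0[of 1] by (simp add: exp_minus divide_inverse)
      from filterlim_compose[OF this ls] show "((\<lambda>l. (l * s) * exp (- (l * s))) \<longlongrightarrow> 0) at_top" .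
    qed
    then show ?thesis
      using s by (simp add: erlang_CDF_def algebra_simps)
  qed
  then have "((\<lambda>l. ?a * erlang_CDF 1 l s) \<longlongrightarrow> ?a * 1) at_top" by (intro tendsto_intros)
  then have "?a * 1 \<le> EE f f"
    by (rule tendsto_upperbound) (rule eventually_mono[OF eventually_gt_at_top[of 0]], rule le, simp_all)
  then show ?thesis by simp
qed

text \<open>By monotonicity the limit exists and is the supremum. One bound for it is
  \<open>jump_form_le_energy\<close>, the other is \<open>energy_le_limit\<close>.\<close>

lemma jump_form_tendsto_energy:
  assumes f: "f \<in> L2 m" "finite_energy f"
  shows "((\<lambda>t. jump_form (p t) f / t) \<longlongrightarrow> EE f f) (at_right 0)"
proof -
  define L where "L = (SUP s\<in>{0<..}. jump_form (p s) f / s)"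
  have bdd: "bdd_above ((\<lambda>s. jump_form (p s) f / s) ` {0<..})"
    by (rule bdd_aboveI2[of _ _ "EE f f"]) (use jump_form_le_energy[OF f] in auto)
  have le_L: "jump_form (p s) f / s \<le> L" if "0 < s" for s
    unfolding L_def by (rule cSUP_upper[OF _ bdd]) (use that in auto)
  have L_le: "L \<le> EE f f"
    unfolding L_def by (rule cSUP_least) (auto intro: jump_form_le_energy[OF f])
  have lim: "((\<lambda>t. jump_form (p t) f / t) \<longlongrightarrow> L) (at_right 0)"
  proof (rule order_tendstoI)
    fix a assume "a < L"
    then obtain s where s: "0 < s" "a < jump_form (p s) f / s"
      unfolding L_def using less_cSUP_iff[OF _ bdd] by auto
    show "\<forall>\<^sub>F t in at_right 0. a < jump_form (p t) f / t"
      using eventually_at_right_less[of 0] eventually_at_right_real[OF s(1)]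
    proof eventually_elim
      case (elim t)
      then have "jump_form (p s) f / s \<le> jump_form (p t) f / t"
        using jump_form_antimono[OF f(1), of t s] s(1) by (simp add: field_simps)
      then show ?case using s(2) by simp
    qed
  next
    fix a assume "L < a"
    show "\<forall>\<^sub>F t in at_right 0. jump_form (p t) f / t < a"
      using eventually_at_right_less[of 0]
      by eventually_elim (use le_L \<open>L < a\<close> le_less_trans in blast)
  qed
  moreover have "EE f f \<le> L" using energy_le_limit[OF f(1) lim] by simp
  ultimately show ?thesis using L_le by simp
qed

end

section \<open>Markov property of the reflected walk\<close>

lemma measure_tendsto_AE_zero:
  assumes "prob_space M" "\<And>n. A n \<in> sets M" "AE \<omega> in M. \<forall>\<^sub>F n in sequentially. \<omega> \<notin> A n"
  shows "(\<lambda>n. measure M (A n)) \<longlonglongrightarrow> 0"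
proof -
  interpret prob_space M by fact
  have "(\<lambda>n. \<integral>\<omega>. indicator (A n) \<omega> \<partial>M) \<longlonglongrightarrow> (\<integral>\<omega>. (0::real) \<partial>M)"
  proof (rule integral_dominated_convergence[where w = "\<lambda>_. 1"])
    show "AE \<omega> in M. (\<lambda>n. indicator (A n) \<omega> :: real) \<longlonglongrightarrow> 0"
      using assms(3) by eventually_elim (auto elim!: eventually_mono intro!: tendsto_eventually)
  qed (use assms(2) in \<open>auto split: split_indicator\<close>)
  then show ?thesis using assms(2) by simp
qed

locale reflected_walk_network = network E c + reflected_walk E c w P X
  for E :: "'v set set" and c :: "'v set \<Rightarrow> real" and w :: "'v \<Rightarrow> real"
    and P :: "'v \<Rightarrow> 'w measure" and X :: "'v \<Rightarrow> real \<Rightarrow> 'w \<Rightarrow> 'v option" +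
  assumes w_pos: "0 < w x"
begin

abbreviation p :: "real \<Rightarrow> 'v \<Rightarrow> 'v \<Rightarrow> real" where
  "p \<equiv> transition_prob P X"

abbreviation at_state :: "'v \<Rightarrow> real \<Rightarrow> 'v \<Rightarrow> 'w set" where
  "at_state x t y \<equiv> {\<omega>\<in>space (P x). X x t \<omega> = Some y}"

lemma countable_vertex_set: "countable (B :: 'v set)"
  by (rule countable_subset[OF subset_UNIV countable_V])

lemma X_event: "0 \<le> t \<Longrightarrow> {\<omega>\<in>space (P x). X x t \<omega> \<in> B} \<in> sets (P x)"
  using measurable_sets[OF measurable_X[of t x], of B] by (simp add: vimage_def Int_def conj_commute)

lemma X_event_eq: "0 \<le> t \<Longrightarrow> {\<omega>\<in>space (P x). X x t \<omega> = a} \<in> sets (P x)"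
  using X_event[of t x "{a}"] by simp

text \<open>At a fixed time the walk is almost surely at a vertex, so the countably many vertex
  events exhaust \<open>D\<close>. This is where no mass is lost to infinity.\<close>

lemma emeasure_vertex_decomp:
  assumes t: "0 \<le> t" and D: "D \<in> sets (P x)"
  shows "emeasure (P x) D = (\<integral>\<^sup>+z. emeasure (P x) (D \<inter> at_state x t z) \<partial>count_space UNIV)"
proof -
  have sets: "D \<inter> at_state x t z \<in> sets (P x)" for z
    using D X_event_eq[OF t] by blast
  have "emeasure (P x) D = emeasure (P x) (\<Union>z. D \<inter> at_state x t z)"
  proof (rule emeasure_eq_AE)
    show "AE \<omega> in P x. \<omega> \<in> D \<longleftrightarrow> \<omega> \<in> (\<Union>z. D \<inter> at_state x t z)"
      using locally_constant_at[OF t, of x]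
      by eventually_elim (use sets.sets_into_space[OF D] in auto)
    show "(\<Union>z. D \<inter> at_state x t z) \<in> sets (P x)"
      using sets by (intro sets.countable_UN'' countable_vertex_set) auto
  qed (rule D)
  also have "\<dots> = (\<integral>\<^sup>+z. emeasure (P x) (D \<inter> at_state x t z) \<partial>count_space UNIV)"
    by (rule emeasure_UN_countable) (use sets in \<open>auto simp: disjoint_family_on_def intro: countable_vertex_set\<close>)
  finally show ?thesis .
qed

lemma prob_vertex_decomp:
  assumes t: "0 \<le> t" and D: "D \<in> sets (P x)"
  shows "((\<lambda>z. measure (P x) (D \<inter> at_state x t z)) has_sum measure (P x) D) UNIV"
proof (rule has_sum_of_nn_integral)
  interpret prob_space "P x" by (rule prob_space_P)
  show "(\<integral>\<^sup>+z. ennreal (measure (P x) (D \<inter> at_state x t z)) \<partial>count_space UNIV)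
      = ennreal (measure (P x) D)"
    using emeasure_vertex_decomp[OF assms] by (simp add: emeasure_eq_measure)
qed auto

lemma transition_prob_nonneg: "0 \<le> p t x y"
  by (simp add: transition_prob_def)

lemma transition_prob_total: "0 \<le> t \<Longrightarrow> (p t x has_sum 1) UNIV"
proof -
  assume t: "0 \<le> t"
  interpret prob_space "P x" by (rule prob_space_P)
  have "space (P x) \<inter> at_state x t z = at_state x t z" for z
    by auto
  then show "(p t x has_sum 1) UNIV"
    using prob_vertex_decomp[OF t sets.top, of x] prob_space by (simp add: transition_prob_def[abs_def])
qed

lemma transition_prob_zero: "p 0 x y = delta x y"
proof -
  interpret prob_space "P x" by (rule prob_space_P)
  show ?thesis
  proof (cases "x = y")
    case True
    have "p 0 x y = 1"
      unfolding transition_prob_def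
      by (subst prob_Collect_eq_1) (use X_event_eq[of 0 x "Some y"] start[of x] True in auto)
    then show ?thesis using True by (simp add: delta_def)
  next
    case False
    have "p 0 x y = 0"
      unfolding transition_prob_def
      by (subst prob_Collect_eq_0) (use X_event_eq[of 0 x "Some y"] start[of x] False in auto)
    then show ?thesis using False by (simp add: delta_def)
  qed
qed

text \<open>Almost every path is constant near the fixed time \<open>t\<close>, so the events at
  \<open>s n\<close> and at \<open>t\<close> eventually agree path by path and their symmetric
  difference has vanishing probability.\<close>

lemma transition_prob_continuous: "continuous_on {0..} (\<lambda>t. p t x y)"
  unfolding continuous_on_sequentially
proof (intro allI ballI impI, elim conjE)
  fix s :: "nat \<Rightarrow> real" and t :: real
  assume t: "t \<in> {0..}" and s: "\<forall>n. s n \<in> {0..}" and lim: "s \<longlonglongrightarrow> t"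
  interpret prob_space "P x" by (rule prob_space_P)
  let ?A = "\<lambda>t. at_state x t y"
  have A: "?A t \<in> sets (P x)" "?A (s n) \<in> sets (P x)" for n using t s by (auto intro: X_event_eq)
  have "(\<lambda>n. measure (P x) ((?A (s n) - ?A t) \<union> (?A t - ?A (s n)))) \<longlonglongrightarrow> 0"
  proof (rule measure_tendsto_AE_zero[OF prob_space_P])
    show "(?A (s n) - ?A t) \<union> (?A t - ?A (s n)) \<in> sets (P x)" for n using A by auto
    have "0 \<le> t" using t by simp
    from locally_constant_at[OF this, of x]
    show "AE \<omega> in P x. \<forall>\<^sub>F n in sequentially. \<omega> \<notin> (?A (s n) - ?A t) \<union> (?A t - ?A (s n))"
    proof eventually_elim
      case (elim \<omega>)
      then obtain e where e: "e > 0" "\<And>r. 0 \<le> r \<Longrightarrow> \<bar>r - t\<bar> < e \<Longrightarrow> X x r \<omega> = X x t \<omega>" by blast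
      from tendstoD[OF lim e(1)] show ?case
      proof eventually_elim
        case (elim n)
        then have "X x (s n) \<omega> = X x t \<omega>" using e(2)[of "s n"] s by (auto simp: dist_real_def)
        then show ?case by auto
      qed
    qed
  qed
  moreover have "\<bar>p (s n) x y - p t x y\<bar> \<le> measure (P x) ((?A (s n) - ?A t) \<union> (?A t - ?A (s n)))" for n
  proof -
    have "measure (P x) A \<le> measure (P x) B + measure (P x) ((A - B) \<union> (B - A))"
      if "A \<in> sets (P x)" "B \<in> sets (P x)" for A B
    proof -
      have "measure (P x) A \<le> measure (P x) (B \<union> ((A - B) \<union> (B - A)))"
        using that by (intro finite_measure_mono) auto
      also have "\<dots> \<le> measure (P x) B + measure (P x) ((A - B) \<union> (B - A))"
        using that by (intro measure_Un_le) auto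
      finally show ?thesis .
    qed
    from this[OF A(2)[of n] A(1)] this[OF A(1) A(2)[of n]] show ?thesis
      by (simp add: transition_prob_def Un_commute abs_le_iff)
  qed
  then have "\<forall>\<^sub>F n in sequentially. norm (p (s n) x y - p t x y)
      \<le> measure (P x) ((?A (s n) - ?A t) \<union> (?A t - ?A (s n)))"
    unfolding real_norm_def by (intro always_eventually allI)
  ultimately have "(\<lambda>n. p (s n) x y - p t x y) \<longlonglongrightarrow> 0"
    by (rule Lim_null_comparison[rotated])
  then show "((\<lambda>t. p t x y) \<circ> s) \<longlonglongrightarrow> p t x y"
    by (simp add: LIM_zero_iff comp_def)
qed

lemma past_subalgebra:
  assumes "0 \<le> t"
  shows "subalgebra (P x) (past (P x) (X x) t)"
  unfolding subalgebra_def past_def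
proof
  show "space (vimage_algebra (space (P x)) (\<lambda>\<omega>. \<lambda>s\<in>{0..t}. X x s \<omega>) (Pi\<^sub>M {0..t} (\<lambda>_. count_space UNIV))) = space (P x)"
    by simp
  have "(\<lambda>\<omega>. \<lambda>s\<in>{0..t}. X x s \<omega>) \<in> measurable (P x) (Pi\<^sub>M {0..t} (\<lambda>_. count_space UNIV))"
    by (rule measurable_restrict) (auto intro: measurable_X)
  then show "sets (vimage_algebra (space (P x)) (\<lambda>\<omega>. \<lambda>s\<in>{0..t}. X x s \<omega>) (Pi\<^sub>M {0..t} (\<lambda>_. count_space UNIV))) \<subseteq> sets (P x)"
    by (rule sets_image_in_sets[OF refl])
qed

lemma past_event:
  assumes "0 \<le> s" "s \<le> t"
  shows "{\<omega>\<in>space (P x). X x s \<omega> \<in> B} \<in> sets (past (P x) (X x) t)"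
proof -
  let ?\<phi> = "\<lambda>\<omega>. \<lambda>s\<in>{0..t}. X x s \<omega>"
  have "?\<phi> \<in> space (P x) \<rightarrow> space (Pi\<^sub>M {0..t} (\<lambda>_. count_space UNIV))"
    by (auto simp: space_PiM)
  then have 1: "?\<phi> \<in> measurable (past (P x) (X x) t) (Pi\<^sub>M {0..t} (\<lambda>_. count_space UNIV))"
    unfolding past_def by (rule measurable_vimage_algebra1)
  have "(\<lambda>\<omega>. ?\<phi> \<omega> s) \<in> measurable (past (P x) (X x) t) (count_space UNIV)"
    by (rule measurable_compose[OF 1 measurable_component_singleton]) (use assms in auto)
  then have "(\<lambda>\<omega>. ?\<phi> \<omega> s) -` B \<inter> space (past (P x) (X x) t) \<in> sets (past (P x) (X x) t)"
    by (rule measurable_sets) simp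
  also have "(\<lambda>\<omega>. ?\<phi> \<omega> s) -` B \<inter> space (past (P x) (X x) t) = {\<omega>\<in>space (P x). X x s \<omega> \<in> B}"
    using assms by (auto simp: past_def)
  finally show ?thesis .
qed

text \<open>The Markov property integrated over an event \<open>F\<close> of the past. Later
  \<open>F\<close> says that \<open>S\<close> was not visited at earlier grid times;
  \<open>F\<close> as the whole space yields the semigroup law.\<close>

lemma markov_prob:
  assumes t: "0 \<le> t" and s: "0 \<le> s" and F: "F \<in> sets (past (P z) (X z) t)"
  shows "measure (P z) (F \<inter> at_state z t x \<inter> at_state z (s + t) y)
    = measure (P z) (F \<inter> at_state z t x) * p s x y"
proof -
  interpret prob_space "P z" by (rule prob_space_P)
  interpret sub: finite_measure_subalgebra "P z" "past (P z) (X z) t"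
    by unfold_locales (rule past_subalgebra[OF t])
  define B :: "(real \<Rightarrow> 'v option) set" where "B = {\<pi>\<in>space path_space. \<pi> s = Some y}"
  have B: "B \<in> sets path_space"
  proof -
    have "(\<lambda>\<pi>. \<pi> s) \<in> measurable path_space (count_space (UNIV :: 'v option set))"
      by (rule measurable_component_singleton) (use s in simp)
    from measurable_sets[OF this, of "{Some y}"] show ?thesis
      by (simp add: B_def vimage_def Int_def conj_commute)
  qed
  have sp: "sample_path (X x) \<in> measurable (P x) path_space"
    unfolding sample_path_def[abs_def] by (rule measurable_restrict) (auto intro: measurable_X)
  have spB: "sample_path Y \<omega> \<in> B \<longleftrightarrow> Y s \<omega> = Some y" for Y :: "real \<Rightarrow> 'w \<Rightarrow> 'v option" and \<omega>
    using s by (auto simp: B_def sample_path_def space_PiM)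
  have law: "measure (process_law (P x) (X x)) B = p s x y"
    unfolding process_law_def measure_distr[OF sp B] transition_prob_def
    by (rule arg_cong[where f = "measure (P x)"]) (auto simp: spB)
  let ?D = "at_state z (s + t) y"
  let ?F = "F \<inter> at_state z t x"
  have D: "?D \<in> sets (P z)" using s t by (intro X_event_eq) simp
  have Fp: "?F \<in> sets (past (P z) (X z) t)"
    using F past_event[OF t order_refl, of z "{Some x}"] by auto
  then have Fs: "?F \<in> sets (P z)" using sub.subalg unfolding subalgebra_def by blast
  let ?r = "real_cond_exp (P z) (past (P z) (X z) t) (indicator ?D)"
  have "AE \<omega> in P z. X z t \<omega> = Some x \<longrightarrow> ?r \<omega> = p s x y"
    using markov[OF t B, of z x] unfolding law spB .
  then have ae: "AE \<omega> in P z. indicator ?F \<omega> * ?r \<omega> = indicator ?F \<omega> * p s x y"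
    by eventually_elim (auto split: split_indicator)
  have iD: "integrable (P z) (indicator ?D :: 'w \<Rightarrow> real)"
    by (rule integrable_real_indicator[OF D]) (simp add: emeasure_eq_measure)
  have "measure (P z) (?F \<inter> ?D) = (\<integral>\<omega>. indicator ?F \<omega> * indicator ?D \<omega> \<partial>P z)"
    using D Fs by (simp add: indicator_inter_arith[symmetric])
  also have "\<dots> = (\<integral>\<omega>. indicator ?F \<omega> * ?r \<omega> \<partial>P z)"
    using sub.real_cond_exp_intA[OF iD Fp] by (simp only: set_lebesgue_integral_def real_scaleR_def)
  also have "\<dots> = (\<integral>\<omega>. indicator ?F \<omega> * p s x y \<partial>P z)"
    by (rule integral_cong_AE) (use ae Fs in auto)
  also have "\<dots> = measure (P z) ?F * p s x y" using Fs by simp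
  finally show ?thesis .
qed

lemma transition_prob_add:
  assumes "0 \<le> s" "0 \<le> t"
  shows "p (s + t) x y = (\<Sum>\<^sub>\<infinity>z. p s x z * p t z y)"
proof -
  have st: "0 \<le> s + t" using assms by simp
  let ?D = "at_state x (s + t) y"
  have "measure (P x) (?D \<inter> at_state x s z) = p s x z * p t z y" for z
  proof -
    have sp: "space (P x) \<in> sets (past (P x) (X x) s)"
      using past_event[OF assms(1) order_refl, of x UNIV] by simp
    have "space (P x) \<inter> at_state x s z = at_state x s z" by auto
    then show ?thesis
      using markov_prob[OF assms(1,2) sp, of z y] by (simp add: transition_prob_def Int_commute add.commute)
  qed
  then have "((\<lambda>z. p s x z * p t z y) has_sum p (s + t) x y) UNIV"
    using prob_vertex_decomp[OF assms(1) X_event_eq[OF st, of x "Some y"]] by (simp add: transition_prob_def)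
  then show ?thesis by (simp add: infsumI)
qed

end

sublocale reflected_walk_network \<subseteq> markov_transition E c "transition_prob P X"
  by unfold_locales
    (fact transition_prob_nonneg transition_prob_total transition_prob_continuous
      transition_prob_zero transition_prob_add)+

section \<open>Stopping on a time grid\<close>

context reflected_walk_network
begin

text \<open>Index and state of the first grid time in \<open>S\<close>. A visit to
  \<open>None\<close> counts as not being in \<open>S\<close>.\<close>

definition grid_hit :: "'v \<Rightarrow> 'v set \<Rightarrow> real \<Rightarrow> nat \<Rightarrow> 'v \<Rightarrow> 'w set" where
  "grid_hit x S h k a = {\<omega>\<in>space (P x). (\<forall>j\<in>{..<k}. X x (real j * h) \<omega> \<in> - (Some ` S)) \<and>
     X x (real k * h) \<omega> = Some a \<and> a \<in> S}"

definition grid_avoid :: "'v \<Rightarrow> 'v set \<Rightarrow> real \<Rightarrow> real \<Rightarrow> 'w set" where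
  "grid_avoid x S h t = {\<omega>\<in>space (P x). \<forall>j. real j * h \<le> t \<longrightarrow> X x (real j * h) \<omega> \<in> - (Some ` S)}"

lemma grid_avoid_past:
  assumes "0 < h"
  shows "{\<omega>\<in>space (P x). \<forall>j\<in>{..<k}. X x (real j * h) \<omega> \<in> B} \<in> sets (past (P x) (X x) (real k * h))"
proof -
  have sp: "space (past (P x) (X x) (real k * h)) = space (P x)" by (simp add: past_def)
  have "{\<omega>\<in>space (past (P x) (X x) (real k * h)). \<forall>j\<in>{..<k}. X x (real j * h) \<omega> \<in> B}
      \<in> sets (past (P x) (X x) (real k * h))"
  proof (rule sets.sets_Collect_finite_All)
    fix j assume "j \<in> {..<k}"
    then show "{\<omega>\<in>space (past (P x) (X x) (real k * h)). X x (real j * h) \<omega> \<in> B} \<in> sets (past (P x) (X x) (real k * h))"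
      unfolding sp using assms by (intro past_event mult_right_mono) auto
  qed simp
  then show ?thesis unfolding sp .
qed

lemma grid_hit_sets:
  assumes h: "0 < h"
  shows "grid_hit x S h k a \<in> sets (P x)"
proof (cases "a \<in> S")
  case True
  have kh: "0 \<le> real k * h" using h by simp
  have "{\<omega>\<in>space (P x). \<forall>j\<in>{..<k}. X x (real j * h) \<omega> \<in> - (Some ` S)} \<in> sets (P x)"
    using grid_avoid_past[OF h, of x k] past_subalgebra[OF kh, of x] unfolding subalgebra_def by blast
  moreover have "at_state x (real k * h) a \<in> sets (P x)"
    by (rule X_event_eq[OF kh])
  moreover have "grid_hit x S h k a = {\<omega>\<in>space (P x). \<forall>j\<in>{..<k}. X x (real j * h) \<omega> \<in> - (Some ` S)}
      \<inter> at_state x (real k * h) a"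
    using True by (auto simp: grid_hit_def)
  ultimately show ?thesis by auto
next
  case False
  then have "grid_hit x S h k a = {}" by (simp add: grid_hit_def)
  then show ?thesis by (simp only: sets.empty_sets)
qed

lemma grid_avoid_sets:
  assumes h: "0 < h"
  shows "grid_avoid x S h t \<in> sets (P x)"
proof -
  have "{\<omega>\<in>space (P x). real j * h \<le> t \<longrightarrow> X x (real j * h) \<omega> \<in> - (Some ` S)} \<in> sets (P x)" for j
  proof (cases "real j * h \<le> t")
    case True
    then show ?thesis using X_event[of "real j * h" x "- (Some ` S)"] h by simp
  next
    case False
    then show ?thesis by simp
  qed
  then show ?thesis unfolding grid_avoid_def by (rule sets.sets_Collect_countable_All)
qed

lemma grid_hit_disjoint:
  assumes "\<omega> \<in> grid_hit x S h k a" "\<omega> \<in> grid_hit x S h k' a'"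
  shows "k = k' \<and> a = a'"
proof -
  have "k = k'"
  proof (rule linorder_cases)
    assume "k < k'"
    then have "X x (real k * h) \<omega> \<in> - (Some ` S)" using assms(2) by (auto simp: grid_hit_def)
    then show ?thesis using assms(1) by (auto simp: grid_hit_def)
  next
    assume "k' < k"
    then have "X x (real k' * h) \<omega> \<in> - (Some ` S)" using assms(1) by (auto simp: grid_hit_def)
    then show ?thesis using assms(2) by (auto simp: grid_hit_def)
  qed
  then show ?thesis using assms by (auto simp: grid_hit_def)
qed

lemma grid_hit_markov:
  assumes h: "0 < h" and t: "real k * h \<le> t"
  shows "measure (P x) (grid_hit x S h k a \<inter> at_state x t y)
    = measure (P x) (grid_hit x S h k a) * p (t - real k * h) a y"
proof (cases "a \<in> S")
  case True
  have kh: "0 \<le> real k * h" using h by simp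
  let ?F = "{\<omega>\<in>space (P x). \<forall>j\<in>{..<k}. X x (real j * h) \<omega> \<in> - (Some ` S)}"
  have eq: "grid_hit x S h k a = ?F \<inter> at_state x (real k * h) a"
    using True by (auto simp: grid_hit_def)
  show ?thesis
    using markov_prob[OF kh _ grid_avoid_past[OF h], of "t - real k * h" x "- (Some ` S)" a y] t
    unfolding eq by simp
next
  case False
  then have "grid_hit x S h k a = {}" by (simp add: grid_hit_def)
  then show ?thesis by simp
qed

lemma countable_index: "countable (UNIV :: (nat \<times> 'v) set)"
  using countable_SIGMA[of "UNIV :: nat set" "\<lambda>_. UNIV :: 'v set"] countable_V by simp

text \<open>Vanishing at negative times, so that sums over grid indices need no restriction to
  \<open>k * h <= t\<close>.\<close>

definition pos_p :: "real \<Rightarrow> 'v \<Rightarrow> 'v \<Rightarrow> real" where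
  "pos_p t a y = indicator {0..} t * p t a y"

text \<open>First-passage decomposition: either \<open>S\<close> was met at a grid time up to
  \<open>t\<close>, and the walk restarts from there, or it was avoided at all of them.\<close>

lemma p_decomp:
  assumes h: "0 < h" and t: "0 \<le> t"
  shows "ennreal (p t x y) = (\<integral>\<^sup>+ka. ennreal (measure (P x) (grid_hit x S h (fst ka) (snd ka))
      * pos_p (t - real (fst ka) * h) (snd ka) y) \<partial>count_space UNIV)
    + ennreal (measure (P x) (grid_avoid x S h t \<inter> at_state x t y))"
proof -
  interpret prob_space "P x" by (rule prob_space_P)
  let ?Y = "at_state x t y"
  define D where "D ka = (if real (fst ka) * h \<le> t then grid_hit x S h (fst ka) (snd ka) \<inter> ?Y else {})"
    for ka :: "nat \<times> 'v"
  have Y: "?Y \<in> sets (P x)" by (rule X_event_eq[OF t])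
  have D: "D ka \<in> sets (P x)" for ka
    unfolding D_def using grid_hit_sets[OF h] Y by auto
  have disj: "disjoint_family_on D UNIV"
    unfolding disjoint_family_on_def
  proof (intro ballI impI equals0I)
    fix ka kb \<omega> assume "ka \<noteq> kb" "\<omega> \<in> D ka \<inter> D kb"
    then have "\<omega> \<in> grid_hit x S h (fst ka) (snd ka)" "\<omega> \<in> grid_hit x S h (fst kb) (snd kb)"
      by (auto simp: D_def split: if_splits)
    from grid_hit_disjoint[OF this] show False using \<open>ka \<noteq> kb\<close> by (simp add: prod_eq_iff)
  qed
  have union: "?Y = (\<Union>ka. D ka) \<union> (grid_avoid x S h t \<inter> ?Y)"
  proof (intro equalityI subsetI)
    fix \<omega> assume \<omega>: "\<omega> \<in> ?Y"
    show "\<omega> \<in> (\<Union>ka. D ka) \<union> (grid_avoid x S h t \<inter> ?Y)"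
    proof (cases "\<omega> \<in> grid_avoid x S h t")
      case False
      then have ex: "\<exists>j. real j * h \<le> t \<and> X x (real j * h) \<omega> \<in> Some ` S"
        using \<omega> by (auto simp: grid_avoid_def)
      define k where "k = (LEAST j. real j * h \<le> t \<and> X x (real j * h) \<omega> \<in> Some ` S)"
      have k: "real k * h \<le> t" "X x (real k * h) \<omega> \<in> Some ` S"
        using LeastI_ex[OF ex] by (auto simp: k_def)
      have less: "X x (real j * h) \<omega> \<in> - (Some ` S)" if "j < k" for j
      proof -
        have "real j * h \<le> real k * h" using that h by (intro mult_right_mono) auto
        then show ?thesis using not_less_Least[OF that[unfolded k_def]] k(1) by auto
      qed
      obtain a where "a \<in> S" "X x (real k * h) \<omega> = Some a" using k(2) by auto
      then have "\<omega> \<in> D (k, a)" using k(1) less \<omega> by (auto simp: D_def grid_hit_def)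
      then show ?thesis by blast
    qed (use \<omega> in blast)
  qed (auto simp: D_def split: if_splits)
  have disj2: "(\<Union>ka. D ka) \<inter> (grid_avoid x S h t \<inter> ?Y) = {}"
    by (auto simp: D_def grid_hit_def grid_avoid_def split: if_splits)
  have UD: "(\<Union>ka. D ka) \<in> sets (P x)"
    by (rule sets.countable_UN''[OF countable_index D])
  have "ennreal (p t x y) = emeasure (P x) ?Y"
    by (simp add: transition_prob_def emeasure_eq_measure)
  also have "\<dots> = emeasure (P x) ((\<Union>ka. D ka) \<union> (grid_avoid x S h t \<inter> ?Y))"
    using union by simp
  also have "\<dots> = emeasure (P x) (\<Union>ka. D ka) + emeasure (P x) (grid_avoid x S h t \<inter> ?Y)"
    by (rule plus_emeasure[symmetric]) (use UD disj2 grid_avoid_sets[OF h] Y in auto)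
  also have "emeasure (P x) (\<Union>ka. D ka) = (\<integral>\<^sup>+ka. emeasure (P x) (D ka) \<partial>count_space UNIV)"
    by (rule emeasure_UN_countable[OF D countable_index disj])
  also have "\<dots> = (\<integral>\<^sup>+ka. ennreal (measure (P x) (grid_hit x S h (fst ka) (snd ka))
      * pos_p (t - real (fst ka) * h) (snd ka) y) \<partial>count_space UNIV)"
    by (rule nn_integral_cong)
      (auto simp: D_def pos_p_def emeasure_eq_measure grid_hit_markov[OF h])
  finally show ?thesis by (simp add: emeasure_eq_measure)
qed

lemma pos_p_measurable: "(\<lambda>t. pos_p t a y) \<in> borel_measurable borel"
  using p_bm[of a y] by (simp add: bounded_measurable_def pos_p_def)

text \<open>The process is not assumed jointly measurable in time and sample point. Measurability in
  \<open>t\<close> is read off from \<open>p_decomp\<close>, which exhibits the remainder as a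
  difference of measurable functions.\<close>

lemma grid_rest_bm:
  assumes h: "0 < h"
  shows "bounded_measurable (\<lambda>t. measure (P x) (grid_avoid x S h t \<inter> at_state x t y)) 1"
    (is "bounded_measurable ?e 1")
  unfolding bounded_measurable_def
proof
  interpret prob_space "P x" by (rule prob_space_P)
  let ?G = "\<lambda>t ka. ennreal (measure (P x) (grid_hit x S h (fst ka) (snd ka))
      * pos_p (t - real (fst ka) * h) (snd ka) y)"
  have "(\<lambda>t. \<integral>\<^sup>+ka. ?G t ka \<partial>count_space UNIV) \<in> borel_measurable lborel"
  proof (rule nn_integral_count_space_swap(2)[OF countable_index lborel.sigma_finite_measure_axioms])
    fix ka :: "nat \<times> 'v"
    have "(\<lambda>t. t - real (fst ka) * h) \<in> borel_measurable lborel" by measurable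
    from measurable_compose[OF this pos_p_measurable[of "snd ka" y]]
    show "(\<lambda>t. ?G t ka) \<in> borel_measurable lborel" by measurable
  qed
  then have 1: "(\<lambda>t. \<integral>\<^sup>+ka. ?G t ka \<partial>count_space UNIV) \<in> borel_measurable borel" by simp
  have "(\<lambda>t. indicator {0..} t * ?e t)
      = (\<lambda>t. pos_p t x y - indicator {0..} t * enn2real (\<integral>\<^sup>+ka. ?G t ka \<partial>count_space UNIV))"
  proof
    fix t :: real
    show "indicator {0..} t * ?e t = pos_p t x y - indicator {0..} t * enn2real (\<integral>\<^sup>+ka. ?G t ka \<partial>count_space UNIV)"
    proof (cases "0 \<le> t")
      case True
      let ?I = "\<integral>\<^sup>+ka. ?G t ka \<partial>count_space UNIV"
      note d = p_decomp[OF h True, of x y S]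
      have fin: "?I \<noteq> \<top>"
      proof
        assume "?I = \<top>"
        then show False using d by simp
      qed
      have "p t x y = enn2real (ennreal (p t x y))" by (simp add: p_nonneg)
      also have "\<dots> = enn2real ?I + ?e t"
        unfolding d using fin by (subst enn2real_plus) (auto simp: less_top)
      finally show ?thesis using True by (simp add: pos_p_def)
    qed (simp add: pos_p_def)
  qed
  then show "(\<lambda>t. indicator {0..} t * ?e t) \<in> borel_measurable borel"
    using 1 pos_p_measurable[of x y] by simp
qed (simp add: prob_space.prob_le_1[OF prob_space_P])

text \<open>The transform of \<open>p_decomp\<close>. The time shift by \<open>k * h\<close> turns
  into the discount factor at the grid time.\<close>

lemma laplace_decomp:
  assumes h: "0 < h" and l: "0 < l"
  shows "ennreal (R l x y) = (\<integral>\<^sup>+ka. ennreal (measure (P x) (grid_hit x S h (fst ka) (snd ka))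
      * (exp (- l * (real (fst ka) * h)) * R l (snd ka) y)) \<partial>count_space UNIV)
    + ennreal (laplace l (\<lambda>t. measure (P x) (grid_avoid x S h t \<inter> at_state x t y)))"
proof -
  let ?e = "\<lambda>t. measure (P x) (grid_avoid x S h t \<inter> at_state x t y)"
  let ?m = "\<lambda>ka. measure (P x) (grid_hit x S h (fst ka) (snd ka))"
  let ?G = "\<lambda>ka t. indicator {0..} t * ennreal (exp (- l * t) * (?m ka * pos_p (t - real (fst ka) * h) (snd ka) y))"
  have pp0: "0 \<le> pos_p t a b" for t a b by (simp add: pos_p_def p_nonneg)
  have Gm: "?G ka \<in> borel_measurable lborel" for ka
  proof -
    have "(\<lambda>t. t - real (fst ka) * h) \<in> borel_measurable lborel" by measurable
    from measurable_compose[OF this pos_p_measurable[of "snd ka" y]]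
    show ?thesis by measurable
  qed
  have G: "(\<integral>\<^sup>+t. ?G ka t \<partial>lborel) = ennreal (?m ka * (exp (- l * (real (fst ka) * h)) * R l (snd ka) y))" for ka
  proof -
    let ?r = "real (fst ka) * h"
    have r0: "0 \<le> ?r" using h by simp
    have cf: "0 \<le> ?m ka * exp (- l * ?r)" by simp
    have "(\<integral>\<^sup>+t. ?G ka t \<partial>lborel) = ennreal \<bar>1\<bar> * (\<integral>\<^sup>+t. ?G ka (?r + 1 * t) \<partial>lborel)"
      by (rule nn_integral_real_affine) (use Gm[of ka] in auto)
    also have "\<dots> = (\<integral>\<^sup>+t. ennreal (?m ka * exp (- l * ?r)) * (indicator {0..} t * ennreal (exp (- l * t) * p t (snd ka) y)) \<partial>lborel)"
    proof -
      have "?G ka (?r + 1 * t) = ennreal (?m ka * exp (- l * ?r)) * (indicator {0..} t * ennreal (exp (- l * t) * p t (snd ka) y))" for t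
      proof (cases "0 \<le> t")
        case True
        have eqe: "exp (- l * (?r + t)) * (?m ka * p t (snd ka) y) = ?m ka * exp (- l * ?r) * (exp (- l * t) * p t (snd ka) y)"
        proof -
          have "exp (- l * (?r + t)) = exp (- l * ?r) * exp (- l * t)"
            unfolding exp_add[symmetric] by (rule arg_cong[where f = exp]) (simp only: distrib_left)
          then show ?thesis by (simp only: mult_ac)
        qed
        have "?G ka (?r + 1 * t) = ennreal (exp (- l * (?r + t)) * (?m ka * p t (snd ka) y))"
          using True r0 by (simp add: pos_p_def)
        also have "\<dots> = ennreal (?m ka * exp (- l * ?r)) * ennreal (exp (- l * t) * p t (snd ka) y)"
          unfolding eqe by (rule ennreal_mult'[OF cf])
        finally show ?thesis using True by simp
      qed (simp add: pos_p_def)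
      then show ?thesis by simp
    qed
    also have "\<dots> = ennreal (?m ka * exp (- l * ?r)) * (\<integral>\<^sup>+t. indicator {0..} t * ennreal (exp (- l * t) * p t (snd ka) y) \<partial>lborel)"
      using p_measurable[of 1 l "snd ka" y] by (intro nn_integral_cmult) simp
    also have "\<dots> = ennreal (?m ka * exp (- l * ?r)) * ennreal (R l (snd ka) y)"
      unfolding R_def by (subst laplace_nn[OF l p_bm]) (auto simp: p_nonneg)
    also have "\<dots> = ennreal (?m ka * (exp (- l * ?r) * R l (snd ka) y))"
      by (subst ennreal_mult'[OF cf, symmetric]) (simp add: mult.assoc)
    finally show ?thesis .
  qed
  have "ennreal (R l x y) = (\<integral>\<^sup>+t. indicator {0..} t * ennreal (exp (- l * t) * p t x y) \<partial>lborel)"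
    unfolding R_def by (subst laplace_nn[OF l p_bm]) (auto simp: p_nonneg)
  also have "\<dots> = (\<integral>\<^sup>+t. (\<integral>\<^sup>+ka. ?G ka t \<partial>count_space UNIV) + indicator {0..} t * ennreal (exp (- l * t) * ?e t) \<partial>lborel)"
  proof (rule nn_integral_cong)
    fix t :: real
    show "indicator {0..} t * ennreal (exp (- l * t) * p t x y)
        = (\<integral>\<^sup>+ka. ?G ka t \<partial>count_space UNIV) + indicator {0..} t * ennreal (exp (- l * t) * ?e t)"
    proof (cases "0 \<le> t")
      case True
      have "ennreal (exp (- l * t) * p t x y) = ennreal (exp (- l * t)) * ennreal (p t x y)"
        by (rule ennreal_mult') simp
      also have "\<dots> = (\<integral>\<^sup>+ka. ennreal (exp (- l * t)) * ennreal (?m ka * pos_p (t - real (fst ka) * h) (snd ka) y) \<partial>count_space UNIV)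
          + ennreal (exp (- l * t)) * ennreal (?e t)"
        unfolding p_decomp[OF h True, of x y S] distrib_left by (subst nn_integral_cmult) auto
      finally show ?thesis using True by (simp add: ennreal_mult')
    qed simp
  qed
  also have "\<dots> = (\<integral>\<^sup>+t. (\<integral>\<^sup>+ka. ?G ka t \<partial>count_space UNIV) \<partial>lborel)
      + (\<integral>\<^sup>+t. indicator {0..} t * ennreal (exp (- l * t) * ?e t) \<partial>lborel)"
  proof (rule nn_integral_add)
    show "(\<lambda>t. \<integral>\<^sup>+ka. ?G ka t \<partial>count_space UNIV) \<in> borel_measurable lborel"
      by (rule nn_integral_count_space_swap(2)[OF countable_index lborel.sigma_finite_measure_axioms Gm])
    have "(\<lambda>t. ennreal (exp (- l * t) * (indicator {0..} t * ?e t))) \<in> borel_measurable lborel"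
    proof (rule measurable_compose[OF borel_measurable_times measurable_ennreal])
      show "(\<lambda>t. indicator {0..} t * ?e t) \<in> borel_measurable lborel"
        using grid_rest_bm[OF h, of x S y] by (simp add: bounded_measurable_def)
    qed measurable
    also have "(\<lambda>t. ennreal (exp (- l * t) * (indicator {0..} t * ?e t)))
        = (\<lambda>t. indicator {0..} t * ennreal (exp (- l * t) * ?e t))"
      by (auto simp: fun_eq_iff split: split_indicator)
    finally show "(\<lambda>t. indicator {0..} t * ennreal (exp (- l * t) * ?e t)) \<in> borel_measurable lborel" .
  qed
  also have "(\<integral>\<^sup>+t. (\<integral>\<^sup>+ka. ?G ka t \<partial>count_space UNIV) \<partial>lborel) = (\<integral>\<^sup>+ka. (\<integral>\<^sup>+t. ?G ka t \<partial>lborel) \<partial>count_space UNIV)"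
    by (rule nn_integral_count_space_swap(1)[OF countable_index lborel.sigma_finite_measure_axioms Gm, symmetric])
  also have "(\<integral>\<^sup>+t. indicator {0..} t * ennreal (exp (- l * t) * ?e t) \<partial>lborel) = ennreal (laplace l ?e)"
    by (rule laplace_nn[OF l grid_rest_bm[OF h]]) simp
  finally show ?thesis unfolding G .
qed

text \<open>The discounted value of \<open>u\<close> at the first grid time spent in \<open>S\<close>, and \<open>0\<close> if there is none.\<close>

definition grid_value :: "'v \<Rightarrow> 'v set \<Rightarrow> real \<Rightarrow> real \<Rightarrow> ('v \<Rightarrow> real) \<Rightarrow> 'w \<Rightarrow> ennreal" where
  "grid_value x S h b u \<omega> = (\<integral>\<^sup>+ka. indicator (grid_hit x S h (fst ka) (snd ka)) \<omega>
     * ennreal (exp (- b * (real (fst ka) * h)) * u (snd ka)) \<partial>count_space UNIV)"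

lemma grid_value_hit:
  assumes "\<omega> \<in> grid_hit x S h k a"
  shows "grid_value x S h b u \<omega> = ennreal (exp (- b * (real k * h)) * u a)"
proof -
  have "grid_value x S h b u \<omega> = (\<Sum>ka\<in>{(k, a)}. indicator (grid_hit x S h (fst ka) (snd ka)) \<omega>
     * ennreal (exp (- b * (real (fst ka) * h)) * u (snd ka)))"
    unfolding grid_value_def
  proof (rule nn_integral_count_space')
    fix ka :: "nat \<times> 'v" assume "ka \<notin> {(k, a)}"
    then have "\<omega> \<notin> grid_hit x S h (fst ka) (snd ka)"
      using grid_hit_disjoint[OF assms, of "fst ka" "snd ka"] by (auto simp: prod_eq_iff)
    then show "indicator (grid_hit x S h (fst ka) (snd ka)) \<omega>
        * ennreal (exp (- b * (real (fst ka) * h)) * u (snd ka)) = 0" by simp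
  qed auto
  then show ?thesis using assms by simp
qed

lemma grid_value_bound:
  assumes h: "0 < h" and b: "0 \<le> b" and u: "\<And>a. 0 \<le> u a" "\<And>a. u a \<le> B"
  shows "grid_value x S h b u \<omega> \<le> ennreal B"
proof (cases "\<exists>k a. \<omega> \<in> grid_hit x S h k a")
  case True
  then obtain k a where ka: "\<omega> \<in> grid_hit x S h k a" by blast
  have "exp (- b * (real k * h)) * u a \<le> 1 * B"
    using h b u by (intro mult_mono) auto
  then show ?thesis unfolding grid_value_hit[OF ka] by (intro ennreal_leI) simp
next
  case False
  then show ?thesis by (simp add: grid_value_def)
qed

lemma grid_value_measurable:
  assumes h: "0 < h"
  shows "grid_value x S h b u \<in> borel_measurable (P x)"
    and "(\<integral>\<^sup>+\<omega>. grid_value x S h b u \<omega> \<partial>P x)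
      = (\<integral>\<^sup>+ka. ennreal (measure (P x) (grid_hit x S h (fst ka) (snd ka))
          * (exp (- b * (real (fst ka) * h)) * u (snd ka))) \<partial>count_space UNIV)"
proof -
  interpret prob_space "P x" by (rule prob_space_P)
  let ?F = "\<lambda>ka \<omega>. indicator (grid_hit x S h (fst ka) (snd ka)) \<omega>
     * ennreal (exp (- b * (real (fst ka) * h)) * u (snd ka))"
  have F: "?F ka \<in> borel_measurable (P x)" for ka
    using grid_hit_sets[OF h] by simp
  show "grid_value x S h b u \<in> borel_measurable (P x)"
    unfolding grid_value_def[abs_def]
    by (rule nn_integral_count_space_swap(2)[OF countable_index sigma_finite_measure_axioms F])
  have "(\<integral>\<^sup>+\<omega>. grid_value x S h b u \<omega> \<partial>P x) = (\<integral>\<^sup>+ka. (\<integral>\<^sup>+\<omega>. ?F ka \<omega> \<partial>P x) \<partial>count_space UNIV)"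
    unfolding grid_value_def
    by (rule nn_integral_count_space_swap(1)[OF countable_index sigma_finite_measure_axioms F, symmetric])
  also have "\<dots> = (\<integral>\<^sup>+ka. ennreal (measure (P x) (grid_hit x S h (fst ka) (snd ka))
          * (exp (- b * (real (fst ka) * h)) * u (snd ka))) \<partial>count_space UNIV)"
    using grid_hit_sets[OF h]
    by (intro nn_integral_cong)
      (simp add: nn_integral_multc emeasure_eq_measure ennreal_mult'[symmetric])
  finally show "(\<integral>\<^sup>+\<omega>. grid_value x S h b u \<omega> \<partial>P x)
      = (\<integral>\<^sup>+ka. ennreal (measure (P x) (grid_hit x S h (fst ka) (snd ka))
          * (exp (- b * (real (fst ka) * h)) * u (snd ka))) \<partial>count_space UNIV)" .
qed

text \<open>A statement about a single path, with the first time attained. It covers hitting times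
  of finite sets as well as exit times, where \<open>S = - {z}\<close>.\<close>

definition first_entry :: "'v \<Rightarrow> 'v set \<Rightarrow> 'w \<Rightarrow> real \<Rightarrow> bool" where
  "first_entry x S \<omega> T \<longleftrightarrow> 0 \<le> T \<and> X x T \<omega> \<in> Some ` S \<and> (\<forall>t. 0 \<le> t \<and> t < T \<longrightarrow> X x t \<omega> \<notin> Some ` S)"

text \<open>Grid times before \<open>T\<close> miss \<open>S\<close> by definition of
  \<open>T\<close>; the first one after \<open>T\<close> finds the walk still in the state of entry,
  once the mesh is smaller than the holding time there.\<close>

lemma first_entry_grid:
  assumes fe: "first_entry x S \<omega> T" and \<omega>: "\<omega> \<in> space (P x)"
    and rc: "\<forall>t\<ge>0. X x t \<omega> \<noteq> None \<longrightarrow> (\<exists>\<epsilon>>0. \<forall>s\<in>{t..t + \<epsilon>}. X x s \<omega> = X x t \<omega>)"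
  shows "\<exists>\<epsilon>>0. \<forall>h. 0 < h \<and> h < \<epsilon> \<longrightarrow> (\<exists>k. T \<le> real k * h \<and> real k * h < T + h \<and>
      \<omega> \<in> grid_hit x S h k (the (X x T \<omega>)))"
proof -
  obtain a where a: "X x T \<omega> = Some a" "a \<in> S" and T: "0 \<le> T" using fe by (auto simp: first_entry_def)
  obtain e where e: "e > 0" "\<And>s. T \<le> s \<Longrightarrow> s \<le> T + e \<Longrightarrow> X x s \<omega> = Some a"
    using rc a T by (metis atLeastAtMost_iff option.distinct(1))
  show ?thesis
  proof (intro exI[of _ e] conjI allI impI)
    fix h :: real assume h: "0 < h \<and> h < e"
    \<comment> \<open>The first grid index at or after \<open>T\<close>; \<open>T = 0\<close> gives
      \<open>k = 0\<close>.\<close>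
    define k where "k = nat \<lceil>T / h\<rceil>"
    have k: "real k = of_int \<lceil>T / h\<rceil>" using T h by (simp add: k_def)
    have "T / h \<le> real k" "real k < T / h + 1" unfolding k by linarith+
    then have k1: "T \<le> real k * h" "real k * h < T + h"
      using h by (auto simp: field_simps)
    have "X x (real j * h) \<omega> \<notin> Some ` S" if "j < k" for j
    proof -
      have "real j < T / h" using that k by (metis less_ceiling_iff of_int_of_nat_eq of_nat_less_iff of_int_less_iff)
      then have "real j * h < T" using h by (simp add: field_simps)
      then show ?thesis using fe h by (auto simp: first_entry_def)
    qed
    then have "\<omega> \<in> grid_hit x S h k a"
      using e(2)[OF k1(1)] k1(2) h a \<omega> by (auto simp: grid_hit_def)
    then show "\<exists>k. T \<le> real k * h \<and> real k * h < T + h \<and> \<omega> \<in> grid_hit x S h k (the (X x T \<omega>))"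
      using k1 a by auto
  qed (rule e)
qed

abbreviation mesh :: "nat \<Rightarrow> real" where
  "mesh n \<equiv> 1 / real (Suc n)"

lemma mesh_tendsto: "mesh \<longlonglongrightarrow> 0"
  by (rule LIMSEQ_Suc[OF lim_const_over_n])

lemma grid_value_tendsto:
  assumes "AE \<omega> in P x. first_entry x S \<omega> (T \<omega>)"
  shows "AE \<omega> in P x. (\<lambda>n. grid_value x S (mesh n) b u \<omega>) \<longlonglongrightarrow> ennreal (exp (- b * T \<omega>) * u (the (X x (T \<omega>) \<omega>)))"
  using assms right_constant[of x] AE_space[of "P x"]
proof eventually_elim
  case (elim \<omega>)
  let ?a = "the (X x (T \<omega>) \<omega>)"
  from first_entry_grid[OF elim(1,3,2)] obtain e where e: "e > 0"
    "\<And>h. 0 < h \<Longrightarrow> h < e \<Longrightarrow> \<exists>k. T \<omega> \<le> real k * h \<and> real k * h < T \<omega> + h \<and> \<omega> \<in> grid_hit x S h k ?a"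
    by blast
  have "\<forall>\<^sub>F n in sequentially. mesh n < e" using mesh_tendsto e(1) by (rule order_tendstoD)
  then have "\<forall>\<^sub>F n in sequentially. \<exists>k. T \<omega> \<le> real k * mesh n \<and> real k * mesh n < T \<omega> + mesh n \<and> \<omega> \<in> grid_hit x S (mesh n) k ?a"
    by eventually_elim (rule e(2), simp_all)
  then obtain M where M: "\<And>n. n \<ge> M \<Longrightarrow> \<exists>k. T \<omega> \<le> real k * mesh n \<and> real k * mesh n < T \<omega> + mesh n \<and> \<omega> \<in> grid_hit x S (mesh n) k ?a"
    unfolding eventually_sequentially by blast
  then obtain k where k: "\<And>n. n \<ge> M \<Longrightarrow> T \<omega> \<le> real (k n) * mesh n"
    "\<And>n. n \<ge> M \<Longrightarrow> real (k n) * mesh n < T \<omega> + mesh n"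
    "\<And>n. n \<ge> M \<Longrightarrow> \<omega> \<in> grid_hit x S (mesh n) (k n) ?a"
    by metis
  have evM: "\<forall>\<^sub>F n in sequentially. n \<ge> M" by (rule eventually_ge_at_top)
  have "(\<lambda>n. real (k n) * mesh n) \<longlonglongrightarrow> T \<omega>"
  proof (rule tendsto_sandwich[of "\<lambda>_. T \<omega>" _ _ "\<lambda>n. T \<omega> + mesh n"])
    show "\<forall>\<^sub>F n in sequentially. T \<omega> \<le> real (k n) * mesh n" using evM by eventually_elim (rule k(1))
    show "\<forall>\<^sub>F n in sequentially. real (k n) * mesh n \<le> T \<omega> + mesh n"
      using evM by eventually_elim (rule less_imp_le[OF k(2)])
    show "(\<lambda>n. T \<omega> + mesh n) \<longlonglongrightarrow> T \<omega>" using tendsto_add[OF tendsto_const mesh_tendsto] by simp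
  qed simp
  then have "(\<lambda>n. ennreal (exp (- b * (real (k n) * mesh n)) * u ?a)) \<longlonglongrightarrow> ennreal (exp (- b * T \<omega>) * u ?a)"
    by (intro tendsto_intros)
  moreover have "\<forall>\<^sub>F n in sequentially. ennreal (exp (- b * (real (k n) * mesh n)) * u ?a) = grid_value x S (mesh n) b u \<omega>"
    using evM by eventually_elim (rule grid_value_hit[symmetric, OF k(3)])
  ultimately show ?case by (rule Lim_transform_eventually)
qed

text \<open>The value at the entry time is only almost everywhere equal to a measurable function,
  namely the limsup of the grid values. Dominated convergence is applied to that version.\<close>

lemma grid_value_limit:
  assumes fe: "AE \<omega> in P x. first_entry x S \<omega> (T \<omega>)" and b: "0 \<le> b"
    and u: "\<And>a. 0 \<le> u a" "\<And>a. u a \<le> B"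
  shows "(\<lambda>n. \<integral>\<^sup>+\<omega>. grid_value x S (mesh n) b u \<omega> \<partial>P x)
      \<longlonglongrightarrow> (\<integral>\<^sup>+\<omega>. ennreal (exp (- b * T \<omega>) * u (the (X x (T \<omega>) \<omega>))) \<partial>P x)"
    and "\<exists>g\<in>borel_measurable (P x). AE \<omega> in P x. ennreal (exp (- b * T \<omega>) * u (the (X x (T \<omega>) \<omega>))) = g \<omega>"
proof -
  interpret prob_space "P x" by (rule prob_space_P)
  define g where "g \<omega> = limsup (\<lambda>n. grid_value x S (mesh n) b u \<omega>)" for \<omega>
  have mesh: "0 < mesh n" for n by simp
  have m: "g \<in> borel_measurable (P x)"
    unfolding g_def[abs_def] by (intro borel_measurable_limsup grid_value_measurable(1) mesh)
  note lim = grid_value_tendsto[OF fe, of b u]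
  have eq: "AE \<omega> in P x. ennreal (exp (- b * T \<omega>) * u (the (X x (T \<omega>) \<omega>))) = g \<omega>"
    using lim by eventually_elim (simp add: g_def lim_imp_Limsup)
  then show "\<exists>g\<in>borel_measurable (P x). AE \<omega> in P x. ennreal (exp (- b * T \<omega>) * u (the (X x (T \<omega>) \<omega>))) = g \<omega>"
    using m by blast
  have "(\<lambda>n. \<integral>\<^sup>+\<omega>. grid_value x S (mesh n) b u \<omega> \<partial>P x) \<longlonglongrightarrow> (\<integral>\<^sup>+\<omega>. g \<omega> \<partial>P x)"
  proof (rule nn_integral_dominated_convergence[where w = "\<lambda>_. ennreal B"])
    show "AE \<omega> in P x. grid_value x S (mesh n) b u \<omega> \<le> ennreal B" for n
      by (rule AE_I2) (rule grid_value_bound[OF mesh b u])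
    show "AE \<omega> in P x. (\<lambda>n. grid_value x S (mesh n) b u \<omega>) \<longlonglongrightarrow> g \<omega>"
      using lim eq by eventually_elim simp
  qed (use m grid_value_measurable(1)[OF mesh] in \<open>auto simp: emeasure_space_1\<close>)
  also have "(\<integral>\<^sup>+\<omega>. g \<omega> \<partial>P x) = (\<integral>\<^sup>+\<omega>. ennreal (exp (- b * T \<omega>) * u (the (X x (T \<omega>) \<omega>))) \<partial>P x)"
    by (rule nn_integral_cong_AE) (use eq in auto)
  finally show "(\<lambda>n. \<integral>\<^sup>+\<omega>. grid_value x S (mesh n) b u \<omega> \<partial>P x)
      \<longlonglongrightarrow> (\<integral>\<^sup>+\<omega>. ennreal (exp (- b * T \<omega>) * u (the (X x (T \<omega>) \<omega>))) \<partial>P x)" .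
qed

text \<open>For a fine mesh, the first grid time after \<open>T\<close> comes before
  \<open>t\<close>.\<close>

lemma grid_avoid_eventually_not:
  assumes "AE \<omega> in P x. first_entry x S \<omega> (T \<omega>)"
  shows "AE \<omega> in P x. T \<omega> < t \<longrightarrow> (\<forall>\<^sub>F n in sequentially. \<omega> \<notin> grid_avoid x S (mesh n) t)"
  using assms right_constant[of x] AE_space[of "P x"]
proof eventually_elim
  case (elim \<omega>)
  show ?case
  proof
    assume Tt: "T \<omega> < t"
    from first_entry_grid[OF elim(1,3,2)] obtain e where e: "e > 0"
      "\<And>h. 0 < h \<Longrightarrow> h < e \<Longrightarrow> \<exists>k. T \<omega> \<le> real k * h \<and> real k * h < T \<omega> + h \<and> \<omega> \<in> grid_hit x S h k (the (X x (T \<omega>) \<omega>))"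
      by blast
    have "\<forall>\<^sub>F n in sequentially. mesh n < min e (t - T \<omega>)"
      using e(1) Tt by (intro order_tendstoD(2)[OF mesh_tendsto]) auto
    then show "\<forall>\<^sub>F n in sequentially. \<omega> \<notin> grid_avoid x S (mesh n) t"
    proof eventually_elim
      case (elim n)
      then obtain k where k: "real k * mesh n < T \<omega> + mesh n" "\<omega> \<in> grid_hit x S (mesh n) k (the (X x (T \<omega>) \<omega>))"
        using e(2)[of "mesh n"] by auto
      then have "real k * mesh n \<le> t" using elim by linarith
      moreover have "X x (real k * mesh n) \<omega> \<in> Some ` S" using k(2) by (auto simp: grid_hit_def)
      ultimately show ?case unfolding grid_avoid_def by blast
    qed
  qed
qed

text \<open>Complementary to the previous lemma: here the visit is known at the fixed time
  \<open>t\<close>, and local constancy on its left shows that the last grid time up to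
  \<open>t\<close> already sees it.\<close>

lemma grid_avoid_eventually_not':
  assumes t: "0 \<le> t" and y: "y \<in> S"
  shows "AE \<omega> in P x. X x t \<omega> = Some y \<longrightarrow> (\<forall>\<^sub>F n in sequentially. \<omega> \<notin> grid_avoid x S (mesh n) t)"
  using locally_constant_at[OF t, of x]
proof eventually_elim
  case (elim \<omega>)
  then obtain e where e: "e > 0" "\<And>s. 0 \<le> s \<Longrightarrow> \<bar>s - t\<bar> < e \<Longrightarrow> X x s \<omega> = X x t \<omega>" by blast
  show ?case
  proof
    assume Y: "X x t \<omega> = Some y"
    have "\<forall>\<^sub>F n in sequentially. mesh n < e" using mesh_tendsto e(1) by (rule order_tendstoD)
    then show "\<forall>\<^sub>F n in sequentially. \<omega> \<notin> grid_avoid x S (mesh n) t"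
    proof eventually_elim
      case (elim n)
      define h where "h = mesh n"
      have h0: "0 < h" "h < e" using elim by (auto simp: h_def)
      define k where "k = nat \<lfloor>t / h\<rfloor>"
      have k: "real k = of_int \<lfloor>t / h\<rfloor>" using t h0 by (simp add: k_def)
      have "real k \<le> t / h" "t / h < real k + 1" unfolding k by linarith+
      then have k1: "real k * h \<le> t" "t < real k * h + h"
        using h0 by (auto simp: field_simps)
      have "X x (real k * h) \<omega> = Some y"
        using e(2)[of "real k * h"] k1 h0 Y by (auto simp: abs_if)
      then show ?case using k1(1) y unfolding grid_avoid_def h_def by blast
    qed
  qed
qed

text \<open>Strong Markov inequality for the resolvent. \<open>G t\<close> bounds, in the limit of
  fine grids, the probability of being at \<open>y\<close> at time \<open>t\<close> before entering
  \<open>S\<close>: zero if \<open>y\<close> is in \<open>S\<close>, and the survival function of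
  the holding time for the exit from \<open>y\<close>.\<close>

lemma laplace_stopped:
  assumes l: "0 < l" and fe: "AE \<omega> in P x. first_entry x S \<omega> (T \<omega>)"
    and G: "bounded_measurable G B" "\<And>t. 0 \<le> t \<Longrightarrow> 0 \<le> G t"
    and rest: "\<And>t. 0 \<le> t \<Longrightarrow> (\<lambda>n. max (measure (P x) (grid_avoid x S (mesh n) t
      \<inter> at_state x t y) - G t) 0) \<longlonglongrightarrow> 0"
  shows "ennreal (R l x y) \<le> (\<integral>\<^sup>+\<omega>. ennreal (exp (- l * T \<omega>) * R l (the (X x (T \<omega>) \<omega>)) y) \<partial>P x)
    + ennreal (laplace l G)"
proof -
  have mesh: "0 < mesh n" for n by simp
  define e where "e n t = measure (P x) (grid_avoid x S (mesh n) t \<inter> at_state x t y)" for n t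
  \<comment> \<open>Only the excess over \<open>G\<close> has to vanish, so the positive part is
    taken; it is bounded by 1 and its transform tends to 0 by dominated convergence.\<close>
  define d where "d n t = max (e n t - G t) 0" for n t
  have ebm: "bounded_measurable (e n) 1" for n
    unfolding e_def[abs_def] by (rule grid_rest_bm[OF mesh])
  have ge: "0 \<le> e n t" "e n t \<le> 1" for n t
    unfolding e_def by (auto simp: prob_space.prob_le_1[OF prob_space_P])
  have dbm: "bounded_measurable (d n) 1" for n
    unfolding bounded_measurable_def
  proof
    have "(\<lambda>t. max (indicator {0..} t * e n t - indicator {0..} t * G t) 0) \<in> borel_measurable borel"
      using ebm[of n] G(1) unfolding bounded_measurable_def
      by (intro borel_measurable_max borel_measurable_diff) auto
    also have "(\<lambda>t. max (indicator {0..} t * e n t - indicator {0..} t * G t) 0) = (\<lambda>t. indicator {0..} t * d n t)"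
      by (auto simp: d_def fun_eq_iff split: split_indicator)
    finally show "(\<lambda>t. indicator {0..} t * d n t) \<in> borel_measurable borel" .
    show "\<forall>t\<ge>0. \<bar>d n t\<bar> \<le> 1" using ge G(2) by (auto simp: d_def max_def) (smt (verit))
  qed
  have "(\<lambda>n. laplace l (d n)) \<longlonglongrightarrow> (\<integral>t. 0 \<partial>(lborel :: real measure))"
    unfolding laplace_def
  proof (rule integral_dominated_convergence[where w = "\<lambda>t. indicator {0..} t * exp (- l * t)"])
    show "integrable lborel (\<lambda>t. indicator {0..} t * exp (- l * t) :: real)" by (rule integrable_exp[OF l])
    show "(\<lambda>t. indicator {0..} t * (exp (- l * t) * d n t)) \<in> borel_measurable lborel" for n
      using laplace_integrable[OF l dbm] by (rule borel_measurable_integrable)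
    show "AE t in lborel. (\<lambda>n. indicator {0..} t * (exp (- l * t) * d n t)) \<longlonglongrightarrow> 0"
    proof (rule AE_I2)
      fix t :: real
      show "(\<lambda>n. indicator {0..} t * (exp (- l * t) * d n t)) \<longlonglongrightarrow> 0"
      proof (cases "0 \<le> t")
        case True
        have "(\<lambda>n. d n t) \<longlonglongrightarrow> 0" using rest[OF True] unfolding d_def e_def .
        from tendsto_mult_right_zero[OF this, of "exp (- l * t)"] show ?thesis using True by simp
      qed simp
    qed
    show "AE t in lborel. norm (indicator {0..} t * (exp (- l * t) * d n t)) \<le> indicator {0..} t * exp (- l * t)" for n
      using dbm[of n] by (intro AE_I2) (auto simp: bounded_measurable_def abs_mult mult_left_le split: split_indicator)
  qed simp
  then have d0: "(\<lambda>n. laplace l (d n)) \<longlonglongrightarrow> 0" by simp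
  have "laplace l (e n) \<le> laplace l (d n) + laplace l G" for n
  proof -
    have "laplace l (e n) \<le> (\<integral>t. indicator {0..} t * (exp (- l * t) * d n t) + indicator {0..} t * (exp (- l * t) * G t) \<partial>lborel)"
      unfolding laplace_def
    proof (rule integral_mono)
      fix t :: real
      have "exp (- l * t) * e n t \<le> exp (- l * t) * (d n t + G t)"
        by (intro mult_left_mono) (auto simp: d_def)
      then show "indicator {0..} t * (exp (- l * t) * e n t)
          \<le> indicator {0..} t * (exp (- l * t) * d n t) + indicator {0..} t * (exp (- l * t) * G t)"
        by (auto simp: distrib_left split: split_indicator)
    qed (intro laplace_integrable[OF l ebm] Bochner_Integration.integrable_add laplace_integrable[OF l dbm] laplace_integrable[OF l G(1)])+
    also have "\<dots> = laplace l (d n) + laplace l G"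
      unfolding laplace_def by (rule Bochner_Integration.integral_add[OF laplace_integrable[OF l dbm] laplace_integrable[OF l G(1)]])
    finally show ?thesis .
  qed
  then have step: "ennreal (R l x y) \<le> (\<integral>\<^sup>+\<omega>. grid_value x S (mesh n) l (\<lambda>a. R l a y) \<omega> \<partial>P x)
      + ennreal (laplace l (d n) + laplace l G)" for n
    unfolding laplace_decomp[OF mesh l, of x y S n] grid_value_measurable(2)[OF mesh] e_def[abs_def]
    by (intro add_left_mono ennreal_leI)
  have "(\<lambda>n. (\<integral>\<^sup>+\<omega>. grid_value x S (mesh n) l (\<lambda>a. R l a y) \<omega> \<partial>P x) + ennreal (laplace l (d n) + laplace l G))
      \<longlonglongrightarrow> (\<integral>\<^sup>+\<omega>. ennreal (exp (- l * T \<omega>) * R l (the (X x (T \<omega>) \<omega>)) y) \<partial>P x) + ennreal (0 + laplace l G)"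
    by (intro tendsto_add tendsto_ennrealI grid_value_limit(1)[OF fe _ R_nonneg R_le[OF l]] d0 tendsto_const less_imp_le[OF l])
  from LIMSEQ_le_const[OF this, of "ennreal (R l x y)"] step show ?thesis by simp
qed

end

section \<open>Resolvent inequalities at hitting and exit times\<close>

lemma borel_measurable_completion_AE_eq:
  fixes f g :: "'a \<Rightarrow> 'b :: topological_space"
  assumes g: "g \<in> borel_measurable M" and eq: "AE x in M. f x = g x"
  shows "f \<in> borel_measurable (completion M)"
proof (rule measurableI)
  fix A :: "'b set" assume A: "A \<in> sets borel"
  have g': "g -` A \<inter> space M \<in> sets M" by (rule measurable_sets[OF g A])
  have "AE x in M. \<not> (f x \<in> A \<and> f x \<noteq> g x)" "AE x in M. \<not> (g x \<in> A \<and> f x \<noteq> g x)"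
    using eq by (eventually_elim, simp)+
  from this[THEN sets_completion_AE]
  have N: "{x\<in>space M. f x \<in> A \<and> f x \<noteq> g x} \<in> sets (completion M)"
    "{x\<in>space M. g x \<in> A \<and> f x \<noteq> g x} \<in> sets (completion M)"
    by (simp_all add: pred_def)
  have "f -` A \<inter> space (completion M) = ((g -` A \<inter> space M) - {x\<in>space M. g x \<in> A \<and> f x \<noteq> g x})
      \<union> {x\<in>space M. f x \<in> A \<and> f x \<noteq> g x}"
    by auto
  also have "\<dots> \<in> sets (completion M)" using N g' by (intro sets.Un sets.Diff) auto
  finally show "f -` A \<inter> space (completion M) \<in> sets (completion M)" .
qed simp

context reflected_walk_network
begin

text \<open>Since \<open>y\<close> is in \<open>A\<close>, no time is spent at \<open>y\<close>
  before \<open>A\<close> is hit, so \<open>laplace_stopped\<close> applies with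
  \<open>G = 0\<close>. The undiscounted expectation of the resolvent at the hitting place is then
  the minimal extension.\<close>

lemma resolvent_le_min_energy_ext:
  assumes l: "0 < l" and A: "finite A" "y \<in> A"
  shows "R l x y \<le> min_energy_ext E c A (\<lambda>z. R l z y) x"
proof -
  have A0: "A \<noteq> {}" using A by blast
  interpret prob_space "P x" by (rule prob_space_P)
  interpret C: prob_space "completion (P x)"
    by (rule prob_spaceI) (simp add: emeasure_space_1)
  define T where "T \<omega> = Inf (hitting_times (X x) A \<omega>)" for \<omega>
  let ?V = "\<lambda>\<omega>. R l (the (X x (T \<omega>) \<omega>)) y"
  have fe: "AE \<omega> in P x. first_entry x A \<omega> (T \<omega>)"
    using hitting_attained[OF A(1) A0, of x]
  proof eventually_elim
    case (elim \<omega>)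
    have "bdd_below (hitting_times (X x) A \<omega>)"
      by (rule bdd_belowI[of _ 0]) (simp add: hitting_times_def)
    then have "T \<omega> \<le> t" if "t \<in> hitting_times (X x) A \<omega>" for t
      unfolding T_def using that by (intro cInf_lower)
    then show ?case
      using elim unfolding first_entry_def T_def[symmetric] by (fastforce simp: hitting_times_def)
  qed
  have bm0: "bounded_measurable (\<lambda>t. 0) 0" by (simp add: bounded_measurable_def)
  have rest: "(\<lambda>n. max (measure (P x) (grid_avoid x A (mesh n) t
      \<inter> at_state x t y) - 0) 0) \<longlonglongrightarrow> 0" if t: "0 \<le> t" for t
  proof -
    have "(\<lambda>n. measure (P x) (grid_avoid x A (mesh n) t \<inter> at_state x t y)) \<longlonglongrightarrow> 0"
    proof (rule measure_tendsto_AE_zero[OF prob_space_P])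
      show "grid_avoid x A (mesh n) t \<inter> at_state x t y \<in> sets (P x)" for n
        using grid_avoid_sets[of "mesh n" x A t] X_event_eq[OF t, of x "Some y"] by auto
      show "AE \<omega> in P x. \<forall>\<^sub>F n in sequentially. \<omega> \<notin> grid_avoid x A (mesh n) t \<inter> at_state x t y"
        using grid_avoid_eventually_not'[OF t A(2), of x]
      proof eventually_elim
        case (elim \<omega>)
        show ?case
        proof (cases "X x t \<omega> = Some y")
          case True
          with elim have "\<forall>\<^sub>F n in sequentially. \<omega> \<notin> grid_avoid x A (mesh n) t" by blast
          then show ?thesis by eventually_elim blast
        qed simp
      qed
    qed
    then show ?thesis by (simp add: max_absorb1)
  qed
  have "ennreal (R l x y) \<le> (\<integral>\<^sup>+\<omega>. ennreal (exp (- l * T \<omega>) * ?V \<omega>) \<partial>P x) + ennreal (laplace l (\<lambda>t. 0))"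
    by (rule laplace_stopped[OF l fe bm0 _ rest]) simp
  also have "laplace l (\<lambda>t. 0) = 0" by (simp add: laplace_def)
  \<comment> \<open>The discount up to the hitting time is dropped here, because
    \<open>hitting_value\<close> speaks of undiscounted expectations; from here on only an
    inequality is left.\<close>
  also have "(\<integral>\<^sup>+\<omega>. ennreal (exp (- l * T \<omega>) * ?V \<omega>) \<partial>P x) \<le> (\<integral>\<^sup>+\<omega>. ennreal (?V \<omega>) \<partial>P x)"
  proof (rule nn_integral_mono_AE)
    show "AE \<omega> in P x. ennreal (exp (- l * T \<omega>) * ?V \<omega>) \<le> ennreal (?V \<omega>)"
      using fe
    proof eventually_elim
      case (elim \<omega>)
      then have "exp (- l * T \<omega>) * ?V \<omega> \<le> 1 * ?V \<omega>"
        using l R_nonneg by (intro mult_right_mono) (auto simp: first_entry_def)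
      then show ?case by (intro ennreal_leI) simp
    qed
  qed
  finally have le: "ennreal (R l x y) \<le> (\<integral>\<^sup>+\<omega>. ennreal (?V \<omega>) \<partial>P x)" by simp
  \<comment> \<open>Discount rate 0 is used to obtain measurability of the undiscounted value
    \<open>?V\<close>.\<close>
  obtain g where g: "g \<in> borel_measurable (P x)" "AE \<omega> in P x. ennreal (exp (- 0 * T \<omega>) * ?V \<omega>) = g \<omega>"
    using grid_value_limit(2)[OF fe order_refl, of "\<lambda>a. R l a y" "1 / l"] R_nonneg R_le[OF l] by blast
  have "AE \<omega> in P x. ?V \<omega> = enn2real (g \<omega>)"
    using g(2) by eventually_elim (auto simp: R_nonneg dest: sym)
  then have Vm: "?V \<in> borel_measurable (completion (P x))"
    by (rule borel_measurable_completion_AE_eq[rotated]) (use g(1) in simp)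
  have Vi: "integrable (completion (P x)) ?V"
    by (rule C.integrable_const_bound[of _ "1 / l"]) (use Vm R_nonneg R_le[OF l] in auto)
  have "(\<integral>\<^sup>+\<omega>. ennreal (?V \<omega>) \<partial>P x) = (\<integral>\<^sup>+\<omega>. ennreal (?V \<omega>) \<partial>completion (P x))"
    by (simp add: nn_integral_completion)
  also have "\<dots> = ennreal (\<integral>\<omega>. ?V \<omega> \<partial>completion (P x))"
    by (rule nn_integral_eq_integral[OF Vi]) (simp add: R_nonneg)
  also have "(\<integral>\<omega>. ?V \<omega> \<partial>completion (P x)) = min_energy_ext E c A (\<lambda>z. R l z y) x"
    using hitting_value[OF A(1) A0, of "\<lambda>z. R l z y" x] by (simp add: T_def)
  finally have "ennreal (R l x y) \<le> ennreal (min_energy_ext E c A (\<lambda>z. R l z y) x)" using le by simp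
  moreover have "0 \<le> min_energy_ext E c A (\<lambda>z. R l z y) x"
    using hitting_value[OF A(1) A0, of "\<lambda>z. R l z y" x] R_nonneg by simp
  ultimately show ?thesis by simp
qed

definition exit_time :: "'v \<Rightarrow> 'w \<Rightarrow> real" where
  "exit_time z \<omega> = Inf (exit_times (X z) z \<omega>)"

definition exit_state :: "'v \<Rightarrow> 'w \<Rightarrow> 'v option" where
  "exit_state z \<omega> = X z (exit_time z \<omega>) \<omega>"

lemma prob_space_completion: "prob_space (completion (P z))"
  using prob_space.emeasure_space_1[OF prob_space_P[of z]] by (intro prob_spaceI) simp

lemma exit_state_measurable: "exit_state z \<in> measurable (completion (P z)) (count_space UNIV)"
  and exit_time_measurable: "exit_time z \<in> borel_measurable (completion (P z))"
  using exit_indep[of z] unfolding independent_rvs_def exit_state_def[abs_def] exit_time_def[abs_def] by auto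

lemma exit_state_sets: "{\<omega>\<in>space (P z). exit_state z \<omega> \<in> B} \<in> sets (completion (P z))"
  using measurable_sets[OF exit_state_measurable[of z], of B] by (simp add: vimage_def Int_def conj_commute)

text \<open>\<open>exit_position\<close> concerns neighbours only, but their probabilities already
  sum to 1. So the walk almost surely jumps to a neighbour, never directly to infinity, and all
  other states get probability 0.\<close>

lemma exit_state_prob:
  "measure (completion (P z)) {\<omega>\<in>space (P z). exit_state z \<omega> = Some x} = cond z x / tc z"
  and exit_state_vertex: "AE \<omega> in P z. exit_state z \<omega> \<in> Some ` nbrs E z"
proof -
  interpret C: prob_space "completion (P z)" by (rule prob_space_completion)
  let ?D = "\<lambda>x. {\<omega>\<in>space (P z). exit_state z \<omega> = Some x}"
  have D: "?D x \<in> sets (completion (P z))" for x using exit_state_sets[of z "{Some x}"] by simp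
  have nb: "measure (completion (P z)) (?D x) = cond z x / tc z" if "x \<in> nbrs E z" for x
    using exit_position[OF that] that by (simp add: exit_state_def exit_time_def cond_def nbrs_def)
  have hs: "((\<lambda>x. cond z x / tc z) has_sum 1) UNIV"
    using has_sum_cmult_right[OF has_sum_infsum[OF cond_summable[of z]], of "1 / tc z"] tc_pos[of z]
    by (simp add: tc_eq[symmetric])
  let ?U = "\<Union>x\<in>nbrs E z. ?D x"
  have Us: "?U \<in> sets (completion (P z))"
    by (intro sets.countable_UN'' countable_vertex_set D)
  have "emeasure (completion (P z)) ?U = (\<integral>\<^sup>+x. emeasure (completion (P z)) (?D x) \<partial>count_space (nbrs E z))"
    by (rule emeasure_UN_countable[OF D countable_vertex_set]) (auto simp: disjoint_family_on_def)
  also have "\<dots> = (\<integral>\<^sup>+x. ennreal (cond z x / tc z) \<partial>count_space (nbrs E z))"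
    by (intro nn_integral_cong) (simp add: C.emeasure_eq_measure nb)
  also have "\<dots> = (\<integral>\<^sup>+x. ennreal (cond z x / tc z) * indicator (nbrs E z) x \<partial>count_space UNIV)"
    by (subst nn_integral_count_space_indicator) auto
  also have "\<dots> = (\<integral>\<^sup>+x. ennreal (cond z x / tc z) \<partial>count_space UNIV)"
    by (intro nn_integral_cong) (auto simp: cond_def nbrs_def split: split_indicator)
  also have "\<dots> = ennreal 1"
    by (rule nn_integral_of_has_sum[OF hs]) (use tc_pos[of z] in \<open>simp add: less_imp_le\<close>)
  finally have "C.prob ?U = 1" by (simp add: C.emeasure_eq_measure)
  then have ae: "AE \<omega> in completion (P z). \<omega> \<in> ?U"
    using C.prob_eq_1[OF Us] by simp
  then have ae': "AE \<omega> in completion (P z). exit_state z \<omega> \<in> Some ` nbrs E z"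
    by eventually_elim auto
  \<comment> \<open>A null set of the completion is covered by a null set of \<open>P z\<close>;
    this brings the statement back to the original measure.\<close>
  have "{\<omega>\<in>space (P z). exit_state z \<omega> \<notin> Some ` nbrs E z} \<in> null_sets (completion (P z))"
    using ae' exit_state_sets[of z "- (Some ` nbrs E z)"]
    by (subst (asm) AE_iff_null) auto
  then obtain N where "N \<in> null_sets (P z)" "{\<omega>\<in>space (P z). exit_state z \<omega> \<notin> Some ` nbrs E z} \<subseteq> N"
    unfolding null_sets_completion_iff2 by blast
  then show "AE \<omega> in P z. exit_state z \<omega> \<in> Some ` nbrs E z"
    by (intro AE_I'[of N]) auto
  show "measure (completion (P z)) (?D x) = cond z x / tc z"
  proof (cases "x \<in> nbrs E z")
    case False
    then have "AE \<omega> in completion (P z). \<omega> \<notin> ?D x"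
      using ae' by (auto elim!: eventually_mono)
    then have "C.prob (?D x) = 0" using C.prob_eq_0[OF D[of x]] by simp
    then show ?thesis using False by (simp add: cond_def nbrs_def)
  qed (rule nb)
qed

text \<open>\<open>exit_times\<close> would also admit leaving \<open>z\<close> for
  \<open>None\<close>; that the exit state is a vertex makes the exit an entry into
  \<open>- {z}\<close>. Time 0 is excluded from \<open>exit_times\<close> and is handled by
  \<open>start\<close>.\<close>

lemma exit_first_entry: "AE \<omega> in P z. first_entry z (- {z}) \<omega> (exit_time z \<omega>)"
  using exit_attained[of z] exit_state_vertex[of z] start[of z]
proof eventually_elim
  case (elim \<omega>)
  have bdd: "bdd_below (exit_times (X z) z \<omega>)"
    by (rule bdd_belowI[of _ 0]) (simp add: exit_times_def)
  have T: "exit_time z \<omega> \<in> exit_times (X z) z \<omega>" using elim(1) by (simp add: exit_time_def)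
  have "X z t \<omega> = Some z" if "0 \<le> t" "t < exit_time z \<omega>" for t
  proof (rule ccontr)
    assume ne: "X z t \<omega> \<noteq> Some z"
    then have "0 < t" using that(1) elim(3) by (cases "t = 0") auto
    then have "t \<in> exit_times (X z) z \<omega>" using ne by (simp add: exit_times_def)
    then have "exit_time z \<omega> \<le> t" unfolding exit_time_def by (rule cInf_lower[OF _ bdd])
    then show False using that(2) by simp
  qed
  moreover have "X z (exit_time z \<omega>) \<omega> \<in> Some ` (- {z})"
    using T elim(2) unfolding exit_state_def exit_times_def by auto
  ultimately show ?case using T by (auto simp: first_entry_def exit_times_def)
qed

lemma expectation_exit_state:
  assumes u: "\<And>a. 0 \<le> u a" "\<And>a. u a \<le> B"
  shows "(\<integral>\<omega>. u (the (exit_state z \<omega>)) \<partial>completion (P z)) = (\<Sum>\<^sub>\<infinity>x. cond z x / tc z * u x)"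
proof -
  interpret C: prob_space "completion (P z)" by (rule prob_space_completion)
  let ?D = "\<lambda>x. {\<omega>\<in>space (P z). exit_state z \<omega> = Some x}"
  have D: "?D x \<in> sets (completion (P z))" for x using exit_state_sets[of z "{Some x}"] by simp
  have um: "(\<lambda>\<omega>. u (the (exit_state z \<omega>))) \<in> borel_measurable (completion (P z))"
    by (rule measurable_compose[OF exit_state_measurable]) simp
  have ui: "integrable (completion (P z)) (\<lambda>\<omega>. u (the (exit_state z \<omega>)))"
    by (rule C.integrable_const_bound[of _ B]) (use um u in auto)
  have s: "(\<lambda>x. cond z x / tc z * u x) summable_on UNIV"
  proof (rule summable_real_bound)
    show "(\<lambda>x. (1 / tc z * B) * cond z x) summable_on UNIV"
      by (rule summable_on_cmult_right[OF cond_summable])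
    fix x
    have "cond z x / tc z * u x \<le> cond z x / tc z * B"
      using u(2)[of x] tc_pos[of z] by (intro mult_left_mono) (auto simp: less_imp_le)
    then show "\<bar>cond z x / tc z * u x\<bar> \<le> (1 / tc z * B) * cond z x"
      using u(1)[of x] tc_pos[of z] by (simp add: abs_mult mult_ac)
  qed
  have t0: "0 \<le> cond z x / tc z" for x using tc_pos[of z] by (simp add: less_imp_le)
  have "ennreal (\<integral>\<omega>. u (the (exit_state z \<omega>)) \<partial>completion (P z))
      = (\<integral>\<^sup>+\<omega>. ennreal (u (the (exit_state z \<omega>))) \<partial>completion (P z))"
    by (rule nn_integral_eq_integral[OF ui, symmetric]) (simp add: u)
  also have "\<dots> = (\<integral>\<^sup>+\<omega>. (\<integral>\<^sup>+x. indicator (?D x) \<omega> * ennreal (u x) \<partial>count_space UNIV) \<partial>completion (P z))"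
  proof (rule nn_integral_cong_AE)
    show "AE \<omega> in completion (P z). ennreal (u (the (exit_state z \<omega>)))
        = (\<integral>\<^sup>+x. indicator (?D x) \<omega> * ennreal (u x) \<partial>count_space UNIV)"
      using AE_completion[OF exit_state_vertex[of z]] AE_space[of "completion (P z)"]
    proof eventually_elim
      case (elim \<omega>)
      then obtain a where a: "exit_state z \<omega> = Some a" by auto
      then have mem: "\<omega> \<in> ?D x \<longleftrightarrow> x = a" for x using elim(2) by auto
      have "(\<integral>\<^sup>+x. indicator (?D x) \<omega> * ennreal (u x) \<partial>count_space UNIV)
          = (\<Sum>x\<in>{a}. indicator (?D x) \<omega> * ennreal (u x))"
        by (rule nn_integral_count_space') (auto simp only: mem indicator_def singleton_iff finite.intros of_bool_def if_False mult_zero_left)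
      also have "\<dots> = ennreal (u a)" by (simp only: sum.insert finite.emptyI empty_iff sum.empty indicator_def mem of_bool_def if_True mult_1_left add_0_right simp_thms)
      finally show ?case by (simp only: a option.sel)
    qed
  qed
  also have "\<dots> = (\<integral>\<^sup>+x. (\<integral>\<^sup>+\<omega>. indicator (?D x) \<omega> * ennreal (u x) \<partial>completion (P z)) \<partial>count_space UNIV)"
    by (rule nn_integral_count_space_swap(1)[OF countable_V C.sigma_finite_measure_axioms, symmetric])
      (use D in simp)
  also have "\<dots> = (\<integral>\<^sup>+x. ennreal (cond z x / tc z * u x) \<partial>count_space UNIV)"
  proof (rule nn_integral_cong)
    fix x
    have "(\<integral>\<^sup>+\<omega>. indicator (?D x) \<omega> * ennreal (u x) \<partial>completion (P z))
        = emeasure (completion (P z)) (?D x) * ennreal (u x)"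
      using D[of x] nn_integral_multc[of "indicator (?D x)" "completion (P z)" "ennreal (u x)"]
        nn_integral_indicator[OF D[of x]] by simp
    also have "\<dots> = ennreal (cond z x / tc z * u x)"
      unfolding C.emeasure_eq_measure exit_state_prob by (rule ennreal_mult'[OF t0, symmetric])
    finally show "(\<integral>\<^sup>+\<omega>. indicator (?D x) \<omega> * ennreal (u x) \<partial>completion (P z))
        = ennreal (cond z x / tc z * u x)" .
  qed
  also have "\<dots> = ennreal (\<Sum>\<^sub>\<infinity>x. cond z x / tc z * u x)"
    by (rule nn_integral_of_has_sum[OF has_sum_infsum[OF s]]) (intro mult_nonneg_nonneg t0 u)
  finally have "ennreal (\<integral>\<omega>. u (the (exit_state z \<omega>)) \<partial>completion (P z)) = ennreal (\<Sum>\<^sub>\<infinity>x. cond z x / tc z * u x)" .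
  moreover have "0 \<le> (\<Sum>\<^sub>\<infinity>x. cond z x / tc z * u x)"
    by (intro infsum_nonneg mult_nonneg_nonneg t0 u)
  moreover have "0 \<le> (\<integral>\<omega>. u (the (exit_state z \<omega>)) \<partial>completion (P z))"
    by (rule Bochner_Integration.integral_nonneg) (simp add: u)
  ultimately show ?thesis by (simp only: ennreal_inj)
qed

lemma expectation_exit_time:
  assumes l: "0 < l"
  shows "(\<integral>\<omega>. exp (- l * exit_time z \<omega>) \<partial>completion (P z)) = w z / (w z + l)"
proof -
  have wl: "0 < w z + l" using w_pos[of z] l by simp
  have "(\<integral>\<omega>. exp (- l * exit_time z \<omega>) \<partial>completion (P z))
      = (\<integral>t. exponential_density (w z) t * exp (- l * t) \<partial>lborel)"
    unfolding exit_time_def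
    by (rule distributed_integral[OF exit_exponential, symmetric])
      (use w_pos[of z] in \<open>auto intro: exponential_density_nonneg\<close>)
  also have "\<dots> = (\<integral>t. w z * (indicator {0..} t * (exp (- (w z + l) * t) * 1)) \<partial>lborel)"
  proof (rule Bochner_Integration.integral_cong[OF refl])
    fix t :: real
    have "exp (- t * w z) * exp (- l * t) = exp (- (w z + l) * t)"
      unfolding exp_add[symmetric] by (rule arg_cong[where f = exp]) (simp add: algebra_simps)
    then show "exponential_density (w z) t * exp (- l * t)
        = w z * (indicator {0..} t * (exp (- (w z + l) * t) * 1))"
      by (simp only: exponential_density_def) (simp split: split_indicator)
  qed
  also have "\<dots> = w z * laplace (w z + l) (\<lambda>t. 1)" by (simp add: laplace_def)
  also have "\<dots> = w z / (w z + l)" by (simp add: laplace_const[OF wl])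
  finally show ?thesis .
qed

lemma expectation_exit:
  assumes l: "0 < l" and u: "\<And>a. 0 \<le> u a" "\<And>a. u a \<le> B"
  shows "(\<integral>\<^sup>+\<omega>. ennreal (exp (- l * exit_time z \<omega>) * u (the (exit_state z \<omega>))) \<partial>P z)
    = ennreal (w z / (w z + l) * (\<Sum>\<^sub>\<infinity>x. cond z x / tc z * u x))"
proof -
  let ?M = "completion (P z)"
  interpret C: prob_space ?M by (rule prob_space_completion)
  let ?f = "\<lambda>\<omega>. exp (- l * exit_time z \<omega>)"
  let ?g = "\<lambda>\<omega>. u (the (exit_state z \<omega>))"
  have fm: "?f \<in> borel_measurable ?M" using exit_time_measurable[of z] by measurable
  have gm: "?g \<in> borel_measurable ?M"
    by (rule measurable_compose[OF exit_state_measurable]) simp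
  have "AE \<omega> in ?M. 0 \<le> exit_time z \<omega>"
    using AE_completion[OF exit_first_entry[of z]] by eventually_elim (simp add: first_entry_def)
  then have f1: "AE \<omega> in ?M. norm (?f \<omega>) \<le> 1"
    by eventually_elim (use l in simp)
  have fi: "integrable ?M ?f" by (rule C.integrable_const_bound[OF f1 fm])
  have gi: "integrable ?M ?g" by (rule C.integrable_const_bound[of _ B]) (use gm u in auto)
  \<comment> \<open>Independence is inherited by functions of the two variables, as these generate
    smaller families of events.\<close>
  have ind: "C.indep_var borel ?f borel ?g"
  proof -
    have i: "C.indep_set {exit_time z -` A \<inter> space ?M |A. A \<in> sets borel} {exit_state z -` A \<inter> space ?M |A. A \<in> sets (count_space UNIV)}"
      using exit_indep[of z] unfolding independent_rvs_def exit_state_def[abs_def] exit_time_def[abs_def] by auto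
    have sub1: "{?f -` A \<inter> space ?M |A. A \<in> sets borel} \<subseteq> {exit_time z -` A \<inter> space ?M |A. A \<in> sets borel}"
    proof
      fix D assume "D \<in> {?f -` A \<inter> space ?M |A. A \<in> sets borel}"
      then obtain A where A: "A \<in> sets borel" "D = ?f -` A \<inter> space ?M" by blast
      have "(\<lambda>t. exp (- l * t)) -` A \<inter> space borel \<in> sets (borel :: real measure)"
        by (rule measurable_sets[OF _ A(1)]) measurable
      then show "D \<in> {exit_time z -` A \<inter> space ?M |A. A \<in> sets borel}"
        using A(2) by (intro CollectI exI[of _ "(\<lambda>t. exp (- l * t)) -` A"]) auto
    qed
    have sub2: "{?g -` A \<inter> space ?M |A. A \<in> sets borel} \<subseteq> {exit_state z -` A \<inter> space ?M |A. A \<in> sets (count_space UNIV)}"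
    proof
      fix D assume "D \<in> {?g -` A \<inter> space ?M |A. A \<in> sets borel}"
      then obtain A where A: "D = ?g -` A \<inter> space ?M" by blast
      show "D \<in> {exit_state z -` A \<inter> space ?M |A. A \<in> sets (count_space UNIV)}"
        unfolding A by (intro CollectI exI[of _ "(\<lambda>s. u (the s)) -` A"]) auto
    qed
    \<comment> \<open>Preimages of Borel sets form a sigma-algebra already, which removes
      \<open>sigma_sets\<close> from the characterisation of independence.\<close>
    have sig: "sigma_sets (space ?M) {h -` A \<inter> space ?M |A. A \<in> sets borel} = {h -` A \<inter> space ?M |A. A \<in> sets borel}"
      for h :: "'w \<Rightarrow> real"
      using sigma_algebra.sigma_sets_eq[OF sets.sigma_algebra_axioms, of "vimage_algebra (space ?M) h borel"]
      by (simp add: sets_vimage_algebra2)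
    show ?thesis
      unfolding C.indep_var_eq sig
    proof (intro conjI fm gm)
      show "C.indep_set {?f -` A \<inter> space ?M |A. A \<in> sets borel} {?g -` A \<inter> space ?M |A. A \<in> sets borel}"
        unfolding C.indep_set_def
        by (rule C.indep_sets_mono_sets[OF i[unfolded C.indep_set_def]]) (use sub1 sub2 in \<open>simp split: bool.split\<close>)
    qed
  qed
  have "(\<integral>\<^sup>+\<omega>. ennreal (?f \<omega> * ?g \<omega>) \<partial>P z) = (\<integral>\<^sup>+\<omega>. ennreal (?f \<omega> * ?g \<omega>) \<partial>?M)"
    by (simp add: nn_integral_completion)
  also have "\<dots> = ennreal (\<integral>\<omega>. ?f \<omega> * ?g \<omega> \<partial>?M)"
    by (rule nn_integral_eq_integral[OF C.indep_var_integrable[OF ind fi gi]]) (simp add: u)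
  also have "(\<integral>\<omega>. ?f \<omega> * ?g \<omega> \<partial>?M) = integral\<^sup>L ?M ?f * integral\<^sup>L ?M ?g"
    by (rule C.indep_var_lebesgue_integral[OF ind fi gi])
  also have "\<dots> = w z / (w z + l) * (\<Sum>\<^sub>\<infinity>x. cond z x / tc z * u x)"
    unfolding expectation_exit_time[OF l] expectation_exit_state[where u = u and B = B, OF u] ..
  finally show ?thesis .
qed

lemma exit_time_tail:
  assumes "0 \<le> t"
  shows "measure (completion (P z)) {\<omega>\<in>space (P z). t \<le> exit_time z \<omega>} \<le> exp (- w z * t)"
proof (cases "t = 0")
  case True
  then show ?thesis by (simp add: prob_space.prob_le_1[OF prob_space_completion])
next
  case False
  interpret C: prob_space "completion (P z)" by (rule prob_space_completion)
  \<comment> \<open>The exponential law is available for the strict event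
    \<open>s < exit_time z\<close>; the weak one at \<open>t\<close> lies in all of these with
    \<open>s < t\<close>, and \<open>s\<close> then increases to \<open>t\<close>.\<close>
  have le: "C.prob {\<omega>\<in>space (P z). t \<le> exit_time z \<omega>} \<le> exp (- w z * s)" if "0 < s" "s < t" for s
  proof -
    have s: "{\<omega>\<in>space (P z). s < exit_time z \<omega>} \<in> sets (completion (P z))"
      using measurable_sets[OF exit_time_measurable[of z], of "{s<..}"] by (simp add: vimage_def Int_def conj_commute)
    have "C.prob {\<omega>\<in>space (P z). t \<le> exit_time z \<omega>} \<le> C.prob {\<omega>\<in>space (P z). s < exit_time z \<omega>}"
      using that s by (intro C.finite_measure_mono) auto
    also have "\<dots> = exp (- s * w z)"
      using C.exponential_distributedD_gt[OF exit_exponential[of z], of s] that w_pos[of z]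
      by (simp add: exit_time_def)
    finally show ?thesis by (simp add: mult.commute)
  qed
  have t: "0 < t" using assms False by simp
  have "((\<lambda>s. exp (- w z * s)) \<longlongrightarrow> exp (- w z * t)) (at_left t)"
    by (intro tendsto_intros)
  then show ?thesis
  proof (rule tendsto_lowerbound)
    show "\<forall>\<^sub>F s in at_left t. C.prob {\<omega>\<in>space (P z). t \<le> exit_time z \<omega>} \<le> exp (- w z * s)"
      using eventually_at_left_real[OF t] by eventually_elim (rule le, auto)
  qed simp
qed

text \<open>First-step analysis at \<open>z\<close>. Until the exit the walk sits at
  \<open>z\<close>, so the part before the jump contributes the transform of the survival function
  if \<open>y = z\<close> and nothing otherwise; at the jump, time and place are
  independent.\<close>

lemma exit_inequality:
  assumes l: "0 < l"
  shows "(w z + l) * R l z y \<le> w z * (\<Sum>\<^sub>\<infinity>x. cond z x / tc z * R l x y) + delta y z"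
proof -
  have wl: "0 < w z + l" using w_pos[of z] l by simp
  interpret prob_space "P z" by (rule prob_space_P)
  interpret C: prob_space "completion (P z)" by (rule prob_space_completion)
  define G where "G t = delta y z * exp (- w z * t)" for t :: real
  have G0: "0 \<le> G t" for t by (simp add: G_def delta_def)
  have Gbm: "bounded_measurable G 1"
  proof (rule bounded_measurable_continuous)
    show "continuous_on {0..} G" unfolding G_def by (intro continuous_intros)
    show "\<bar>G t\<bar> \<le> 1" if "0 \<le> t" for t
      using mult_nonneg_nonneg[OF less_imp_le[OF w_pos[of z]] that] by (auto simp: G_def delta_def)
  qed
  have lG: "laplace l G = delta y z / (w z + l)"
  proof -
    have "laplace l G = (\<integral>t. delta y z * (indicator {0..} t * (exp (- (w z + l) * t) * 1)) \<partial>lborel)"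
      unfolding laplace_def G_def
    proof (rule Bochner_Integration.integral_cong[OF refl])
      fix t :: real
      have "exp (- l * t) * exp (- w z * t) = exp (- (w z + l) * t)"
        unfolding exp_add[symmetric] by (rule arg_cong[where f = exp]) (simp add: algebra_simps)
      then show "indicator {0..} t * (exp (- l * t) * (delta y z * exp (- w z * t)))
          = delta y z * (indicator {0..} t * (exp (- (w z + l) * t) * 1))"
        by (simp only: mult.left_commute mult_1_right)
    qed
    also have "\<dots> = delta y z * laplace (w z + l) (\<lambda>t. 1)" by (simp add: laplace_def)
    finally show ?thesis by (simp add: laplace_const[OF wl])
  qed
  let ?S = "- {z}"
  let ?e = "\<lambda>n t. measure (P z) (grid_avoid z ?S (mesh n) t \<inter> at_state z t y)"
  have rest: "(\<lambda>n. max (?e n t - G t) 0) \<longlonglongrightarrow> 0" if t: "0 \<le> t" for t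
  proof (cases "y = z")
    case False
    have "(\<lambda>n. ?e n t) \<longlonglongrightarrow> 0"
    proof (rule measure_tendsto_AE_zero[OF prob_space_P])
      show "grid_avoid z ?S (mesh n) t \<inter> at_state z t y \<in> sets (P z)" for n
        using grid_avoid_sets[of "mesh n" z ?S t] X_event_eq[OF t, of z "Some y"] by auto
      have "y \<in> ?S" using False by simp
      from grid_avoid_eventually_not'[OF t this, of z]
      show "AE \<omega> in P z. \<forall>\<^sub>F n in sequentially. \<omega> \<notin> grid_avoid z ?S (mesh n) t \<inter> at_state z t y"
      proof eventually_elim
        case (elim \<omega>)
        show ?case
        proof (cases "X z t \<omega> = Some y")
          case True
          with elim have "\<forall>\<^sub>F n in sequentially. \<omega> \<notin> grid_avoid z ?S (mesh n) t" by blast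
          then show ?thesis by eventually_elim blast
        qed simp
      qed
    qed
    moreover have "G t = 0" using False by (simp add: G_def delta_def)
    ultimately show ?thesis by (simp add: max_absorb1)
  next
    case True
    let ?L = "{\<omega>\<in>space (P z). exit_time z \<omega> < t}"
    let ?H = "{\<omega>\<in>space (P z). t \<le> exit_time z \<omega>}"
    have L: "?L \<in> sets (completion (P z))" and H: "?H \<in> sets (completion (P z))"
      using measurable_sets[OF exit_time_measurable[of z], of "{..<t}"]
        measurable_sets[OF exit_time_measurable[of z], of "{t..}"]
      by (simp_all add: vimage_def Int_def conj_commute)
    have A: "grid_avoid z ?S (mesh n) t \<in> sets (P z)" for n by (rule grid_avoid_sets) simp
    have lim: "(\<lambda>n. C.prob (grid_avoid z ?S (mesh n) t \<inter> ?L)) \<longlonglongrightarrow> 0"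
    proof (rule measure_tendsto_AE_zero[OF prob_space_completion])
      show "grid_avoid z ?S (mesh n) t \<inter> ?L \<in> sets (completion (P z))" for n
        using A[of n] L by auto
      show "AE \<omega> in completion (P z). \<forall>\<^sub>F n in sequentially. \<omega> \<notin> grid_avoid z ?S (mesh n) t \<inter> ?L"
        using AE_completion[OF grid_avoid_eventually_not[OF exit_first_entry[of z], of t]]
      proof eventually_elim
        case (elim \<omega>)
        show ?case
        proof (cases "exit_time z \<omega> < t")
          case True
          with elim have "\<forall>\<^sub>F n in sequentially. \<omega> \<notin> grid_avoid z ?S (mesh n) t" by blast
          then show ?thesis by eventually_elim blast
        qed simp
      qed
    qed
    \<comment> \<open>Paths avoiding \<open>- {z}\<close> on the grid up to \<open>t\<close> either
      left \<open>z\<close> before \<open>t\<close>, an event that disappears in the limit, or leave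
      at \<open>t\<close> or later, with probability at most \<open>G t\<close>.\<close>
    have "?e n t - G t \<le> C.prob (grid_avoid z ?S (mesh n) t \<inter> ?L)" for n
    proof -
      have "?e n t \<le> measure (P z) (grid_avoid z ?S (mesh n) t)"
        using A[of n] by (intro finite_measure_mono) auto
      also have "\<dots> = C.prob (grid_avoid z ?S (mesh n) t)" using A[of n] by simp
      also have "\<dots> \<le> C.prob ((grid_avoid z ?S (mesh n) t \<inter> ?L) \<union> ?H)"
      proof (rule C.finite_measure_mono)
        show "grid_avoid z ?S (mesh n) t \<subseteq> (grid_avoid z ?S (mesh n) t \<inter> ?L) \<union> ?H"
        proof
          fix \<omega> assume "\<omega> \<in> grid_avoid z ?S (mesh n) t"
          moreover from this have "\<omega> \<in> space (P z)" using sets.sets_into_space[OF A[of n]] by blast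
          ultimately show "\<omega> \<in> (grid_avoid z ?S (mesh n) t \<inter> ?L) \<union> ?H"
            by (cases "exit_time z \<omega> < t") (simp_all only: Un_iff Int_iff mem_Collect_eq not_less simp_thms)
        qed
      qed (intro sets.Un sets.Int L H sets_completionI_sets A)
      also have "\<dots> \<le> C.prob (grid_avoid z ?S (mesh n) t \<inter> ?L) + C.prob ?H"
        by (intro measure_Un_le sets.Int L H sets_completionI_sets A)
      also have "C.prob ?H \<le> G t" using exit_time_tail[OF t, of z] True by (simp add: G_def delta_def)
      finally show ?thesis by simp
    qed
    then have "max (?e n t - G t) 0 \<le> C.prob (grid_avoid z ?S (mesh n) t \<inter> ?L)" for n by simp
    then show ?thesis
      by (intro tendsto_sandwich[OF _ _ tendsto_const lim] always_eventually allI) auto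
  qed
  have nn: "0 \<le> w z / (w z + l) * (\<Sum>\<^sub>\<infinity>x. cond z x / tc z * R l x y)" "0 \<le> delta y z / (w z + l)"
    using w_pos[of z] wl
    by (intro mult_nonneg_nonneg infsum_nonneg divide_nonneg_pos R_nonneg cond_nonneg tc_pos;
        simp add: delta_def)+
  have "ennreal (R l z y) \<le> (\<integral>\<^sup>+\<omega>. ennreal (exp (- l * exit_time z \<omega>) * R l (the (X z (exit_time z \<omega>) \<omega>)) y) \<partial>P z)
      + ennreal (laplace l G)"
    by (rule laplace_stopped[OF l exit_first_entry Gbm G0 rest])
  also have "(\<integral>\<^sup>+\<omega>. ennreal (exp (- l * exit_time z \<omega>) * R l (the (X z (exit_time z \<omega>) \<omega>)) y) \<partial>P z)
      = ennreal (w z / (w z + l) * (\<Sum>\<^sub>\<infinity>x. cond z x / tc z * R l x y))"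
    unfolding exit_state_def[symmetric] by (rule expectation_exit[OF l R_nonneg R_le[OF l]])
  also have "\<dots> + ennreal (laplace l G)
      = ennreal (w z / (w z + l) * (\<Sum>\<^sub>\<infinity>x. cond z x / tc z * R l x y) + delta y z / (w z + l))"
    unfolding lG by (rule ennreal_plus[symmetric, OF nn])
  finally have "R l z y \<le> w z / (w z + l) * (\<Sum>\<^sub>\<infinity>x. cond z x / tc z * R l x y) + delta y z / (w z + l)"
    by (simp only: ennreal_le_iff[OF add_nonneg_nonneg[OF nn]])
  from mult_left_mono[OF this less_imp_le[OF wl]]
  show ?thesis using wl by (simp add: distrib_left)
qed

text \<open>This is \<open>exit_inequality\<close> multiplied by the speed weight
  \<open>tc z / w z\<close>, which turns jump rates into conductances.\<close>

lemma resolvent_generator_le: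
  assumes l: "0 < l"
  shows "l * (tc z / w z) * R l z y + (\<Sum>\<^sub>\<infinity>x. cond z x * (R l z y - R l x y)) \<le> tc z / w z * delta y z"
proof -
  have s: "(\<lambda>x. cond z x * R l x y) summable_on UNIV"
  proof (rule summable_real_bound[OF summable_on_cmult_left[OF cond_summable[of z], of "1 / l"]])
    show "\<bar>cond z x * R l x y\<bar> \<le> cond z x * (1 / l)" for x
      using R_nonneg[of l x y] R_le[OF l, of x y] by (simp only: abs_mult abs_of_nonneg cond_nonneg mult_left_mono)
  qed
  have "(\<Sum>\<^sub>\<infinity>x. cond z x * (R l z y - R l x y)) = (\<Sum>\<^sub>\<infinity>x. R l z y * cond z x - cond z x * R l x y)"
    by (simp add: algebra_simps)
  also have "\<dots> = R l z y * tc z - (\<Sum>\<^sub>\<infinity>x. cond z x * R l x y)"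
    unfolding tc_eq
    by (rule infsumI, rule has_sum_diff) (intro has_sum_cmult_right has_sum_infsum cond_summable s)+
  finally have 1: "(\<Sum>\<^sub>\<infinity>x. cond z x * (R l z y - R l x y)) = R l z y * tc z - (\<Sum>\<^sub>\<infinity>x. cond z x * R l x y)" .
  have "(\<Sum>\<^sub>\<infinity>x. cond z x / tc z * R l x y) = (\<Sum>\<^sub>\<infinity>x. 1 / tc z * (cond z x * R l x y))" by simp
  also have "\<dots> = 1 / tc z * (\<Sum>\<^sub>\<infinity>x. cond z x * R l x y)" by (rule infsum_cmult_right')
  finally have 2: "(w z + l) * R l z y \<le> w z * (1 / tc z * (\<Sum>\<^sub>\<infinity>x. cond z x * R l x y)) + delta y z"
    using exit_inequality[OF l, of z y] by simp
  have 3: "tc z / w z * ((w z + l) * R l z y)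
      \<le> tc z / w z * (w z * (1 / tc z * (\<Sum>\<^sub>\<infinity>x. cond z x * R l x y)) + delta y z)"
    using 2 w_pos[of z] tc_pos[of z] by (intro mult_left_mono) auto
  have "tc z / w z * ((w z + l) * R l z y) = tc z * R l z y + l * (tc z / w z) * R l z y"
    using w_pos[of z] by (simp add: field_simps)
  moreover have "tc z / w z * (w z * (1 / tc z * (\<Sum>\<^sub>\<infinity>x. cond z x * R l x y)) + delta y z)
      = (\<Sum>\<^sub>\<infinity>x. cond z x * R l x y) + tc z / w z * delta y z"
    using w_pos[of z] tc_pos[of z] by (simp add: field_simps)
  ultimately show ?thesis using 3 unfolding 1 mult.commute[of "R l z y" "tc z"] by linarith
qed

end

theorem proposition3p15:
  fixes E :: "'v set set" and c :: "'v set \<Rightarrow> real"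
    and w0 w :: "'v \<Rightarrow> real"
    and P :: "'v \<Rightarrow> 'w measure" and X :: "'v \<Rightarrow> real \<Rightarrow> 'w \<Rightarrow> 'v option"
    and m :: "'v measure"
  assumes "conductance_graph E c"
    and "infinite (UNIV :: 'v set)" and "countable (UNIV :: 'v set)"
    and "graph_connected E"
    and "finite_total_conductance E c"
    and "reflection_threshold E c w0"
    and "\<And>x. w0 x \<le> w x"
    and "reflected_walk E c w P X"
    and "m = speed_measure E c w"
  shows "dirichlet_domain m P X = reflected_dirichlet_space E c \<inter> L2 m \<and>
    energy_orthogonal_sum E c (reflected_dirichlet_space E c)
      (extended_dirichlet_space E c) (finite_energy_harmonic E c) \<and>
    (\<forall>f\<in>dirichlet_domain m P X.
       energy E c f < \<infinity> \<and> dirichlet_form m P X f = enn2real (energy E c f))"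
proof -
  interpret conductance_graph E c by fact
  interpret reflected_walk E c w P X by fact
  \<comment> \<open>The threshold is strictly positive, and \<open>w\<close> dominates it.\<close>
  have w_pos: "0 < w x" for x
    using assms(6,7) unfolding reflection_threshold_def by (meson less_le_trans)
  interpret network E c by unfold_locales (fact assms)+
  interpret reflected_walk_network E c w P X by unfold_locales (rule w_pos)
  define mm where "mm x = tc x / w x" for x
  interpret reflected_transition E c mm "transition_prob P X"
  proof unfold_locales
    show "0 < mm x" for x using tc_pos[of x] w_pos[of x] by (simp add: mm_def)
    show "R l x y \<le> min_energy_ext E c A (\<lambda>z. R l z y) x" if "0 < l" "finite A" "y \<in> A" for l A x y
      by (rule resolvent_le_min_energy_ext[OF that])
    show "l * mm z * R l z y + (\<Sum>\<^sub>\<infinity>x. cond z x * (R l z y - R l x y)) \<le> mm z * delta y z" if "0 < l" for l z y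
      unfolding mm_def by (rule resolvent_generator_le[OF that])
  qed
  have m: "m = weighted_network.m mm"
    by (simp add: assms(9) speed_measure_def m_def mm_def)
  \<comment> \<open>For \<open>t > 0\<close> the approximating form of the semigroup is a rescaled
    \<open>jump_form\<close>; only such \<open>t\<close> matter for the limit at 0 from the
    right.\<close>
  have form: "approx_form m P X f t = jump_form (transition_prob P X t) f / t"
    if "f \<in> L2 m" "0 < t" for f t
    using sym_kernel_form(4)[OF sym_kernel_p[of t] that(1)[unfolded m]] that(2)
    by (simp add: approx_form_def semigroup_op_def m)
  have lim_iff: "(approx_form m P X f \<longlongrightarrow> L) (at_right 0)
      \<longleftrightarrow> ((\<lambda>t. jump_form (transition_prob P X t) f / t) \<longlongrightarrow> L) (at_right 0)" if "f \<in> L2 m" for f L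
    by (rule filterlim_cong[OF refl refl])
      (use form[OF that] eventually_at_right_less[of 0] in \<open>auto elim: eventually_mono\<close>)
  \<comment> \<open>A real limit bounds the energy, by \<open>energy_le_limit\<close>; conversely,
    finite energy makes the limit exist.\<close>
  have dom: "f \<in> dirichlet_domain m P X \<longleftrightarrow> f \<in> L2 m \<and> finite_energy f" for f
    unfolding dirichlet_domain_def
    using lim_iff[of f] energy_le_limit[of f] jump_form_tendsto_energy[of f] by (auto simp: m)
  have "dirichlet_form m P X f = enn2real (energy E c f)" if "f \<in> dirichlet_domain m P X" for f
  proof -
    have f: "f \<in> L2 m" "finite_energy f" using that dom by auto
    have "(approx_form m P X f \<longlongrightarrow> EE f f) (at_right 0)"
      unfolding lim_iff[OF f(1)] using jump_form_tendsto_energy f by (simp add: m)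
    then have "dirichlet_form m P X f = EE f f"
      unfolding dirichlet_form_def by (intro tendsto_Lim) simp_all
    then show ?thesis by (simp add: energy_eq_EE[OF f(2)] EE_nonneg)
  qed
  then show ?thesis
    using energy_orthogonal_sum dom
    by (auto simp: reflected_dirichlet_space_def finite_energy_iff)
qed

end
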